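(* Given a Coxeter group $W$, for any distinct $i,j\in I$ with $m:=m_{ij}\ge 2$ and any $w\in W$ such that $\ell(ws_i)=\ell(w)+1$ and $\ell(ws_j)=\ell(w)+1$, the following relations hold in $\mathbf{D}(W)$ for all divisors $n$ of $m$ and all $r\in[1,n]$ (where we abbreviate $D_k:=D_{w\cdot\underbrace{s_is_j\cdots}_{2k-1}\cdot w^{-1}}\in\mathbf{D}(W)$, $k=1,\ldots,m$): (a) Quadratic-linear relations (for $1\le p<\frac{m}{2n}$): $$\sum_{0\le a<b<\frac{m}{n}:\,b-a=\frac{m}{n}-p}D_{r+an}D_{r+bn}=\sum_{0\le a'<b'<\frac{m}{n}:\,b'-a'=p}D_{r+b'n}D_{r+a'n}-\sum_{p\le c<\frac{m}{n}-p}D_{r+cn},$$ $$\sum_{0\le a<b<\frac{m}{n}:\,b-a=\frac{m}{n}-p}D_{r+bn}D_{r+an}=\sum_{0\le a'<b'<\frac{m}{n}:\,b'-a'=p}D_{r+a'n}D_{r+b'n}-\sum_{p\le c<\frac{m}{n}-p}D_{r+cn}.$$ (b) Yang-Baxter type relations (for $0\le t\le\frac{m}{n}$): $$\overset{\longrightarrow}{\prod_{t\le a\le\frac{m}{n}-1}}(1-D_{r+an})\ \overset{\longrightarrow}{\prod_{0\le b\le t-1}}D_{r+bn}=\overset{\longleftarrow}{\prod_{0\le b\le t-1}}D_{r+bn}\ \overset{\longleftarrow}{\prod_{t\le a\le\frac{m}{n}-1}}(1-D_{r+an}).$$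
   Context: $\overset{\longrightarrow}{\prod}$ (resp. $\overset{\longleftarrow}{\prod}$) denotes the product with factors written from left to right in increasing (resp. decreasing) order of the index; empty products are $1$. $\underbrace{s_is_j\cdots}_{2k-1}$ is the alternating product of $2k-1$ factors starting with $s_i$; it is a reflection. A Coxeter group $W$ is generated by $s_i$, $i\in I$, subject to relations $(s_is_j)^{m_{ij}}=1$, where $m_{ij}=m_{ji}\in\mathbb{Z}_{\ge 0}$ are such that $m_{ij}=1$ iff $i=j$ ($m_{ij}=0$ imposes no relation). $\ell$ is the length function. $\hat{\mathbf{H}}(W)$ is the (unital associative) $\mathbb{Z}$-algebra generated by $s_i,D_i$, $i\in I$, subject to relations: (i) $s_i^2=1$, $D_i^2=D_i$, $s_iD_i+D_is_i=s_i-1$ for $i\in I$; (ii) $(s_is_j)^{m_{ij}}=1$; (iii) $\underbrace{D_is_js_i\cdots s_{j'}}_{m_{ij}}=\underbrace{s_j\cdots s_{i'}s_{j'}D_{i'}}_{m_{ij}}$ for all distinct $i,j\in I$ with $m_{ij}\ne 0$, where $i'=i$ if $m_{ij}$ is even, $i'=j$ if $m_{ij}$ is odd, and $\{i',j'\}=\{i,j\}$ (each side has $m_{ij}$ factors with indices alternating between $i$ and $j$). It is a Hopf algebra over $\mathbb{Z}$ with $\Delta(s_i)=s_i\otimes s_i$, $\Delta(D_i)=D_i\otimes 1+s_i\otimes D_i$, $\varepsilon(s_i)=1$, $\varepsilon(D_i)=0$. $\mathcal{S}:=\{us_iu^{-1}\mid u\in W,i\in I\}$. For each $s\in\mathcal{S}$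 there is a unique $D_s\in\hat{\mathbf{H}}(W)$ such that $D_{s_i}=D_i$ (the generator) for $i\in I$ and $D_{s_iss_i}=s_iD_ss_i$ for any $i\in I$, $s\in\mathcal{S}\setminus\{s_i\}$. $\hat{\mathbf{D}}(W)$ is the subalgebra of $\hat{\mathbf{H}}(W)$ generated by all $D_s$, $s\in\mathcal{S}$, and $\mathbf{K}(W):=\bigcap_{u\in W}u\hat{\mathbf{D}}(W)u^{-1}$. For $J\subset I$, $W_J$ is the (Coxeter) subgroup generated by $s_j$, $j\in J$; $\hat{\mathbf{D}}(W_J)$ is identified with the subalgebra of $\hat{\mathbf{D}}(W)$ generated by all $D_s$ with $s\in\mathcal{S}\cap W_J$. $\hat{\mathbf{D}}(W)$ is filtered by $\deg D_s=1$ (degree at most $d$ means: lies in the $\mathbb{Z}$-span of products of at most $d$ of the $D_s$). For distinct $i,j\in I$, $\mathbf{K}_{ij}(W)$ is the set of all elements of $\mathbf{K}(W_{\{i,j\}})\cap\operatorname{Ker}\varepsilon$ having degree at most $m_{ij}$. $\mathbf{H}(W)=\hat{\mathbf{H}}(W)/\underline{\mathbf{J}}(W)$, where $\underline{\mathbf{J}}(W)$ is the ideal generated by all $\mathbf{K}_{ij}(W)$, $i\ne j$. $\mathbf{D}(W)$ is the image of $\hat{\mathbf{D}}(W)$ in $\mathbf{H}(W)$; the images of $D_s$ are denoted by the same symbols. *)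

theory Defs
  imports "HOL-Library.Poly_Mapping" "HOL-Algebra.QuotRing" "HOL-Algebra.Generated_Rings"
    "HOL-Algebra.Generated_Groups"
begin

section \<open>Coxeter groups\<close>

definition coxeter_matrix :: "('i \<Rightarrow> 'i \<Rightarrow> nat) \<Rightarrow> bool" where
  "coxeter_matrix m \<longleftrightarrow> (\<forall>i j. m i j = m j i) \<and> (\<forall>i j. m i j = 1 \<longleftrightarrow> i = j)"

text \<open>The index set \<open>I\<close> is the type \<open>'i\<close>. The congruence below is the one generated by the
  relations \<open>(s\<^sub>i s\<^sub>j)^(m i j) = 1\<close> on the free monoid of words. Since \<open>m i i = 1\<close> makes
  every generator an involution, the quotient monoid is already the group with this presentation;
  for \<open>m i j = 0\<close> the relator is the empty word.\<close>

inductive cox_cong :: "('i \<Rightarrow> 'i \<Rightarrow> nat) \<Rightarrow> 'i list \<Rightarrow> 'i list \<Rightarrow> bool" for m where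
  relator: "cox_cong m (u @ concat (replicate (m i j) [i, j]) @ v) (u @ v)"
| refl: "cox_cong m u u"
| sym: "cox_cong m u v \<Longrightarrow> cox_cong m v u"
| trans: "cox_cong m u v \<Longrightarrow> cox_cong m v x \<Longrightarrow> cox_cong m u x"

definition cox_class :: "('i \<Rightarrow> 'i \<Rightarrow> nat) \<Rightarrow> 'i list \<Rightarrow> 'i list set" where
  "cox_class m u = {v. cox_cong m u v}"

definition coxeter_group :: "('i \<Rightarrow> 'i \<Rightarrow> nat) \<Rightarrow> 'i list set monoid" where
  "coxeter_group m =
     \<lparr>carrier = range (cox_class m),
      mult = (\<lambda>X Y. \<Union>x\<in>X. \<Union>y\<in>Y. cox_class m (x @ y)),
      one = cox_class m []\<rparr>"

definition cox_gen :: "('i \<Rightarrow> 'i \<Rightarrow> nat) \<Rightarrow> 'i \<Rightarrow> 'i list set" where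
  "cox_gen m i = cox_class m [i]"

definition cox_length :: "('i \<Rightarrow> 'i \<Rightarrow> nat) \<Rightarrow> 'i list set \<Rightarrow> nat" where
  "cox_length m w = (LEAST l. \<exists>u\<in>w. length u = l)"

definition reflections :: "('i \<Rightarrow> 'i \<Rightarrow> nat) \<Rightarrow> 'i list set set" where
  "reflections m =
     {u \<otimes>\<^bsub>coxeter_group m\<^esub> cox_gen m i \<otimes>\<^bsub>coxeter_group m\<^esub> inv\<^bsub>coxeter_group m\<^esub> u
        | u i. u \<in> carrier (coxeter_group m)}"

definition parabolic :: "('i \<Rightarrow> 'i \<Rightarrow> nat) \<Rightarrow> 'i set \<Rightarrow> 'i list set set" where
  "parabolic m J = generate (coxeter_group m) (cox_gen m ` J)"

fun alternating :: "'i \<Rightarrow> 'i \<Rightarrow> nat \<Rightarrow> 'i list" where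
  "alternating i j 0 = []"
| "alternating i j (Suc k) = i # alternating j i k"


section \<open>The free ring on the generators\<close>

text \<open>Words form a monoid under concatenation; finitely supported integer-valued functions on
  words, with convolution product, are then the free associative unital ring.\<close>

instantiation list :: (type) monoid_add
begin

definition zero_list :: "'a list" where "zero_list = []"

definition plus_list :: "'a list \<Rightarrow> 'a list \<Rightarrow> 'a list" where "plus_list = (@)"

instance by standard (simp_all add: zero_list_def plus_list_def)

end

datatype 'i gen = Sgen 'i | Dgen 'i

type_synonym 'i free = "'i gen list \<Rightarrow>\<^sub>0 int"

definition free_alg :: "'i free ring" where
  "free_alg = \<lparr>carrier = UNIV, mult = (*), one = 1, zero = 0, add = (+)\<rparr>"

definition monomial :: "'i gen list \<Rightarrow> 'i free" where
  "monomial u = Poly_Mapping.single u 1"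

lemma ring_free_alg: "ring free_alg"
proof (rule ringI)
  show "abelian_group (free_alg :: 'i free ring)"
  proof (rule abelian_groupI)
    fix x :: "'i free"
    show "\<exists>y\<in>carrier free_alg. y \<oplus>\<^bsub>free_alg\<^esub> x = \<zero>\<^bsub>free_alg\<^esub>"
      by (rule bexI [of _ "- x"]) (simp_all add: free_alg_def)
  qed (simp_all add: free_alg_def ac_simps)
  show "Group.monoid (free_alg :: 'i free ring)"
    by (rule monoidI) (simp_all add: free_alg_def mult.assoc)
qed (simp_all add: free_alg_def algebra_simps)

lemma monomial_mult: "monomial u * monomial v = monomial (u @ v)"
  by (simp add: monomial_def mult_single plus_list_def)

lemma monomial_Nil: "monomial [] = 1"
  by (simp add: monomial_def flip: zero_list_def)


section \<open>The Hopf algebra \<open>Hhat(W)\<close>\<close>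

definition Hhat_rels :: "('i \<Rightarrow> 'i \<Rightarrow> nat) \<Rightarrow> 'i free set" where
  "Hhat_rels m =
     (\<Union>i. {monomial [Sgen i, Sgen i] - 1,
           monomial [Dgen i, Dgen i] - monomial [Dgen i],
           monomial [Sgen i, Dgen i] + monomial [Dgen i, Sgen i] - (monomial [Sgen i] - 1)})
   \<union> {monomial (concat (replicate (m i j) [Sgen i, Sgen j])) - 1 | i j. True}
   \<union> {monomial (Dgen i # map Sgen (alternating j i (m i j - 1)))
        - monomial (map Sgen (alternating j i (m i j - 1)) @ [Dgen (if even (m i j) then i else j)])
        | i j. i \<noteq> j \<and> m i j \<noteq> 0}"

definition Hhat :: "('i \<Rightarrow> 'i \<Rightarrow> nat) \<Rightarrow> 'i free set ring" where
  "Hhat m = free_alg Quot (Idl\<^bsub>free_alg\<^esub> (Hhat_rels m))"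

lemma ring_Hhat: "ring (Hhat m)"
  unfolding Hhat_def
  by (intro ideal.quotient_is_ring ring.genideal_ideal ring_free_alg) (simp add: free_alg_def)

definition to_Hhat :: "('i \<Rightarrow> 'i \<Rightarrow> nat) \<Rightarrow> 'i free \<Rightarrow> 'i free set" where
  "to_Hhat m x = (Idl\<^bsub>free_alg\<^esub> (Hhat_rels m)) +>\<^bsub>free_alg\<^esub> x"

text \<open>The homomorphism from \<open>W\<close> to the units of \<open>Hhat(W)\<close>; its value does not depend on the
  word chosen in the class.\<close>

definition W_Hhat :: "('i \<Rightarrow> 'i \<Rightarrow> nat) \<Rightarrow> 'i list set \<Rightarrow> 'i free set" where
  "W_Hhat m w = the_elem ((\<lambda>u. to_Hhat m (monomial (map Sgen u))) ` w)"

primrec counit_gen :: "'i gen \<Rightarrow> int" where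
  "counit_gen (Sgen i) = 1"
| "counit_gen (Dgen i) = 0"

definition counit_free :: "'i free \<Rightarrow> int" where
  "counit_free p = (\<Sum>u\<in>Poly_Mapping.keys p. Poly_Mapping.lookup p u * prod_list (map counit_gen u))"

text \<open>\<^const>\<open>counit_free\<close> vanishes on \<^const>\<open>Hhat_rels\<close>, hence is constant on cosets.\<close>

definition counit :: "'i free set \<Rightarrow> int" where
  "counit X = the_elem (counit_free ` X)"

definition refl_D :: "('i \<Rightarrow> 'i \<Rightarrow> nat) \<Rightarrow> 'i list set \<Rightarrow> 'i free set" where
  "refl_D m = (THE f. f \<in> reflections m \<rightarrow>\<^sub>E carrier (Hhat m) \<and>
     (\<forall>i. f (cox_gen m i) = to_Hhat m (monomial [Dgen i])) \<and>
     (\<forall>i. \<forall>s \<in> reflections m - {cox_gen m i}.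
        f (cox_gen m i \<otimes>\<^bsub>coxeter_group m\<^esub> s \<otimes>\<^bsub>coxeter_group m\<^esub> cox_gen m i)
        = to_Hhat m (monomial [Sgen i]) \<otimes>\<^bsub>Hhat m\<^esub> f s \<otimes>\<^bsub>Hhat m\<^esub> to_Hhat m (monomial [Sgen i])))"

text \<open>\<open>Dhat(W\<^sub>J)\<close> and \<open>K(W\<^sub>J)\<close> are taken inside \<open>Hhat(W)\<close>; \<open>J = UNIV\<close> gives
  \<open>Dhat(W)\<close> and \<open>K(W)\<close>.\<close>

definition Dhat :: "('i \<Rightarrow> 'i \<Rightarrow> nat) \<Rightarrow> 'i set \<Rightarrow> 'i free set set" where
  "Dhat m J = generate_ring (Hhat m) (refl_D m ` (reflections m \<inter> parabolic m J))"

definition K_alg :: "('i \<Rightarrow> 'i \<Rightarrow> nat) \<Rightarrow> 'i set \<Rightarrow> 'i free set set" where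
  "K_alg m J = (\<Inter>u\<in>parabolic m J.
     (\<lambda>x. W_Hhat m u \<otimes>\<^bsub>Hhat m\<^esub> x \<otimes>\<^bsub>Hhat m\<^esub> W_Hhat m (inv\<^bsub>coxeter_group m\<^esub> u)) ` Dhat m J)"

text \<open>Product of the factors \<open>f x\<close> in a noncommutative ring, in the order of the list.\<close>

definition ordered_prod :: "('a, 'b) ring_scheme \<Rightarrow> ('c \<Rightarrow> 'a) \<Rightarrow> 'c list \<Rightarrow> 'a" where
  "ordered_prod R f xs = foldr (\<lambda>x y. f x \<otimes>\<^bsub>R\<^esub> y) xs \<one>\<^bsub>R\<^esub>"

definition degree_le :: "('i \<Rightarrow> 'i \<Rightarrow> nat) \<Rightarrow> nat \<Rightarrow> 'i free set set" where
  "degree_le m d = generate (add_monoid (Hhat m))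
     {ordered_prod (Hhat m) (refl_D m) ss | ss. set ss \<subseteq> reflections m \<and> length ss \<le> d}"

definition K2 :: "('i \<Rightarrow> 'i \<Rightarrow> nat) \<Rightarrow> 'i \<Rightarrow> 'i \<Rightarrow> 'i free set set" where
  "K2 m i j = {x \<in> K_alg m {i, j}. counit x = 0 \<and> x \<in> degree_le m (m i j)}"


section \<open>The Hecke-Hopf algebra \<open>H(W)\<close> and its subalgebra \<open>D(W)\<close>\<close>

definition J_ideal :: "('i \<Rightarrow> 'i \<Rightarrow> nat) \<Rightarrow> 'i free set set" where
  "J_ideal m = Idl\<^bsub>Hhat m\<^esub> (\<Union>i. \<Union>j\<in>- {i}. K2 m i j)"

definition Hecke_Hopf :: "('i \<Rightarrow> 'i \<Rightarrow> nat) \<Rightarrow> 'i free set set ring" where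
  "Hecke_Hopf m = Hhat m Quot J_ideal m"

definition to_H :: "('i \<Rightarrow> 'i \<Rightarrow> nat) \<Rightarrow> 'i free set \<Rightarrow> 'i free set set" where
  "to_H m x = J_ideal m +>\<^bsub>Hhat m\<^esub> x"

definition D_ring :: "('i \<Rightarrow> 'i \<Rightarrow> nat) \<Rightarrow> 'i free set set ring" where
  "D_ring m = (Hecke_Hopf m)\<lparr>carrier := to_H m ` Dhat m UNIV\<rparr>"

definition D_dihedral ::
    "('i \<Rightarrow> 'i \<Rightarrow> nat) \<Rightarrow> 'i list set \<Rightarrow> 'i \<Rightarrow> 'i \<Rightarrow> nat \<Rightarrow> 'i free set set" where
  "D_dihedral m w i j k = to_H m (refl_D m
     (w \<otimes>\<^bsub>coxeter_group m\<^esub> cox_class m (alternating i j (2 * k - 1))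
        \<otimes>\<^bsub>coxeter_group m\<^esub> inv\<^bsub>coxeter_group m\<^esub> w))"

end

theory Submission
  imports Defs Complex_Main "HOL-Algebra.IntRing"
begin

text \<open>Let \<open>s = s\<^sub>i\<close>. Conjugation by \<open>s\<close> permutes the \<open>D\<^sub>k\<close> of the dihedral subgroup
  \<open>W\<^sub>i\<^sub>j\<close> by \<open>k \<mapsto> m + 2 - k\<close> (mod \<open>m\<close>), except that \<open>s D\<^sub>1 s = 1 - s - D\<^sub>1\<close>. In the conjugate of
  the difference of the two sides of any of the relations for \<open>w = 1\<close>, the terms containing the
  extra \<open>s\<close> cancel, and what remains is again such a difference, for another residue class \<open>r\<close>,
  another \<open>t\<close>, or the chain read backwards. So these differences form a family in
  \<open>Dhat(W\<^sub>i\<^sub>j)\<close> stable under conjugation by \<open>W\<^sub>i\<^sub>j\<close>; they are killed by the counit and have degree at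
  most \<open>m\<close>, hence lie in \<open>K\<^sub>i\<^sub>j(W)\<close>. For general \<open>w\<close> conjugate by \<open>w\<close>: since \<open>w\<close> is the shortest
  element of \<open>w W\<^sub>i\<^sub>j\<close>, it inverts no reflection of \<open>W\<^sub>i\<^sub>j\<close>, and \<open>w D\<^sub>t w\<inverse> = D\<close> of \<open>w t w\<inverse>\<close>.

  That the \<open>D\<^sub>s\<close> are well defined, and that conjugation acts on them as claimed, rests on the exchange
  condition, obtained from the parity of the multiplicity of a reflection in a word, and on
  \<open>s\<^sub>i s\<^sub>j\<close> having order exactly \<open>m i j\<close>, obtained from the geometric representation.\<close>

text \<open>\<open>refl_D\<close> is a definite description, so nothing can be said of it before a
  solution is exhibited. The point at issue is that \<open>x s_i x^-1 = s_j\<close> should imply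
  \<open>x D_i = D_j x\<close> whenever \<open>x\<close> keeps the simple root of \<open>i\<close>
  positive. Relation (iii) says this only for one alternating word of length
  \<open>m i j - 1\<close>; the word calculus of the first half serves to factor every such
  \<open>x\<close> into steps of that kind.

  The reason why a divisor \<open>n\<close> of \<open>m\<close> may be chosen is that
  \<open>k \<mapsto> m + 2 - k\<close> permutes the residue classes mod \<open>n\<close>: it sends
  \<open>r\<close> to \<open>n + 2 - r\<close> and fixes the class of 1. Only that class contains
  \<open>D_1\<close>; on every other one conjugation by \<open>s_i\<close> is a mere renaming, so
  the whole calculation takes place in one abstract chain \<open>d 0, ..., d (q - 1)\<close> with
  \<open>q = m div n\<close>. There is no second calculation for \<open>s_j\<close>: exchanging
  \<open>i\<close> and \<open>j\<close> replaces \<open>k\<close> by \<open>m + 1 - k\<close>, which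
  preserves the family of relations.\<close>

section \<open>Inversions of words in a Coxeter group\<close>

text \<open>The parity of the number of positions \<open>p\<close> with \<open>a\<^sub>1\<dots>a\<^sub>p\<dots>a\<^sub>1 = t\<close> in the word
  \<open>a\<^sub>1\<dots>a\<^sub>k\<close>; unlike the number itself it depends only on the group element, and for a reflection
  \<open>t\<close> it is odd iff left multiplication by \<open>t\<close> shortens that element.\<close>

primrec word_parity :: "('i \<Rightarrow> 'i \<Rightarrow> nat) \<Rightarrow> 'i list \<Rightarrow> 'i list set \<Rightarrow> bool" where
  "word_parity m [] t = False"
| "word_parity m (a # u) t =
     ((t = cox_gen m a) \<noteq> word_parity m u (cox_gen m a \<otimes>\<^bsub>coxeter_group m\<^esub> t \<otimes>\<^bsub>coxeter_group m\<^esub> cox_gen m a))"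

section \<open>The presented group and its elements as classes of words\<close>

locale coxeter =
  fixes m :: "'i \<Rightarrow> 'i \<Rightarrow> nat"
  assumes coxeter_matrix: "coxeter_matrix m"
begin

abbreviation "W \<equiv> coxeter_group m"
abbreviation "cls \<equiv> cox_class m"
abbreviation "gen \<equiv> cox_gen m"
abbreviation "par \<equiv> word_parity m"

lemma m_sym: "m i j = m j i" and m_eq_1: "m i j = 1 \<longleftrightarrow> i = j"
  using coxeter_matrix by (auto simp: coxeter_matrix_def)

lemma cox_cong_context: "cox_cong m u v \<Longrightarrow> cox_cong m (a @ u @ b) (a @ v @ b)"
proof (induction rule: cox_cong.induct)
  case (relator u i j v)
  show ?case using cox_cong.relator [of m "a @ u" i j "v @ b"] by simp
next
  case (trans u v x)
  from cox_cong.trans [OF trans.IH] show ?case .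
qed (simp_all add: cox_cong.refl cox_cong.sym)

lemma cls_eq_iff: "cls u = cls v \<longleftrightarrow> cox_cong m u v"
proof
  assume "cls u = cls v"
  moreover have "v \<in> cls v" by (simp add: cox_class_def cox_cong.refl)
  ultimately have "v \<in> cls u" by simp
  then show "cox_cong m u v" by (simp add: cox_class_def)
next
  assume "cox_cong m u v"
  then have "cox_cong m u x \<longleftrightarrow> cox_cong m v x" for x
    using cox_cong.trans [of m u v x] cox_cong.trans [of m v u x] cox_cong.sym [of m u v] by argo
  then show "cls u = cls v" by (simp add: cox_class_def)
qed

lemma self_in_cls: "u \<in> cls u"
  by (simp add: cox_class_def cox_cong.refl)

lemma in_cls_iff: "v \<in> cls u \<longleftrightarrow> cls v = cls u"
proof -
  have "v \<in> cls u \<longleftrightarrow> cls u = cls v" by (simp add: cls_eq_iff) (simp add: cox_class_def)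
  then show ?thesis by auto
qed

lemma cls_append_cong:
  assumes "cls u = cls u'" "cls v = cls v'" shows "cls (u @ v) = cls (u' @ v')"
proof -
  have "cox_cong m (u @ v) (u' @ v)" "cox_cong m (u' @ v) (u' @ v')"
    using cox_cong_context [of u u' "[]" v] cox_cong_context [of v v' u' "[]"] assms
    unfolding cls_eq_iff by simp_all
  then show ?thesis
    unfolding cls_eq_iff by (rule cox_cong.trans)
qed

lemma cls_mult: "cls u \<otimes>\<^bsub>W\<^esub> cls v = cls (u @ v)"
proof -
  have "cls (x @ y) = cls (u @ v)" if "x \<in> cls u" "y \<in> cls v" for x y
    using that unfolding in_cls_iff by (rule cls_append_cong)
  then have "cls u \<otimes>\<^bsub>W\<^esub> cls v = (\<Union>x\<in>cls u. \<Union>y\<in>cls v. cls (u @ v))"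
    by (simp add: coxeter_group_def)
  moreover have "cls u \<noteq> {}" "cls v \<noteq> {}" using self_in_cls by blast+
  ultimately show ?thesis by simp
qed

lemma cls_one: "\<one>\<^bsub>W\<^esub> = cls []"
  by (simp add: coxeter_group_def)

lemma cls_closed [simp]: "cls u \<in> carrier W"
  by (simp add: coxeter_group_def)

lemma carrierE: assumes "t \<in> carrier W" obtains u where "t = cls u"
  using assms by (auto simp: coxeter_group_def)

lemma gen_eq: "gen i = cls [i]"
  by (simp add: cox_gen_def)

lemma gen_closed [simp]: "gen i \<in> carrier W"
  by (simp add: gen_eq)

text \<open>This is the relator for two equal indices, since \<open>m a a = 1\<close>.\<close>

lemma cls_square: "cls (u @ [a, a] @ v) = cls (u @ v)"
  using cox_cong.relator [of m u a a v] m_eq_1 [of a a] by (simp add: cls_eq_iff)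

lemma cls_rev: "cls (u @ rev u) = cls []"
proof (induction u)
  case (Cons a u)
  have "cls ((a # u) @ rev (a # u)) = cls ([a] @ (u @ rev u) @ [a])" by simp
  also have "\<dots> = cls ([a] @ [] @ [a])"
    by (rule cls_append_cong [OF HOL.refl cls_append_cong [OF Cons.IH HOL.refl]])
  also have "\<dots> = cls []" using cls_square [of "[]" a "[]"] by simp
  finally show ?case .
qed simp

lemma cls_rev': "cls (rev u @ u) = cls []"
  using cls_rev [of "rev u"] by simp

lemma group_W: "group W"
proof (rule groupI)
  fix x assume "x \<in> carrier W"
  then show "\<exists>y\<in>carrier W. y \<otimes>\<^bsub>W\<^esub> x = \<one>\<^bsub>W\<^esub>"
    by (metis carrierE cls_closed cls_mult cls_one cls_rev')
next
  fix x y z assume "x \<in> carrier W" "y \<in> carrier W" "z \<in> carrier W"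
  then show "x \<otimes>\<^bsub>W\<^esub> y \<otimes>\<^bsub>W\<^esub> z = x \<otimes>\<^bsub>W\<^esub> (y \<otimes>\<^bsub>W\<^esub> z)"
    by (metis append.assoc carrierE cls_mult)
next
  fix x y assume "x \<in> carrier W" "y \<in> carrier W"
  then show "x \<otimes>\<^bsub>W\<^esub> y \<in> carrier W"
    by (metis carrierE cls_mult cls_closed)
next
  fix x assume "x \<in> carrier W"
  then show "\<one>\<^bsub>W\<^esub> \<otimes>\<^bsub>W\<^esub> x = x"
    by (metis append_Nil carrierE cls_mult cls_one)
qed (simp add: cls_one)

sublocale W: group W by (rule group_W)

lemma inv_cls: "inv\<^bsub>W\<^esub> cls u = cls (rev u)"
  by (rule W.inv_equality) (simp_all add: cls_mult cls_rev' cls_one)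

lemma inv_gen: "inv\<^bsub>W\<^esub> gen i = gen i"
  unfolding gen_eq inv_cls by simp

lemma gen_gen: "gen i \<otimes>\<^bsub>W\<^esub> gen i = \<one>\<^bsub>W\<^esub>"
  using cls_square [of "[]" i "[]"] by (simp add: gen_eq cls_mult cls_one)

text \<open>Indexed by a word and not by its class, because parities and the images in
  \<open>Hhat m\<close> are defined on words; \<open>cj_cong\<close> gives independence of the
  word.\<close>

definition cj :: "'i list \<Rightarrow> 'i list set \<Rightarrow> 'i list set" where
  "cj u t = cls u \<otimes>\<^bsub>W\<^esub> t \<otimes>\<^bsub>W\<^esub> inv\<^bsub>W\<^esub> cls u"

lemma cj_closed [simp]: "t \<in> carrier W \<Longrightarrow> cj u t \<in> carrier W"
  by (simp add: cj_def)

lemma cj_append: "t \<in> carrier W \<Longrightarrow> cj (u @ v) t = cj u (cj v t)"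
  by (simp add: cj_def cls_mult [symmetric] W.inv_mult_group W.m_assoc)

lemma cj_Nil [simp]: "t \<in> carrier W \<Longrightarrow> cj [] t = t"
  by (simp add: cj_def cls_one [symmetric])

lemma cj_cls: "cj u (cls v) = cls (u @ v @ rev u)"
  by (simp add: cj_def inv_cls cls_mult)

lemma cj_gen: "cj u (gen a) = cls (u @ [a] @ rev u)"
  by (simp add: cj_cls gen_eq)

lemma cj_cong: "cls u = cls v \<Longrightarrow> cj u t = cj v t"
  by (simp add: cj_def)

lemma cj_rev [simp]: "t \<in> carrier W \<Longrightarrow> cj (rev u) (cj u t) = t"
  using cj_append [of t "rev u" u] cj_cong [OF cls_rev'] by simp

lemma cj_rev' [simp]: "t \<in> carrier W \<Longrightarrow> cj u (cj (rev u) t) = t"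
  using cj_rev [of t "rev u"] by simp

lemma cj_eq_iff: "s \<in> carrier W \<Longrightarrow> t \<in> carrier W \<Longrightarrow> cj u s = t \<longleftrightarrow> s = cj (rev u) t"
  by (metis cj_rev cj_rev')

lemma cj_single: "cj [a] t = gen a \<otimes>\<^bsub>W\<^esub> t \<otimes>\<^bsub>W\<^esub> gen a"
  by (simp add: cj_def inv_cls gen_eq)

lemma cj_single_gen [simp]: "cj [a] (gen a) = gen a"
  by (simp add: cj_single gen_gen)

lemma cj_mult: "t \<in> carrier W \<Longrightarrow> cj u t \<otimes>\<^bsub>W\<^esub> cls u = cls u \<otimes>\<^bsub>W\<^esub> t"
  by (simp add: cj_def W.m_assoc)

section \<open>Parities along words and the exchange condition\<close>

lemma par_Cons: "par (a # u) t \<longleftrightarrow> (t = gen a) \<noteq> par u (cj [a] t)"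
  by (simp add: cj_single)

declare word_parity.simps(2) [simp del]

text \<open>Cocycle rule: modulo 2, the reflections met along \<open>u @ v\<close> are those met
  along \<open>u\<close> and the \<open>u\<close>-conjugates of those met along
  \<open>v\<close>.\<close>

lemma par_append:
  "t \<in> carrier W \<Longrightarrow> par (u @ v) t \<longleftrightarrow> par u t \<noteq> par v (cj (rev u) t)"
proof (induction u arbitrary: t)
  case (Cons a u)
  have "cj (rev (a # u)) t = cj (rev u) (cj [a] t)" using Cons.prems by (simp add: cj_append)
  then show ?case using Cons.prems Cons.IH [of "cj [a] t"] by (auto simp: par_Cons)
qed simp

lemma par_single: "par [a] t \<longleftrightarrow> t = gen a"
  by (simp add: par_Cons)

lemma par_snoc: "t \<in> carrier W \<Longrightarrow> par (u @ [a]) t \<longleftrightarrow> par u t \<noteq> (t = cj u (gen a))"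
  using cj_eq_iff [of t "gen a" "rev u"] by (simp add: par_append par_single)

lemma alternating_snoc:
  "alternating i j (Suc n) = alternating i j n @ [if even n then i else j]"
  by (induction n arbitrary: i j) auto

lemma alternating_add:
  "alternating i j (k + n) = alternating i j k @ (if even k then alternating i j n else alternating j i n)"
  by (induction k arbitrary: i j) auto

lemma length_alternating [simp]: "length (alternating i j n) = n"
  by (induction n arbitrary: i j) auto

lemma set_alternating: "set (alternating i j n) \<subseteq> {i, j}"
  by (induction n arbitrary: i j) auto

text \<open>Lets an equality in \<open>W\<close> of the two alternating words of length
  \<open>n\<close> be read as \<open>(s_i s_j)^n = 1\<close>.\<close>

lemma alternating_rev: "alternating i j n @ rev (alternating j i n) = alternating i j (2 * n)"
proof (induction n arbitrary: i j)
  case (Suc n)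
  have "alternating i j (Suc n) @ rev (alternating j i (Suc n)) = i # (alternating j i n @ rev (alternating i j n)) @ [j]"
    by simp
  also have "\<dots> = i # alternating j i (2 * n) @ [j]" by (simp only: Suc.IH)
  also have "\<dots> = i # alternating j i (Suc (2 * n))" by (subst alternating_snoc) simp
  finally show ?case by simp
qed simp

lemma concat_replicate_alternating: "concat (replicate n [i, j]) = alternating i j (2 * n)"
  by (induction n) auto

definition rot :: "'i \<Rightarrow> 'i \<Rightarrow> 'i list set" where "rot i j = gen i \<otimes>\<^bsub>W\<^esub> gen j"

lemma rot_closed [simp]: "rot i j \<in> carrier W" by (simp add: rot_def)

lemma cls_alternating_even: "cls (alternating i j (2 * n)) = rot i j [^]\<^bsub>W\<^esub> n"
proof (induction n)
  case 0 show ?case by (simp add: cls_one)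
next
  case (Suc n)
  have "alternating i j (2 * Suc n) = alternating i j (2 * n) @ [i, j]"
    using alternating_snoc [of i j "Suc (2 * n)"] alternating_snoc [of i j "2 * n"] by simp
  then show ?case
    using Suc.IH by (simp add: cls_mult [symmetric] rot_def gen_eq) (simp add: cls_mult)
qed

lemma cls_alternating_odd: "cls (alternating i j (Suc (2 * n))) = rot i j [^]\<^bsub>W\<^esub> n \<otimes>\<^bsub>W\<^esub> gen i"
  by (subst alternating_snoc) (simp add: cls_mult [symmetric] cls_alternating_even gen_eq)

lemma rot_pow_m: "rot i j [^]\<^bsub>W\<^esub> m i j = \<one>\<^bsub>W\<^esub>"
  using cox_cong.relator [of m "[]" i j "[]"]
  by (simp add: cls_eq_iff [symmetric] concat_replicate_alternating cls_alternating_even cls_one)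

text \<open>The left side is the reflection met at position \<open>n\<close>, counted from 0, of the
  alternating word. So the reflections along such a word are \<open>rot i j ^ p * s_i\<close>,
  periodic in \<open>p\<close>.\<close>

lemma cj_alternating_gen:
  "cj (alternating i j n) (gen (if even n then i else j)) = rot i j [^]\<^bsub>W\<^esub> n \<otimes>\<^bsub>W\<^esub> gen i"
proof -
  have eq: "alternating i j n @ [if even n then i else j] @ rev (alternating i j n) = alternating i j (Suc (2 * n))" for i j
  proof (induction n arbitrary: i j)
    case (Suc n)
    have "alternating i j (Suc n) @ [if even (Suc n) then i else j] @ rev (alternating i j (Suc n))
       = i # (alternating j i n @ [if even n then j else i] @ rev (alternating j i n)) @ [i]"
      by simp
    also have "\<dots> = i # alternating j i (Suc (2 * n)) @ [i]" by (simp only: Suc.IH)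
    also have "\<dots> = i # alternating j i (Suc (Suc (2 * n)))"
      by (subst (2) alternating_snoc) simp
    finally show ?case by simp
  qed simp
  show ?thesis unfolding cj_gen eq cls_alternating_odd ..
qed

lemma par_alternating:
  "t \<in> carrier W \<Longrightarrow> par (alternating i j n) t \<longleftrightarrow>
     odd (card {p. p < n \<and> t = rot i j [^]\<^bsub>W\<^esub> p \<otimes>\<^bsub>W\<^esub> gen i})"
proof (induction n)
  case (Suc n)
  let ?S = "\<lambda>n. {p. p < n \<and> t = rot i j [^]\<^bsub>W\<^esub> p \<otimes>\<^bsub>W\<^esub> gen i}"
  have "?S (Suc n) = (if t = rot i j [^]\<^bsub>W\<^esub> n \<otimes>\<^bsub>W\<^esub> gen i then insert n (?S n) else ?S n)"
    by (auto simp: less_Suc_eq)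
  moreover have "finite (?S n)" "n \<notin> ?S n" by auto
  ultimately have "odd (card (?S (Suc n))) \<longleftrightarrow> odd (card (?S n)) \<noteq> (t = rot i j [^]\<^bsub>W\<^esub> n \<otimes>\<^bsub>W\<^esub> gen i)"
    by simp
  then show ?case
    using Suc.IH Suc.prems
    by (simp only: alternating_snoc par_snoc cj_alternating_gen)
qed simp

text \<open>The relator has \<open>2 * m i j\<close> letters, and the reflections met along it have
  period \<open>m i j\<close>, so each is met equally often in the two halves.\<close>

lemma par_relator:
  assumes "t \<in> carrier W" shows "\<not> par (concat (replicate (m i j) [i, j])) t"
proof -
  let ?M = "m i j" and ?f = "\<lambda>p. rot i j [^]\<^bsub>W\<^esub> p \<otimes>\<^bsub>W\<^esub> gen i"
  have per: "?f (?M + p) = ?f p" for p :: nat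
    by (simp add: W.nat_pow_mult [symmetric] rot_pow_m)
  let ?S = "{p. p < ?M \<and> t = ?f p}"
  have "{p. p < 2 * ?M \<and> t = ?f p} = ?S \<union> (\<lambda>p. ?M + p) ` ?S"
  proof (intro equalityI subsetI)
    fix p assume p: "p \<in> {p. p < 2 * ?M \<and> t = ?f p}"
    show "p \<in> ?S \<union> (\<lambda>p. ?M + p) ` ?S"
    proof (cases "p < ?M")
      case False
      then have "p = ?M + (p - ?M)" "p - ?M < ?M" using p by auto
      then show ?thesis using p per [of "p - ?M"] by (intro UnI2 image_eqI [of _ _ "p - ?M"]) auto
    qed (use p in auto)
  qed (auto simp: per)
  moreover have "card (?S \<union> (\<lambda>p. ?M + p) ` ?S) = card ?S + card ((\<lambda>p. ?M + p) ` ?S)"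
    by (rule card_Un_disjoint) auto
  moreover have "card ((\<lambda>p. ?M + p) ` ?S) = card ?S" by (rule card_image) auto
  ultimately show ?thesis
    using assms by (simp add: concat_replicate_alternating par_alternating)
qed

lemma par_cong: "cls u = cls v \<Longrightarrow> t \<in> carrier W \<Longrightarrow> par u t = par v t"
proof -
  assume "cls u = cls v"
  then have "cox_cong m u v" by (simp add: cls_eq_iff)
  then show "t \<in> carrier W \<Longrightarrow> par u t = par v t"
  proof (induction rule: cox_cong.induct)
    case (relator u i j v)
    let ?r = "concat (replicate (m i j) [i, j])"
    have "cj (rev ?r) (cj (rev u) t) = cj (rev u) t"
    proof -
      have "cls ?r = cls []"
        using cox_cong.relator [of m "[]" i j "[]"] by (simp add: cls_eq_iff)
      then have "cls (rev ?r) = cls []" using inv_cls [of ?r] inv_cls [of "[]"] by simp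
      from cj_cong [OF this] show ?thesis using relator by simp
    qed
    then show ?case
      using relator par_relator [of "cj (rev u) t" i j] by (simp add: par_append)
  qed auto
qed

text \<open>Strong exchange: an odd count is positive, and left multiplication by \<open>t\<close>
  deletes the first letter at which \<open>t\<close> is met. The inclusion of letter sets makes this
  usable inside parabolic subgroups.\<close>

lemma par_exchange:
  "t \<in> carrier W \<Longrightarrow> par u t \<Longrightarrow>
    \<exists>v. length v < length u \<and> set v \<subseteq> set u \<and> t \<otimes>\<^bsub>W\<^esub> cls u = cls v"
proof (induction u arbitrary: t)
  case (Cons a u)
  have au: "cls (a # u) = gen a \<otimes>\<^bsub>W\<^esub> cls u" for u by (simp add: gen_eq cls_mult)
  show ?case
  proof (cases "t = gen a")
    case True
    then have "t \<otimes>\<^bsub>W\<^esub> cls (a # u) = cls u"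
      by (simp add: au W.m_assoc [symmetric] gen_gen)
    then show ?thesis by (intro exI [of _ u]) auto
  next
    case False
    then obtain v where v: "length v < length u" "set v \<subseteq> set u" "cj [a] t \<otimes>\<^bsub>W\<^esub> cls u = cls v"
      using Cons.IH [of "cj [a] t"] Cons.prems by (auto simp: par_Cons)
    have "t \<otimes>\<^bsub>W\<^esub> cls (a # u) = gen a \<otimes>\<^bsub>W\<^esub> (cj [a] t \<otimes>\<^bsub>W\<^esub> cls u)"
      using Cons.prems(1) by (simp add: au cj_single W.m_assoc [symmetric] gen_gen)
    also have "\<dots> = cls (a # v)" by (simp add: v au)
    finally show ?thesis using v by (intro exI [of _ "a # v"]) auto
  qed
qed simp

lemma par_shorten:
  assumes "par u (gen a)"
  shows "\<exists>v. length v < length u \<and> set v \<subseteq> set u \<and> cls (a # u) = cls v"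
  using par_exchange [OF _ assms] by (simp add: gen_eq cls_mult)

section \<open>Reduced words and shortest coset representatives\<close>

definition reduced :: "'i set \<Rightarrow> 'i list \<Rightarrow> bool" where
  "reduced J u \<longleftrightarrow> set u \<subseteq> J \<and> (\<forall>v. set v \<subseteq> J \<longrightarrow> cls v = cls u \<longrightarrow> length u \<le> length v)"

lemma reduced_exists:
  assumes "set u \<subseteq> J" shows "\<exists>v. reduced J v \<and> cls v = cls u"
proof -
  obtain v where "set v \<subseteq> J \<and> cls v = cls u"
    and "\<And>x. set x \<subseteq> J \<and> cls x = cls u \<Longrightarrow> length v \<le> length x"
    using ex_has_least_nat [of "\<lambda>v. set v \<subseteq> J \<and> cls v = cls u" u length] assms by blast
  then show ?thesis unfolding reduced_def by metis
qed

text \<open>The first letter contributes \<open>s_a\<close> once, so an even total would leave an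
  odd one for \<open>y\<close>, and exchange would shorten \<open>a # y\<close>. Exchange introduces
  no new letters, which is why minimality among words over \<open>J\<close> is the right
  notion.\<close>

lemma reduced_par_first: assumes "reduced J (a # y)" shows "par (a # y) (gen a)"
proof (rule ccontr)
  assume "\<not> ?thesis"
  then have "par y (gen a)" by (simp add: par_Cons)
  then obtain v where "length v < length y" "set v \<subseteq> set y" "cls (a # y) = cls v"
    using par_shorten by blast
  then show False using assms unfolding reduced_def by fastforce
qed

lemma reduced_alternating:
  assumes "reduced {i, k} y" "y \<noteq> []" "hd y = i" shows "y = alternating i k (length y)"
  using assms
proof (induction y arbitrary: i k)
  case (Cons a y)
  have red: "reduced {k, i} y"
    unfolding reduced_def
  proof (intro conjI allI impI)
    show "set y \<subseteq> {k, i}" using Cons.prems by (auto simp: reduced_def)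
    fix v assume v: "set v \<subseteq> {k, i}" "cls v = cls y"
    then have "cls (a # v) = cls (a # y)" using cls_append_cong [of "[a]" "[a]" v y] by simp
    moreover have "set (a # v) \<subseteq> {i, k}" using Cons.prems v by auto
    ultimately have "length (a # y) \<le> length (a # v)"
      using Cons.prems(1) unfolding reduced_def by blast
    then show "length y \<le> length v" by simp
  qed
  show ?case
  proof (cases y)
    case Nil then show ?thesis using Cons.prems by simp
  next
    case (Cons b z)
    have "b \<noteq> a"
    proof
      assume "b = a"
      then have "cls z = cls (a # y)" using cls_square [of "[]" a z] Cons by simp
      then show False using \<open>reduced {i, k} (a # y)\<close> Cons unfolding reduced_def by fastforce
    qed
    then have "b = k" using red Cons Cons.prems by (auto simp: reduced_def)
    then show ?thesis using Cons.IH [OF red] Cons Cons.prems by simp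
  qed
qed simp

text \<open>Take \<open>z\<close> to be a shortest word representing an element of the coset
  \<open>W_J x\<close>. If it met an element of \<open>W_J\<close> an odd number of times, exchange
  would produce a shorter one.\<close>

lemma coset_representative:
  "\<exists>y z. set y \<subseteq> J \<and> cls x = cls (y @ z) \<and> (\<forall>u. set u \<subseteq> J \<longrightarrow> \<not> par z (cls u))
     \<and> (\<forall>y' z'. set y' \<subseteq> J \<longrightarrow> cls x = cls (y' @ z') \<longrightarrow> length z \<le> length z')"
proof -
  let ?P = "\<lambda>z. \<exists>y. set y \<subseteq> J \<and> cls x = cls (y @ z)"
  have "?P x" by (intro exI [of _ "[]"]) auto
  then obtain z where z: "?P z" "\<And>z'. ?P z' \<Longrightarrow> length z \<le> length z'"
    using ex_has_least_nat [of ?P x length] by blast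
  then obtain y where y: "set y \<subseteq> J" "cls x = cls (y @ z)" by blast
  have "\<not> par z (cls u)" if u: "set u \<subseteq> J" for u
  proof
    assume "par z (cls u)"
    then obtain z' where z': "length z' < length z" "cls u \<otimes>\<^bsub>W\<^esub> cls z = cls z'"
      using par_exchange [of "cls u" z] by auto
    \<comment> \<open>Insert \<open>rev u @ u\<close>: the part \<open>u @ z\<close> becomes
      \<open>z'\<close>, and \<open>rev u\<close> is absorbed into the factor over
      \<open>J\<close>.\<close>
    have "cls x = cls (y @ rev u @ u @ z)"
      using y cls_append_cong [of y y "rev u @ u @ z" z]
        cls_append_cong [OF cls_rev', of z z u] by simp
    also have "\<dots> = cls ((y @ rev u) @ z')"
      using cls_append_cong [of "y @ rev u" "y @ rev u" "u @ z" z'] z' by (simp add: cls_mult)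
    finally have "length z \<le> length z'" using y u by (intro z(2) exI [of _ "y @ rev u"]) auto
    then show False using z' by simp
  qed
  then show ?thesis using y z(2) by blast
qed

text \<open>For the last property, conjugation by \<open>y\<close> preserves \<open>W_J\<close>, so
  by the cocycle rule \<open>z\<close> contributes nothing to parities at elements of
  \<open>W_J\<close>.\<close>

lemma reduced_coset_representative:
  obtains y z where "reduced J y" "cls x = cls (y @ z)" "\<And>u. set u \<subseteq> J \<Longrightarrow> \<not> par z (cls u)"
    "\<And>y' z'. set y' \<subseteq> J \<Longrightarrow> cls x = cls (y' @ z') \<Longrightarrow> length z \<le> length z'"
    "\<And>u. set u \<subseteq> J \<Longrightarrow> par x (cls u) = par y (cls u)"
proof -
  obtain y0 z where yz: "set y0 \<subseteq> J" "cls x = cls (y0 @ z)" and z: "\<And>u. set u \<subseteq> J \<Longrightarrow> \<not> par z (cls u)"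
    "\<And>y' z'. set y' \<subseteq> J \<Longrightarrow> cls x = cls (y' @ z') \<Longrightarrow> length z \<le> length z'"
    using coset_representative [of J x] by metis
  obtain y where y: "reduced J y" "cls y = cls y0" using reduced_exists [OF yz(1)] by blast
  have x: "cls x = cls (y @ z)" using cls_append_cong [OF y(2), of z z] yz by simp
  have "par x (cls u) = par y (cls u)" if u: "set u \<subseteq> J" for u
  proof -
    have "\<not> par z (cls (rev y @ u @ y))"
      using y(1) u by (intro z) (auto simp: reduced_def)
    then show ?thesis
      using par_cong [OF x, of "cls u"] by (simp add: par_append cj_cls)
  qed
  then show ?thesis using that y x z by blast
qed

text \<open>On \<open>W_J\<close> the parities of \<open>x\<close> are those of its reduced factor
  \<open>y\<close> over \<open>J\<close>. A nonempty \<open>y\<close> would have its first letter as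
  a generator of odd parity, so \<open>y\<close> is empty. This is how two length conditions on
  \<open>w\<close> control all reflections of the dihedral subgroup.\<close>

lemma par_parabolic:
  assumes "\<And>a. a \<in> J \<Longrightarrow> \<not> par x (gen a)" "set u \<subseteq> J"
  shows "\<not> par x (cls u)"
proof -
  obtain y z where yz: "reduced J y" and p: "\<And>u. set u \<subseteq> J \<Longrightarrow> par x (cls u) = par y (cls u)"
    by (rule reduced_coset_representative [of J x]) blast
  have "y = []"
  proof (cases y)
    case (Cons a y')
    then have "a \<in> J" using yz by (auto simp: reduced_def)
    then show ?thesis
      using reduced_par_first [of J a y'] yz Cons assms(1) [of a] p [of "[a]"] by (simp add: gen_eq)
  qed
  then show ?thesis using p assms(2) by simp
qed

text \<open>Translates the length hypotheses into parities. Right multiplication by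
  \<open>s_a\<close> becomes left multiplication on the inverse, hence the reversed word; an odd
  parity would let exchange shorten it.\<close>

lemma par_right_descent:
  assumes "cox_length m (cls x \<otimes>\<^bsub>W\<^esub> gen a) = cox_length m (cls x) + 1"
  shows "\<not> par (rev x) (gen a)"
proof
  assume "par (rev x) (gen a)"
  have len: "cox_length m (cls v) \<le> length v" for v
    unfolding cox_length_def by (rule Least_le) (use self_in_cls in blast)
  have "\<exists>u\<in>cls x. length u = cox_length m (cls x)"
    unfolding cox_length_def by (rule LeastI [of _ "length x"]) (use self_in_cls in blast)
  then obtain u where u: "cls u = cls x" "length u = cox_length m (cls x)"
    by (auto simp: in_cls_iff)
  have "cls (rev u) = cls (rev x)" using inv_cls [of u] inv_cls [of x] u(1) by simp
  from par_cong [OF this, of "gen a"] have "par (rev u) (gen a)" using \<open>par (rev x) (gen a)\<close> by simp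
  then obtain v where v: "length v < length u" "cls (a # rev u) = cls v"
    using par_shorten by fastforce
  have "cls (rev v) = cls (u @ [a])"
    using inv_cls [of v] inv_cls [of "a # rev u"] v(2) by simp
  also have "\<dots> = cls x \<otimes>\<^bsub>W\<^esub> gen a" using u by (simp add: gen_eq cls_mult [symmetric])
  finally show False using assms u v(1) len [of "rev v"] by simp
qed

end

section \<open>The order of a product of two generators\<close>

text \<open>The contragredient of the geometric representation: \<open>f\<close> lists the values of a linear form on
  the simple roots. The case \<open>k = i\<close> is covered since \<open>m i i = 1\<close>, and \<open>m i k = 0\<close> gives
  \<open>cos (pi / 0) = cos 0 = 1\<close>, as required for infinite order.\<close>

definition geometric_act :: "('i \<Rightarrow> 'i \<Rightarrow> nat) \<Rightarrow> 'i \<Rightarrow> ('i \<Rightarrow> real) \<Rightarrow> 'i \<Rightarrow> real" where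
  "geometric_act m i f = (\<lambda>k. f k + 2 * cos (pi / real (m i k)) * f i)"

context coxeter
begin

abbreviation "act u f \<equiv> foldr (geometric_act m) u f"

text \<open>On the coordinates \<open>i\<close> and \<open>j\<close> the product of the two
  reflections is a rotation by \<open>2 * \<theta>\<close>, in non-orthogonal coordinates; any other
  coordinate accumulates their increments. The formulas are multiplied through by
  \<open>sin \<theta>\<close> or its square to avoid division. At \<open>n = m i j\<close> the angle
  is a full turn, which gives \<open>act_relator\<close>.\<close>

lemma act_alternating:
  fixes f :: "'i \<Rightarrow> real"
  assumes "i \<noteq> j" and "m i j \<ge> 2"
  defines "\<theta> \<equiv> pi / real (m i j)"
  defines "g \<equiv> \<lambda>n. act (alternating i j (2 * n)) f"
  shows "sin \<theta> * g n i = (sin \<theta> * cos (2 * real n * \<theta>) - cos \<theta> * sin (2 * real n * \<theta>)) * f i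
           - sin (2 * real n * \<theta>) * f j"
    and "sin \<theta> * g n j = sin (2 * real n * \<theta>) * f i
           + (sin (2 * real n * \<theta>) * cos \<theta> + cos (2 * real n * \<theta>) * sin \<theta>) * f j"
    and "k \<noteq> i \<Longrightarrow> k \<noteq> j \<Longrightarrow> (sin \<theta>)\<^sup>2 * g n k = (sin \<theta>)\<^sup>2 * f k
           + cos (pi / real (m j k)) * (f i * (cos \<theta> - cos (2 * real n * \<theta>) * cos \<theta> - sin (2 * real n * \<theta>) * sin \<theta>)
              + f j * (1 - cos (2 * real n * \<theta>)))
           + cos (pi / real (m i k)) * (f i * (1 - cos (2 * real n * \<theta>))
              + f j * (cos \<theta> - cos (2 * real n * \<theta>) * cos \<theta> + sin (2 * real n * \<theta>) * sin \<theta>))"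
proof -
  define s c where "s = sin \<theta>" and "c = cos \<theta>"
  define S C where "S = (\<lambda>n. sin (2 * real n * \<theta>))" and "C = (\<lambda>n. cos (2 * real n * \<theta>))"
  have "s * s + c * c = 1" by (simp add: s_def c_def flip: power2_eq_square)
  then have cc1: "c * c = 1 - s * s" by simp
  \<comment> \<open>The version with a trailing factor makes the reduction modulo
    \<open>c * c = 1 - s * s\<close> work inside right-nested products too.\<close>
  then have "c * (c * x) = x - s * (s * x)" for x
    by (simp only: mult.assoc [symmetric] cc1) (simp add: algebra_simps)
  note cc = cc1 this
  have ang: "2 * real (Suc n) * \<theta> = 2 * real n * \<theta> + (\<theta> + \<theta>)" for n by (simp add: algebra_simps)
  have SC: "S (Suc n) = S n * (c * c - s * s) + C n * (2 * s * c)"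
    "C (Suc n) = C n * (c * c - s * s) - S n * (2 * s * c)" for n
    unfolding S_def C_def s_def c_def ang
    by (simp_all only: sin_add cos_add) (simp_all add: algebra_simps)
  have S0: "S 0 = 0" "C 0 = 1" by (simp_all add: S_def C_def)
  have ones: "m i i = 1" "m j j = 1" using m_eq_1 by auto
  have step: "g (Suc n) i = - (g n i + 2 * c * g n j)"
    "g (Suc n) j = - g n j + 2 * c * (g n i + 2 * c * g n j)"
    "k \<noteq> i \<Longrightarrow> k \<noteq> j \<Longrightarrow> g (Suc n) k = g n k + 2 * cos (pi / real (m j k)) * g n j
        + 2 * cos (pi / real (m i k)) * (g n i + 2 * c * g n j)" for n k
    using assms(1) by (simp_all add: g_def geometric_act_def ones c_def \<theta>_def m_sym [of j i])
  have 1: "s * g n i = (s * C n - c * S n) * f i - S n * f j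
      \<and> s * g n j = S n * f i + (S n * c + C n * s) * f j" for n
  proof (induction n)
    case 0 show ?case by (simp add: S0 g_def)
  next
    case (Suc n)
    have "s * g (Suc n) i = - (s * g n i + 2 * c * (s * g n j))"
      "s * g (Suc n) j = - (s * g n j) + 2 * c * (s * g n i + 2 * c * (s * g n j))"
      by (simp_all add: step algebra_simps)
    moreover have "s * g n i = (s * C n - c * S n) * f i - S n * f j"
      "s * g n j = S n * f i + (S n * c + C n * s) * f j"
      using Suc.IH by auto
    ultimately have "s * g (Suc n) i = (s * C (Suc n) - c * S (Suc n)) * f i - S (Suc n) * f j"
      "s * g (Suc n) j = S (Suc n) * f i + (S (Suc n) * c + C (Suc n) * s) * f j"
      unfolding SC by (simp_all add: algebra_simps cc)
    then show ?case ..
  qed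
  then show "sin \<theta> * g n i = (sin \<theta> * cos (2 * real n * \<theta>) - cos \<theta> * sin (2 * real n * \<theta>)) * f i
           - sin (2 * real n * \<theta>) * f j"
    and "sin \<theta> * g n j = sin (2 * real n * \<theta>) * f i
           + (sin (2 * real n * \<theta>) * cos \<theta> + cos (2 * real n * \<theta>) * sin \<theta>) * f j"
    by (simp_all add: s_def c_def S_def C_def)
  have "s\<^sup>2 * g n k = s\<^sup>2 * f k
      + cos (pi / real (m j k)) * (f i * (c - C n * c - S n * s) + f j * (1 - C n))
      + cos (pi / real (m i k)) * (f i * (1 - C n) + f j * (c - C n * c + S n * s))"
    if "k \<noteq> i" "k \<noteq> j" for n k
  proof (induction n)
    case 0 show ?case by (simp add: S0 g_def)
  next
    case (Suc n)
    define \<alpha> \<beta> where "\<alpha> = cos (pi / real (m i k))" and "\<beta> = cos (pi / real (m j k))"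
    have "s\<^sup>2 * g (Suc n) k = s\<^sup>2 * g n k + 2 * \<beta> * s * (s * g n j) + 2 * \<alpha> * s * (s * g n i + 2 * c * (s * g n j))"
      by (simp add: step that \<alpha>_def \<beta>_def algebra_simps power2_eq_square)
    moreover have "s * g n i = (s * C n - c * S n) * f i - S n * f j"
      "s * g n j = S n * f i + (S n * c + C n * s) * f j"
      using 1 by auto
    ultimately show ?case
      using Suc.IH unfolding SC \<alpha>_def [symmetric] \<beta>_def [symmetric]
      by (simp add: algebra_simps power2_eq_square cc)
  qed
  then show "(sin \<theta>)\<^sup>2 * g n k = (sin \<theta>)\<^sup>2 * f k
           + cos (pi / real (m j k)) * (f i * (cos \<theta> - cos (2 * real n * \<theta>) * cos \<theta> - sin (2 * real n * \<theta>) * sin \<theta>)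
              + f j * (1 - cos (2 * real n * \<theta>)))
           + cos (pi / real (m i k)) * (f i * (1 - cos (2 * real n * \<theta>))
              + f j * (cos \<theta> - cos (2 * real n * \<theta>) * cos \<theta> + sin (2 * real n * \<theta>) * sin \<theta>))"
    if "k \<noteq> i" "k \<noteq> j" using that by (simp add: s_def c_def S_def C_def)
qed

lemma m_ge_2: "i \<noteq> j \<Longrightarrow> m i j \<noteq> 0 \<Longrightarrow> m i j \<ge> 2"
  using m_eq_1 [of i j] by linarith

lemma sin_pi_m: "m i j \<ge> 2 \<Longrightarrow> sin (pi / real (m i j)) > 0"
  by (intro sin_gt_zero) (auto simp: divide_less_eq)

lemma act_relator: "act (concat (replicate (m i j) [i, j])) f = f"
proof -
  consider "i = j" | "m i j = 0" | "i \<noteq> j" "m i j \<ge> 2" using m_ge_2 by blast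
  then show ?thesis
  proof cases
    case 1
    then have "m i j = 1" using m_eq_1 by simp
    then show ?thesis using 1 by (simp add: geometric_act_def)
  next
    case 3
    note a = act_alternating [OF 3, where f = f and n = "m i j"]
    have s: "sin (pi / real (m i j)) > 0" using sin_pi_m 3 by simp
    have t: "2 * real (m i j) * (pi / real (m i j)) = 2 * pi" using 3 by simp
    show ?thesis
    proof
      fix k show "act (concat (replicate (m i j) [i, j])) f k = f k"
        using a s unfolding t concat_replicate_alternating by (cases "k = i"; cases "k = j") auto
    qed
  qed simp
qed

lemma act_cong: "cls u = cls v \<Longrightarrow> act u f = act v f"
proof -
  assume "cls u = cls v"
  then have "cox_cong m u v" by (simp add: cls_eq_iff)
  then show ?thesis
    by (induction rule: cox_cong.induct) (simp_all add: act_relator)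
qed

lemma rot_order:
  assumes "i \<noteq> j" "n > 0" "rot i j [^]\<^bsub>W\<^esub> n = \<one>\<^bsub>W\<^esub>"
  shows "m i j > 0 \<and> m i j \<le> n"
proof (rule ccontr)
  assume con: "\<not> ?thesis"
  \<comment> \<open>The form dual to the simple root of \<open>j\<close>. As it vanishes on the root
    of \<open>i\<close>, its invariance forces \<open>sin (2 n \<theta>) = 0\<close> and
    \<open>cos (2 n \<theta>) = 1\<close> when \<open>m i j\<close> is nonzero.\<close>
  define f :: "'i \<Rightarrow> real" where "f = (\<lambda>k. if k = j then 1 else 0)"
  have "cls (alternating i j (2 * n)) = cls []" using assms by (simp add: cls_alternating_even cls_one)
  from act_cong [OF this] have id: "act (alternating i j (2 * n)) f = f" by simp
  have f: "f i = 0" "f j = 1" using assms(1) by (auto simp: f_def)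
  show False
  proof (cases "m i j = 0")
    case True
    have "m j j = 1" "m i i = 1" using m_eq_1 by auto
    \<comment> \<open>Here the cosine is 1, the rotation degenerates to a unipotent map, and the
      values of \<open>f\<close> drift linearly.\<close>
    then have "act (alternating i j (2 * n)) f i = - 2 * real n \<and> act (alternating i j (2 * n)) f j = 2 * real n + 1" for n
      using True m_sym [of j i] assms(1)
      by (induction n) (simp_all add: f geometric_act_def)
    from this [of n] show ?thesis using id f assms(2) by simp
  next
    case False
    then have m: "m i j \<ge> 2" "n < m i j" using con m_ge_2 assms(1) by auto
    define \<theta> where "\<theta> = pi / real (m i j)"
    have s: "sin \<theta> > 0" unfolding \<theta>_def using m by (intro sin_pi_m)
    note a = act_alternating(1,2) [OF assms(1) m(1), where f = f and n = n, folded \<theta>_def]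
    from a s have "sin (2 * real n * \<theta>) = 0" "cos (2 * real n * \<theta>) = 1"
      unfolding id f by auto
    then have "cos (2 * (real n * \<theta>)) = 1" by (simp add: mult.assoc)
    then have "sin (real n * \<theta>) = 0" by (simp add: cos_double_sin)
    moreover have "sin (real n * \<theta>) > 0"
      using m assms(2) by (intro sin_gt_zero) (auto simp: \<theta>_def divide_less_eq)
    ultimately show False by simp
  qed
qed

lemma gen_neq_one: "gen i \<noteq> \<one>\<^bsub>W\<^esub>"
proof
  assume "gen i = \<one>\<^bsub>W\<^esub>"
  then have "act [i] (\<lambda>_. 1) i = act [] (\<lambda>_. 1) i" by (subst act_cong [of "[i]" "[]"]) (simp_all add: gen_eq cls_one)
  moreover have "m i i = 1" using m_eq_1 by simp
  ultimately show False by (simp add: geometric_act_def)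
qed

lemma gen_inj: "gen i = gen j \<longleftrightarrow> i = j"
proof
  assume eq: "gen i = gen j"
  show "i = j"
  proof (rule ccontr)
    assume "i \<noteq> j"
    have "rot i j [^]\<^bsub>W\<^esub> (1::nat) = \<one>\<^bsub>W\<^esub>" using eq by (simp add: rot_def gen_gen)
    then show False using rot_order [OF \<open>i \<noteq> j\<close>, of 1] m_eq_1 [of i j] \<open>i \<noteq> j\<close> by simp
  qed
qed simp

text \<open>Since \<open>s_i\<close> is not a left descent, every reduced word of \<open>y\<close>
  starts with \<open>k\<close>, so \<open>y\<close> alternates. Then \<open>i # y\<close> and
  \<open>y @ [a]\<close> are the two alternating words of length \<open>p + 1\<close>, where
  \<open>p = length y\<close>; their equality gives \<open>(s_i s_k)^(p + 1) = 1\<close>, hence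
  \<open>m i k <= p + 1\<close>. If \<open>m i k <= p\<close>, a braid move on the first
  \<open>m i k\<close> letters would give a reduced word starting with \<open>i\<close>. The
  conclusion is exactly the situation of relation (iii).\<close>

lemma dihedral_conj_gen:
  assumes "i \<noteq> k" "reduced {i, k} y" "y \<noteq> []" "\<not> par y (gen i)" "a \<in> {i, k}"
    and eq: "gen i \<otimes>\<^bsub>W\<^esub> cls y = cls y \<otimes>\<^bsub>W\<^esub> gen a"
  shows "m i k > 0 \<and> y = alternating k i (m i k - 1) \<and> a = (if even (m i k) then i else k)"
proof -
  have first: "hd u = k" if "reduced {i, k} u" "u \<noteq> []" "cls u = cls y" for u
  proof (cases u)
    case (Cons b u')
    have "par y (gen b)"
      using reduced_par_first [of "{i, k}" b u'] par_cong [OF that(3), of "gen b"] that(1) Cons by simp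
    moreover have "b \<in> {i, k}" using that(1) Cons by (simp add: reduced_def)
    ultimately show ?thesis using assms(4) Cons by auto
  qed (use that in simp)
  define p where "p = length y"
  have red': "reduced {k, i} y" using assms(2) by (simp add: insert_commute)
  have y: "y = alternating k i p"
    unfolding p_def by (rule reduced_alternating [OF red' assms(3) first]) (use assms in auto)
  have p0: "p > 0" using assms(3) by (simp add: p_def)
  then obtain p' where p': "p = Suc p'" by (cases p) auto
  have "\<not> par y (gen i)" by fact
  \<comment> \<open>Otherwise \<open>a\<close> is the last letter of \<open>y\<close> and cancels in
    \<open>y s_a = s_i y\<close>; this rewrites \<open>y\<close> as the alternating word of the same
    length that starts with \<open>i\<close>.\<close>
  have a: "a = (if even p then k else i)"
  proof (rule ccontr)
    assume "a \<noteq> (if even p then k else i)"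
    then have "y = alternating k i p' @ [a]" using assms(5) unfolding y p' by (subst alternating_snoc) auto
    then have "cls y \<otimes>\<^bsub>W\<^esub> gen a = cls (alternating k i p')"
      using cls_square [of "alternating k i p'" a "[]"] by (simp add: gen_eq cls_mult)
    then have iy: "cls (i # y) = cls (alternating k i p')" using eq by (simp add: gen_eq cls_mult)
    have "cls y = cls (i # i # y)" using cls_square [of "[]" i y] by simp
    also have "\<dots> = cls (i # alternating k i p')" using cls_append_cong [of "[i]" "[i]", OF HOL.refl iy] by simp
    finally have "cls (alternating i k p) = cls y" by (simp add: p')
    moreover from this have "reduced {i, k} (alternating i k p)"
      using assms(2) set_alternating [of i k p] unfolding reduced_def by (simp add: p_def)
    ultimately have "hd (alternating i k p) = k" using p' by (intro first) simp_all
    then show False using assms(1) p' by simp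
  qed
  have "cls (alternating i k (Suc p)) = cls (alternating k i (Suc p))"
  proof -
    have "alternating k i (Suc p) = y @ [a]" unfolding a y by (rule alternating_snoc)
    moreover have "alternating i k (Suc p) = i # y" by (simp add: y)
    ultimately show ?thesis using eq by (simp add: gen_eq cls_mult)
  qed
  then have "cls (alternating i k (2 * Suc p)) = cls (alternating k i (Suc p) @ rev (alternating k i (Suc p)))"
    unfolding alternating_rev [symmetric] by (rule cls_append_cong) simp
  then have "rot i k [^]\<^bsub>W\<^esub> Suc p = \<one>\<^bsub>W\<^esub>" unfolding cls_alternating_even cls_rev by (simp only: cls_one)
  from rot_order [OF assms(1) _ this] have m: "m i k > 0" "m i k \<le> Suc p" by auto
  have "\<not> m i k \<le> p"
  proof
    assume le: "m i k \<le> p"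
    let ?M = "m i k"
    have "cls (alternating i k ?M @ rev (alternating k i ?M)) = cls []"
      using cox_cong.relator [of m "[]" i k "[]"]
      by (simp add: alternating_rev concat_replicate_alternating cls_eq_iff)
    from cls_append_cong [OF this, of "alternating k i ?M" "alternating k i ?M"]
    have "cls (alternating k i ?M) = cls (alternating i k ?M @ (rev (alternating k i ?M) @ alternating k i ?M))" by simp
    also have "\<dots> = cls (alternating i k ?M @ [])"
      by (rule cls_append_cong [OF HOL.refl cls_rev'])
    finally have sw: "cls (alternating k i ?M) = cls (alternating i k ?M)" by simp
    define r where "r = (if even ?M then alternating k i (p - ?M) else alternating i k (p - ?M))"
    have yr: "y = alternating k i ?M @ r"
      using alternating_add [of k i ?M "p - ?M"] le y by (simp add: r_def)
    define y' where "y' = alternating i k ?M @ r"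
    have y': "cls y' = cls y" unfolding y'_def yr by (rule cls_append_cong [OF sw [symmetric] HOL.refl])
    have "set y' \<subseteq> {i, k}"
      using set_alternating [of i k] set_alternating [of k i] by (auto simp: y'_def r_def)
    moreover have "length y' = length y" by (simp add: y'_def yr)
    ultimately have "reduced {i, k} y'" using assms(2) y' unfolding reduced_def by simp
    moreover have "y' \<noteq> []" "hd y' = i" using m(1) by (cases ?M; simp add: y'_def)+
    ultimately show False using first [OF _ _ y'] assms(1) by simp
  qed
  then have "m i k = Suc p" using m by simp
  then show ?thesis using m y a by simp
qed

end

section \<open>The elements \<open>D\<^sub>s\<close>\<close>

lemma counit_free_superset:
  "finite A \<Longrightarrow> Poly_Mapping.keys p \<subseteq> A \<Longrightarrow>
     counit_free p = (\<Sum>u\<in>A. Poly_Mapping.lookup p u * prod_list (map counit_gen u))"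
  unfolding counit_free_def by (rule sum.mono_neutral_left) (auto simp: in_keys_iff)

lemma counit_free_diff: "counit_free (p - q) = counit_free p - counit_free q"
proof -
  let ?A = "Poly_Mapping.keys p \<union> Poly_Mapping.keys q"
  have "Poly_Mapping.keys (p - q) \<subseteq> ?A" by (rule keys_diff)
  then show ?thesis
    by (simp add: counit_free_superset [of ?A] lookup_minus algebra_simps sum_subtractf)
qed

lemma counit_free_zero [simp]: "counit_free 0 = 0"
  by (simp add: counit_free_def)

lemma counit_free_uminus: "counit_free (- p) = - counit_free p"
  using counit_free_diff [of 0 p] by simp

lemma counit_free_add: "counit_free (p + q) = counit_free p + counit_free q"
  using counit_free_diff [of p "- q"] by (simp add: counit_free_uminus)

lemma counit_free_monomial: "counit_free (monomial u) = prod_list (map counit_gen u)"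
  by (simp add: counit_free_def monomial_def)

lemma counit_free_one [simp]: "counit_free 1 = 1"
  using counit_free_monomial [of "[]"] by (simp add: monomial_Nil)

text \<open>Additively the free ring is the free abelian group on words, so induction over free
  abelian groups applies.\<close>

lemma free_induct [case_names zero monomial diff]:
  fixes p :: "'i free"
  assumes "P 0" "\<And>u. P (monomial u)" "\<And>p q. P p \<Longrightarrow> P q \<Longrightarrow> P (p - q)"
  shows "P p"
  by (rule frag_induction [of p UNIV]) (use assms in \<open>auto simp: monomial_def\<close>)

lemma counit_free_mult: "counit_free (p * q) = counit_free p * counit_free q"
proof (induction p rule: free_induct)
  case (monomial u)
  show ?case
    by (induction q rule: free_induct)
      (simp_all add: monomial_mult counit_free_monomial right_diff_distrib counit_free_diff)
qed (simp_all add: left_diff_distrib counit_free_diff)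

interpretation free: ring "free_alg :: 'i free ring"
  by (rule ring_free_alg)

lemma free_alg_simps [simp]:
  "carrier free_alg = UNIV" "x \<otimes>\<^bsub>free_alg\<^esub> y = x * y" "\<one>\<^bsub>free_alg\<^esub> = 1"
  "x \<oplus>\<^bsub>free_alg\<^esub> y = x + y" "\<zero>\<^bsub>free_alg\<^esub> = 0"
  by (simp_all add: free_alg_def)

lemma Hhat_ideal: "ideal (Idl\<^bsub>free_alg\<^esub> (Hhat_rels m)) free_alg"
  by (rule free.genideal_ideal) simp

lemma to_Hhat_hom: "to_Hhat m \<in> ring_hom free_alg (Hhat m)"
proof -
  have "to_Hhat m = (+>\<^bsub>free_alg\<^esub>) (Idl\<^bsub>free_alg\<^esub> (Hhat_rels m))"
    by (rule ext) (simp add: to_Hhat_def)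
  then show ?thesis using ideal.rcos_ring_hom [OF Hhat_ideal] by (simp add: Hhat_def)
qed

lemma counit_free_rels: "p \<in> Hhat_rels m \<Longrightarrow> counit_free p = 0"
proof -
  have "prod_list (map counit_gen (concat (replicate n [Sgen i, Sgen j]))) = 1" for n and i j :: 'a
    by (induction n) auto
  then show "p \<in> Hhat_rels m \<Longrightarrow> counit_free p = 0"
    unfolding Hhat_rels_def
    by (auto simp: counit_free_diff counit_free_add counit_free_monomial)
qed

lemma counit_free_ideal:
  assumes "p \<in> Idl\<^bsub>free_alg\<^esub> (Hhat_rels m)" shows "counit_free p = 0"
proof -
  have "ideal {p. counit_free p = 0} (free_alg :: 'a free ring)"
  proof (rule idealI)
    show "ring free_alg" by (rule ring_free_alg)
    show "subgroup {p. counit_free p = 0} (add_monoid (free_alg :: 'a free ring))"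
    proof (rule group.subgroupI)
      show "Group.group (add_monoid (free_alg :: 'a free ring))" by (rule free.add.is_group)
      show "{p. counit_free p = 0} \<noteq> {}" using counit_free_zero by blast
      fix p :: "'a free"
      assume "p \<in> {p. counit_free p = 0}"
      moreover have "inv\<^bsub>add_monoid free_alg\<^esub> p = - p"
        using free.minus_equality [of "- p" p] by (simp add: a_inv_def)
      ultimately show "inv\<^bsub>add_monoid free_alg\<^esub> p \<in> {p. counit_free p = 0}"
        by (simp add: counit_free_uminus)
    qed (auto simp: counit_free_add)
  qed (simp_all add: counit_free_mult)
  then show ?thesis
    using free.genideal_minimal [of "{p. counit_free p = 0}" "Hhat_rels m"] assms counit_free_rels by blast
qed

lemma counit_to_Hhat [simp]: "counit (to_Hhat m p) = counit_free p"
proof -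
  have "counit_free ` to_Hhat m p = {counit_free p}"
  proof -
    have "p \<in> to_Hhat m p"
      unfolding to_Hhat_def
      by (rule abelian_subgroup.a_rcos_self [OF ideal.axioms(1) [THEN abelian_subgroupI3]])
        (simp_all add: Hhat_ideal free.is_abelian_group)
    moreover have "counit_free q = counit_free p" if "q \<in> to_Hhat m p" for q
      using that by (auto simp: to_Hhat_def a_r_coset_def' counit_free_add counit_free_ideal)
    ultimately show ?thesis by blast
  qed
  then show ?thesis by (simp add: counit_def)
qed

section \<open>Calculation in \<open>Hhat m\<close> from its generators and relations\<close>

context coxeter
begin

abbreviation "H \<equiv> Hhat m"

sublocale H: ring H by (rule ring_Hhat)

lemma to_Hhat_closed [simp]: "to_Hhat m p \<in> carrier H"
  using ring_hom_closed [OF to_Hhat_hom] by simp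

lemma to_Hhat_mult: "to_Hhat m (p * q) = to_Hhat m p \<otimes>\<^bsub>H\<^esub> to_Hhat m q"
  using ring_hom_mult [OF to_Hhat_hom, of p q] by simp

lemma to_Hhat_add: "to_Hhat m (p + q) = to_Hhat m p \<oplus>\<^bsub>H\<^esub> to_Hhat m q"
  using ring_hom_add [OF to_Hhat_hom, of p q] by simp

lemma to_Hhat_one: "to_Hhat m 1 = \<one>\<^bsub>H\<^esub>"
  using ring_hom_one [OF to_Hhat_hom] by simp

lemma to_Hhat_zero: "to_Hhat m 0 = \<zero>\<^bsub>H\<^esub>"
  using ring_hom_zero [OF to_Hhat_hom ring_free_alg ring_Hhat] by simp

lemma to_Hhat_uminus: "to_Hhat m (- p) = \<ominus>\<^bsub>H\<^esub> to_Hhat m p"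
  by (rule H.minus_equality [symmetric]) (simp_all add: to_Hhat_add [symmetric] to_Hhat_zero)

lemma to_Hhat_diff: "to_Hhat m (p - q) = to_Hhat m p \<ominus>\<^bsub>H\<^esub> to_Hhat m q"
  using to_Hhat_add [of p "- q"] by (simp add: a_minus_def to_Hhat_uminus)

lemma carrier_HE: assumes "x \<in> carrier H" obtains p where "x = to_Hhat m p"
  using assms unfolding Hhat_def FactRing_def A_RCOSETS_def' to_Hhat_def by auto

lemma to_Hhat_rel: "p \<in> Hhat_rels m \<Longrightarrow> to_Hhat m p = \<zero>\<^bsub>H\<^esub>"
proof -
  assume "p \<in> Hhat_rels m"
  then have "p \<in> Idl\<^bsub>free_alg\<^esub> (Hhat_rels m)"
    using free.genideal_self [of "Hhat_rels m"] by auto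
  then show ?thesis
    unfolding to_Hhat_def Hhat_def
    by (simp add: FactRing_def ring.a_rcos_zero [OF ring_free_alg Hhat_ideal])
qed

lemma to_Hhat_eqI: "p - q \<in> Hhat_rels m \<Longrightarrow> to_Hhat m p = to_Hhat m q"
  using to_Hhat_rel [of "p - q"] by (simp add: to_Hhat_diff H.r_right_minus_eq)

lemma counit_mult: "x \<in> carrier H \<Longrightarrow> y \<in> carrier H \<Longrightarrow> counit (x \<otimes>\<^bsub>H\<^esub> y) = counit x * counit y"
  by (elim carrier_HE) (simp add: to_Hhat_mult [symmetric] counit_free_mult)

lemma counit_add: "x \<in> carrier H \<Longrightarrow> y \<in> carrier H \<Longrightarrow> counit (x \<oplus>\<^bsub>H\<^esub> y) = counit x + counit y"
  by (elim carrier_HE) (simp add: to_Hhat_add [symmetric] counit_free_add)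

lemma counit_minus: "x \<in> carrier H \<Longrightarrow> y \<in> carrier H \<Longrightarrow> counit (x \<ominus>\<^bsub>H\<^esub> y) = counit x - counit y"
  by (elim carrier_HE) (simp add: to_Hhat_diff [symmetric] counit_free_diff)

lemma counit_one: "counit \<one>\<^bsub>H\<^esub> = 1" and counit_zero: "counit \<zero>\<^bsub>H\<^esub> = 0"
  by (simp_all add: to_Hhat_one [symmetric] to_Hhat_zero [symmetric])

definition hW :: "'i list \<Rightarrow> 'i free set" where "hW u = to_Hhat m (monomial (map Sgen u))"

definition hD :: "'i \<Rightarrow> 'i free set" where "hD i = to_Hhat m (monomial [Dgen i])"

lemma hW_closed [simp]: "hW u \<in> carrier H" and hD_closed [simp]: "hD i \<in> carrier H"
  by (simp_all add: hW_def hD_def)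

lemma hW_append: "hW (u @ v) = hW u \<otimes>\<^bsub>H\<^esub> hW v"
  by (simp add: hW_def to_Hhat_mult [symmetric] monomial_mult)

lemma hW_Nil [simp]: "hW [] = \<one>\<^bsub>H\<^esub>"
  by (simp add: hW_def monomial_Nil to_Hhat_one)

lemma hW_cong: "cls u = cls v \<Longrightarrow> hW u = hW v"
proof -
  assume "cls u = cls v"
  then have "cox_cong m u v" by (simp add: cls_eq_iff)
  then show ?thesis
  proof (induction rule: cox_cong.induct)
    case (relator u i j v)
    have "monomial (concat (replicate (m i j) [Sgen i, Sgen j])) - 1 \<in> Hhat_rels m"
      unfolding Hhat_rels_def by blast
    from to_Hhat_eqI [OF this] have "hW (concat (replicate (m i j) [i, j])) = \<one>\<^bsub>H\<^esub>"
      by (simp add: hW_def map_concat to_Hhat_one)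
    then show ?case by (simp add: hW_append)
  qed auto
qed

lemma hW_rev [simp]: "hW u \<otimes>\<^bsub>H\<^esub> hW (rev u) = \<one>\<^bsub>H\<^esub>" "hW (rev u) \<otimes>\<^bsub>H\<^esub> hW u = \<one>\<^bsub>H\<^esub>"
  using hW_cong [OF cls_rev, of u] hW_cong [OF cls_rev', of u] by (simp_all add: hW_append)

lemma hW_rev_cancel [simp]:
  assumes "x \<in> carrier H"
  shows "hW u \<otimes>\<^bsub>H\<^esub> (hW (rev u) \<otimes>\<^bsub>H\<^esub> x) = x" "hW (rev u) \<otimes>\<^bsub>H\<^esub> (hW u \<otimes>\<^bsub>H\<^esub> x) = x"
  using assms by (simp_all add: H.m_assoc [symmetric])

lemma hD_idem: "hD i \<otimes>\<^bsub>H\<^esub> hD i = hD i"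
proof -
  have "monomial [Dgen i, Dgen i] - monomial [Dgen i] \<in> Hhat_rels m"
    unfolding Hhat_rels_def by blast
  from to_Hhat_eqI [OF this] show ?thesis
    by (simp add: hD_def to_Hhat_mult [symmetric] monomial_mult)
qed

lemma hW_hD: "hW [i] \<otimes>\<^bsub>H\<^esub> hD i \<oplus>\<^bsub>H\<^esub> hD i \<otimes>\<^bsub>H\<^esub> hW [i] = hW [i] \<ominus>\<^bsub>H\<^esub> \<one>\<^bsub>H\<^esub>"
proof -
  have "monomial [Sgen i, Dgen i] + monomial [Dgen i, Sgen i] - (monomial [Sgen i] - 1) \<in> Hhat_rels m"
    unfolding Hhat_rels_def by blast
  from to_Hhat_eqI [OF this] show ?thesis
    by (simp add: hD_def hW_def to_Hhat_mult [symmetric] to_Hhat_add [symmetric] to_Hhat_diff [symmetric]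
        to_Hhat_one [symmetric] monomial_mult)
qed

lemma hD_braid:
  assumes "i \<noteq> j" "m i j \<noteq> 0"
  defines "y \<equiv> alternating j i (m i j - 1)"
  shows "hD i \<otimes>\<^bsub>H\<^esub> hW y = hW y \<otimes>\<^bsub>H\<^esub> hD (if even (m i j) then i else j)"
proof -
  have "monomial (Dgen i # map Sgen y) - monomial (map Sgen y @ [Dgen (if even (m i j) then i else j)])
      \<in> Hhat_rels m"
    unfolding Hhat_rels_def y_def using assms by blast
  from to_Hhat_eqI [OF this] show ?thesis
    by (simp add: hD_def hW_def to_Hhat_mult [symmetric] monomial_mult)
qed

text \<open>Peel off from \<open>x\<close> a maximal factor in the dihedral subgroup generated by \<open>s\<^sub>i\<close> and a right
  descent \<open>s\<^sub>k\<close> of \<open>x\<close>. That factor must carry \<open>s\<^sub>i\<close> to one of the two generators, so it has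
  length \<open>m i k - 1\<close> and relation (iii) applies to it.\<close>

lemma hW_hD_conj:
  "cj x (gen i) = gen j \<Longrightarrow> \<not> par (rev x) (gen i) \<Longrightarrow> hW x \<otimes>\<^bsub>H\<^esub> hD i = hD j \<otimes>\<^bsub>H\<^esub> hW x"
proof (induction "length x" arbitrary: x i rule: less_induct)
  case less
  \<comment> \<open>Right descents of \<open>x\<close> are left descents of its inverse, so the
    first letter of \<open>X\<close> is one.\<close>
  obtain X where X: "reduced UNIV X" "cls X = cls (rev x)"
    using reduced_exists [of "rev x" UNIV] by auto
  have lenX: "length X \<le> length x" using X unfolding reduced_def by (metis length_rev subset_UNIV)
  have xX: "cls x = cls (rev X)" using inv_cls [of X] inv_cls [of "rev x"] X(2) by simp
  have parX: "\<not> par X (gen i)" using par_cong [OF X(2), of "gen i"] less.prems(2) by simp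
  show ?case
  proof (cases X)
    case Nil
    then have x: "cls x = cls []" using xX by simp
    then have "i = j" using less.prems(1) cj_cong [OF x, of "gen i"] by (simp add: gen_inj)
    then show ?thesis using hW_cong [OF x] by simp
  next
    case (Cons k X')
    have k: "par X (gen k)" using reduced_par_first X(1) Cons by blast
    then have ik: "i \<noteq> k" using parX by auto
    obtain y z where y: "reduced {i, k} y" and yz: "cls X = cls (y @ z)"
      and z: "\<And>u. set u \<subseteq> {i, k} \<Longrightarrow> \<not> par z (cls u)"
      and min: "\<And>y' z'. set y' \<subseteq> {i, k} \<Longrightarrow> cls X = cls (y' @ z') \<Longrightarrow> length z \<le> length z'"
      and par_y: "\<And>u. set u \<subseteq> {i, k} \<Longrightarrow> par X (cls u) = par y (cls u)"
      by (rule reduced_coset_representative [of "{i, k}" X]) blast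
    \<comment> \<open>The factorization \<open>[k] @ X'\<close> competes with \<open>y @ z\<close>,
      so minimality of \<open>z\<close> provides the decrease for the induction.\<close>
    have "length z \<le> length X'" using min [of "[k]" X'] Cons by simp
    then have len: "length (rev z) < length x" using lenX Cons by simp
    have "par y (gen k)" "\<not> par y (gen i)" using par_y [of "[k]"] par_y [of "[i]"] k parX by (auto simp: gen_eq)
    then have "y \<noteq> []" by auto
    have x: "cls x = cls (rev z @ rev y)" using xX inv_cls [of X] inv_cls [of "y @ z"] yz by simp
    define t where "t = cj (rev y) (gen i)"
    have t: "t \<in> carrier W" by (simp add: t_def)
    have zt: "cj (rev z) t = gen j"
      using less.prems(1) cj_cong [OF x, of "gen i"] by (simp add: t_def cj_append)
    then have tz: "cj z (gen j) = t" using t by (simp add: cj_eq_iff)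
    have "set (rev y @ [i] @ y) \<subseteq> {i, k}" using y by (auto simp: reduced_def)
    from reduced_exists [OF this] obtain v where v: "reduced {i, k} v" "cls v = t"
      by (auto simp: t_def cj_gen)
    have "v \<noteq> []"
    proof
      assume "v = []"
      then have "cj (rev y) (gen i) = cls []" using v by (simp add: t_def)
      then have "gen i = cj y (cls [])" by (simp add: cj_eq_iff)
      then show False using gen_neq_one [of i] by (simp add: cj_cls cls_rev cls_one)
    qed
    then obtain a v' where a: "v = a # v'" by (cases v) auto
    have aJ: "a \<in> {i, k}" using v a by (simp add: reduced_def)
    \<comment> \<open>In \<open>W\<close> we have \<open>t z = z s_j\<close>. The generator
      \<open>s_a\<close>, first letter of a reduced word of \<open>t\<close>, has odd parity along
      \<open>v @ z\<close>, because \<open>z\<close> meets nothing in the dihedral subgroup. Along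
      \<open>z @ [j]\<close> an odd parity can then only come from the last letter, that is
      \<open>s_a = z s_j z^-1 = t\<close>.\<close>
    have "gen a = t"
    proof -
      have "set (rev v @ [a] @ v) \<subseteq> {i, k}" using v aJ by (auto simp: reduced_def)
      then have "\<not> par z (cj (rev v) (gen a))" using z by (simp add: cj_gen)
      moreover have "par v (gen a)" using reduced_par_first v(1) a by blast
      ultimately have "par (v @ z) (gen a)" by (simp add: par_append)
      moreover have "cls (v @ z) = cls (z @ [j])"
        using cj_mult [of "gen j" z] v(2) tz by (simp add: gen_eq flip: cls_mult)
      ultimately have "par (z @ [j]) (gen a)" using par_cong [of "v @ z" "z @ [j]" "gen a"] by simp
      then show ?thesis using z [of "[a]"] aJ tz by (simp add: par_snoc gen_eq)
    qed
    have "hW (rev z) \<otimes>\<^bsub>H\<^esub> hD a = hD j \<otimes>\<^bsub>H\<^esub> hW (rev z)"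
      using zt z [of "[a]"] aJ by (intro less.hyps len) (simp_all add: \<open>gen a = t\<close> flip: gen_eq)
    moreover have "hW (rev y) \<otimes>\<^bsub>H\<^esub> hD i = hD a \<otimes>\<^bsub>H\<^esub> hW (rev y)"
    proof -
      have "gen i = cj y (gen a)" using \<open>gen a = t\<close> unfolding t_def by simp
      then have "gen i \<otimes>\<^bsub>W\<^esub> cls y = cls y \<otimes>\<^bsub>W\<^esub> gen a" by (simp add: cj_mult)
      from dihedral_conj_gen [OF ik y \<open>y \<noteq> []\<close> \<open>\<not> par y (gen i)\<close> aJ this]
      have "hD i \<otimes>\<^bsub>H\<^esub> hW y = hW y \<otimes>\<^bsub>H\<^esub> hD a" using hD_braid [OF ik] by auto
      then have "hW (rev y) \<otimes>\<^bsub>H\<^esub> (hD i \<otimes>\<^bsub>H\<^esub> hW y) \<otimes>\<^bsub>H\<^esub> hW (rev y)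
          = hW (rev y) \<otimes>\<^bsub>H\<^esub> (hW y \<otimes>\<^bsub>H\<^esub> hD a) \<otimes>\<^bsub>H\<^esub> hW (rev y)" by simp
      then show ?thesis by (simp add: H.m_assoc)
    qed
    ultimately show ?thesis
      using hW_cong [OF x] by (simp add: hW_append H.m_assoc) (simp add: H.m_assoc [symmetric])
  qed
qed

section \<open>Existence, uniqueness and conjugation of the elements \<open>refl_D\<close>\<close>

lemma reflections_eq: "reflections m = {cj u (gen i) | u i. True}"
proof -
  have "reflections m = (\<lambda>(x, i). x \<otimes>\<^bsub>W\<^esub> gen i \<otimes>\<^bsub>W\<^esub> inv\<^bsub>W\<^esub> x) ` (carrier W \<times> UNIV)"
    unfolding reflections_def by auto
  also have "\<dots> = {cj u (gen i) | u i. True}"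
    by (auto simp: cj_def elim!: carrierE)
  finally show ?thesis .
qed

lemma cj_in_reflections: "cj u (gen i) \<in> reflections m"
  by (auto simp: reflections_eq)

text \<open>The parity condition says that \<open>u\<close> sends the simple root of
  \<open>i\<close> to a positive root. If it fails, replace \<open>u\<close> by
  \<open>u @ [i]\<close>: the reflection is the same and the parity flips.\<close>

lemma reflectionE:
  assumes "t \<in> reflections m"
  obtains u i where "t = cj u (gen i)" "\<not> par (rev u) (gen i)"
proof -
  obtain u i where u: "t = cj u (gen i)" using assms by (auto simp: reflections_eq)
  have "t = cj (u @ [i]) (gen i)" by (simp add: u cj_append)
  moreover have "par (rev (u @ [i])) (gen i) \<noteq> par (rev u) (gen i)" by (simp add: par_Cons)
  ultimately show ?thesis using that u by metis
qed

lemma reflections_closed: "t \<in> reflections m \<Longrightarrow> t \<in> carrier W"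
  by (auto simp: reflections_eq)

lemma cj_reflections: "t \<in> reflections m \<Longrightarrow> cj u t \<in> reflections m"
  by (elim reflectionE) (simp add: cj_append [symmetric] cj_in_reflections)

text \<open>All parities along \<open>u @ rev u\<close> are even, and the cocycle rule splits them
  between the two halves.\<close>

lemma par_self:
  assumes "\<not> par (rev u) (gen i)" shows "\<not> par u (cj u (gen i))"
proof -
  have "\<not> par (u @ rev u) (cj u (gen i))" using par_cong [OF cls_rev, of "cj u (gen i)" u] by simp
  then show ?thesis using assms by (simp add: par_append)
qed

text \<open>The word \<open>rev v @ u\<close> carries \<open>s_i\<close> to \<open>s_j\<close>, and
  the two parity conditions together give the one required by \<open>hW_hD_conj\<close>.\<close>

lemma refl_D_well_defined:
  assumes "cj u (gen i) = cj v (gen j)" "\<not> par (rev u) (gen i)" "\<not> par (rev v) (gen j)"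
  shows "hW u \<otimes>\<^bsub>H\<^esub> hD i \<otimes>\<^bsub>H\<^esub> hW (rev u) = hW v \<otimes>\<^bsub>H\<^esub> hD j \<otimes>\<^bsub>H\<^esub> hW (rev v)"
proof -
  let ?x = "rev v @ u"
  have "cj ?x (gen i) = gen j" using assms(1) by (simp add: cj_append)
  moreover have "\<not> par (rev ?x) (gen i)"
    using assms(1,2) par_self [OF assms(3)] by (simp add: par_append)
  ultimately have "hW ?x \<otimes>\<^bsub>H\<^esub> hD i = hD j \<otimes>\<^bsub>H\<^esub> hW ?x" by (rule hW_hD_conj)
  then have "hW v \<otimes>\<^bsub>H\<^esub> (hW ?x \<otimes>\<^bsub>H\<^esub> hD i) \<otimes>\<^bsub>H\<^esub> hW (rev u) = hW v \<otimes>\<^bsub>H\<^esub> (hD j \<otimes>\<^bsub>H\<^esub> hW ?x) \<otimes>\<^bsub>H\<^esub> hW (rev u)"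
    by simp
  then show ?thesis by (simp add: hW_append H.m_assoc)
qed

text \<open>The candidate \<open>F\<close> takes its value from any admissible presentation of the
  reflection, and \<open>refl_D_well_defined\<close> makes the choice irrelevant. Any solution
  agrees with \<open>F\<close> by induction on the conjugating word; the case excluded from the
  recursion, where the reflection is \<open>gen a\<close>, is harmless because conjugation by
  \<open>s_a\<close> fixes it.\<close>

lemma refl_D_cj:
  assumes "\<not> par (rev u) (gen i)"
  shows "refl_D m (cj u (gen i)) = hW u \<otimes>\<^bsub>H\<^esub> hD i \<otimes>\<^bsub>H\<^esub> hW (rev u)"
proof -
  let ?P = "\<lambda>f. f \<in> reflections m \<rightarrow>\<^sub>E carrier H \<and>
     (\<forall>i. f (gen i) = to_Hhat m (monomial [Dgen i])) \<and>
     (\<forall>i. \<forall>s \<in> reflections m - {gen i}.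
        f (gen i \<otimes>\<^bsub>W\<^esub> s \<otimes>\<^bsub>W\<^esub> gen i)
        = to_Hhat m (monomial [Sgen i]) \<otimes>\<^bsub>H\<^esub> f s \<otimes>\<^bsub>H\<^esub> to_Hhat m (monomial [Sgen i]))"
  have P: "?P f \<longleftrightarrow> f \<in> reflections m \<rightarrow>\<^sub>E carrier H \<and> (\<forall>i. f (gen i) = hD i) \<and>
     (\<forall>i. \<forall>s \<in> reflections m - {gen i}. f (cj [i] s) = hW [i] \<otimes>\<^bsub>H\<^esub> f s \<otimes>\<^bsub>H\<^esub> hW [i])" for f
    by (simp add: cj_single hD_def hW_def)
  define F where "F = restrict (\<lambda>t. SOME d. \<exists>u i. t = cj u (gen i) \<and> \<not> par (rev u) (gen i) \<and>
      d = hW u \<otimes>\<^bsub>H\<^esub> hD i \<otimes>\<^bsub>H\<^esub> hW (rev u)) (reflections m)"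
  have F: "F (cj u (gen i)) = hW u \<otimes>\<^bsub>H\<^esub> hD i \<otimes>\<^bsub>H\<^esub> hW (rev u)" if "\<not> par (rev u) (gen i)" for u i
  proof -
    let ?Q = "\<lambda>d. \<exists>v j. cj u (gen i) = cj v (gen j) \<and> \<not> par (rev v) (gen j) \<and>
      d = hW v \<otimes>\<^bsub>H\<^esub> hD j \<otimes>\<^bsub>H\<^esub> hW (rev v)"
    have "?Q (hW u \<otimes>\<^bsub>H\<^esub> hD i \<otimes>\<^bsub>H\<^esub> hW (rev u))" using that by blast
    moreover have "d = hW u \<otimes>\<^bsub>H\<^esub> hD i \<otimes>\<^bsub>H\<^esub> hW (rev u)" if "?Q d" for d
      using that refl_D_well_defined \<open>\<not> par (rev u) (gen i)\<close> by metis
    ultimately have "(SOME d. ?Q d) = hW u \<otimes>\<^bsub>H\<^esub> hD i \<otimes>\<^bsub>H\<^esub> hW (rev u)" by (rule some_equality)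
    then show ?thesis by (simp add: F_def cj_in_reflections)
  qed
  have "?P F"
    unfolding P
  proof (intro conjI allI ballI)
    show "F \<in> reflections m \<rightarrow>\<^sub>E carrier H"
    proof (rule PiE_I)
      fix t assume "t \<in> reflections m"
      then show "F t \<in> carrier H" by (elim reflectionE) (simp add: F)
    qed (simp add: F_def)
    show "F (gen i) = hD i" for i using F [of "[]" i] by simp
    fix a s assume s: "s \<in> reflections m - {gen a}"
    then have "s \<in> reflections m" by simp
    then obtain u i where u: "s = cj u (gen i)" "\<not> par (rev u) (gen i)" by (rule reflectionE)
    \<comment> \<open>Prepending \<open>a\<close> adds to the parity exactly when \<open>s\<close>
      equals \<open>gen a\<close>, the excluded case.\<close>
    have "\<not> par (rev (a # u)) (gen i)"
      using u s by (simp add: par_snoc) (metis cj_eq_iff gen_closed rev_rev_ident)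
    from F [OF this] have "F (cj [a] s) = hW (a # u) \<otimes>\<^bsub>H\<^esub> hD i \<otimes>\<^bsub>H\<^esub> hW (rev u @ [a])"
      using u cj_append [of "gen i" "[a]" u] by simp
    also have "\<dots> = hW [a] \<otimes>\<^bsub>H\<^esub> F s \<otimes>\<^bsub>H\<^esub> hW [a]"
      using hW_append [of "[a]" u] u by (simp add: hW_append F H.m_assoc)
    finally show "F (cj [a] s) = hW [a] \<otimes>\<^bsub>H\<^esub> F s \<otimes>\<^bsub>H\<^esub> hW [a]" .
  qed
  moreover have "f = F" if "?P f" for f
  proof -
    have f: "f \<in> reflections m \<rightarrow>\<^sub>E carrier H" "\<And>i. f (gen i) = hD i"
      "\<And>i s. s \<in> reflections m - {gen i} \<Longrightarrow> f (cj [i] s) = hW [i] \<otimes>\<^bsub>H\<^esub> f s \<otimes>\<^bsub>H\<^esub> hW [i]"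
      using that unfolding P by blast+
    have F': "F \<in> reflections m \<rightarrow>\<^sub>E carrier H" "\<And>i. F (gen i) = hD i"
      "\<And>i s. s \<in> reflections m - {gen i} \<Longrightarrow> F (cj [i] s) = hW [i] \<otimes>\<^bsub>H\<^esub> F s \<otimes>\<^bsub>H\<^esub> hW [i]"
      using \<open>?P F\<close> unfolding P by blast+
    have "f (cj u (gen i)) = F (cj u (gen i))" for u i
    proof (induction u)
      case Nil show ?case by (simp add: f(2) F'(2))
    next
      case (Cons a u)
      have s: "cj u (gen i) \<in> reflections m" by (rule cj_in_reflections)
      have c: "cj (a # u) (gen i) = cj [a] (cj u (gen i))" using cj_append [of "gen i" "[a]" u] by simp
      show ?case
      proof (cases "cj u (gen i) = gen a")
        case True then show ?thesis unfolding c by (simp add: f(2) F'(2))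
      next
        case False then show ?thesis unfolding c using s Cons.IH by (simp add: f(3) F'(3))
      qed
    qed
    then show "f = F" by (intro PiE_ext [OF f(1) F'(1)]) (auto simp: reflections_eq)
  qed
  ultimately have "refl_D m = F" unfolding refl_D_def by (rule the_equality)
  then show ?thesis using F assms by simp
qed

lemma refl_D_closed [simp]: "t \<in> reflections m \<Longrightarrow> refl_D m t \<in> carrier H"
  by (elim reflectionE) (simp add: refl_D_cj)

lemma refl_D_gen: "refl_D m (gen i) = hD i"
  using refl_D_cj [of "[]" i] by simp

lemma refl_D_conj:
  assumes "t \<in> reflections m" "\<not> par (rev u) t"
  shows "refl_D m (cj u t) = hW u \<otimes>\<^bsub>H\<^esub> refl_D m t \<otimes>\<^bsub>H\<^esub> hW (rev u)"
proof -
  obtain v i where v: "t = cj v (gen i)" "\<not> par (rev v) (gen i)" using assms(1) by (rule reflectionE)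
  have "\<not> par (rev (u @ v)) (gen i)" using v assms(2) by (simp add: par_append)
  from refl_D_cj [OF this] show ?thesis
    using v by (simp add: cj_append hW_append refl_D_cj H.m_assoc)
qed

lemma refl_D_idem: "t \<in> reflections m \<Longrightarrow> refl_D m t \<otimes>\<^bsub>H\<^esub> refl_D m t = refl_D m t"
proof -
  assume "t \<in> reflections m"
  then obtain u i where u: "t = cj u (gen i)" "\<not> par (rev u) (gen i)" by (rule reflectionE)
  have "hD i \<otimes>\<^bsub>H\<^esub> (hD i \<otimes>\<^bsub>H\<^esub> x) = hD i \<otimes>\<^bsub>H\<^esub> x" if "x \<in> carrier H" for x
    using that by (simp add: H.m_assoc [symmetric] hD_idem)
  then show ?thesis using u by (simp add: refl_D_cj H.m_assoc)
qed

lemma counit_refl_D: "t \<in> reflections m \<Longrightarrow> counit (refl_D m t) = 0"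
proof -
  assume "t \<in> reflections m"
  then obtain u i where u: "t = cj u (gen i)" "\<not> par (rev u) (gen i)" by (rule reflectionE)
  have "counit (hD i) = 0" by (simp add: hD_def counit_free_monomial)
  then show ?thesis using u by (simp add: refl_D_cj counit_mult)
qed

lemma W_Hhat_cls: "W_Hhat m (cls u) = hW u"
proof -
  have "to_Hhat m (monomial (map Sgen v)) = hW u" if "v \<in> cls u" for v
    using hW_cong [of v u] that by (simp add: in_cls_iff hW_def)
  then have "(\<lambda>v. to_Hhat m (monomial (map Sgen v))) ` cls u = (\<lambda>v. hW u) ` cls u"
    by (rule image_cong [OF HOL.refl])
  also have "\<dots> = {hW u}" using self_in_cls [of u] by auto
  finally show ?thesis by (simp add: W_Hhat_def)
qed

end

section \<open>Conjugating the relations by an involution\<close>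

definition yb_left :: "('a, 'b) ring_scheme \<Rightarrow> (nat \<Rightarrow> 'a) \<Rightarrow> nat \<Rightarrow> nat \<Rightarrow> 'a" where
  "yb_left R d q t = ordered_prod R (\<lambda>a. \<one>\<^bsub>R\<^esub> \<ominus>\<^bsub>R\<^esub> d a) [t..<q] \<otimes>\<^bsub>R\<^esub> ordered_prod R d [0..<t]"

definition yb_right :: "('a, 'b) ring_scheme \<Rightarrow> (nat \<Rightarrow> 'a) \<Rightarrow> nat \<Rightarrow> nat \<Rightarrow> 'a" where
  "yb_right R d q t =
     ordered_prod R d (rev [0..<t]) \<otimes>\<^bsub>R\<^esub> ordered_prod R (\<lambda>a. \<one>\<^bsub>R\<^esub> \<ominus>\<^bsub>R\<^esub> d a) (rev [t..<q])"

text \<open>Pairs at distance \<open>k\<close> are parametrized by their smaller entry;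
  \<open>finsum_pairs\<close> returns to the index sets of the theorem.\<close>

definition pair_sum :: "('a, 'b) ring_scheme \<Rightarrow> (nat \<Rightarrow> nat \<Rightarrow> 'a) \<Rightarrow> nat \<Rightarrow> nat \<Rightarrow> 'a" where
  "pair_sum R f q k = (\<Oplus>\<^bsub>R\<^esub>a\<in>{..<q - k}. f a (a + k))"

definition quad_left :: "('a, 'b) ring_scheme \<Rightarrow> (nat \<Rightarrow> 'a) \<Rightarrow> nat \<Rightarrow> nat \<Rightarrow> 'a" where
  "quad_left R d q p = pair_sum R (\<lambda>a b. d a \<otimes>\<^bsub>R\<^esub> d b) q (q - p)"

definition quad_right :: "('a, 'b) ring_scheme \<Rightarrow> (nat \<Rightarrow> 'a) \<Rightarrow> nat \<Rightarrow> nat \<Rightarrow> 'a" where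
  "quad_right R d q p = pair_sum R (\<lambda>a b. d b \<otimes>\<^bsub>R\<^esub> d a) q p \<ominus>\<^bsub>R\<^esub> (\<Oplus>\<^bsub>R\<^esub>c\<in>{p..<q - p}. d c)"

text \<open>Conjugation by a generator reverses the order of the indices, so the reversed chain has
  to be carried along. By \<open>quad_flip\<close> its first quadratic relation is the second one
  for \<open>d\<close>.\<close>

definition flip_chain :: "nat \<Rightarrow> (nat \<Rightarrow> 'a) \<Rightarrow> nat \<Rightarrow> 'a" where
  "flip_chain q d a = d (q - 1 - a)"

lemma rev_upt_conv_map: "y \<le> q \<Longrightarrow> map (\<lambda>a. q - 1 - a) [x..<y] = rev [q - y..<q - x]"
  by (rule nth_equalityI) (auto simp: rev_nth)

lemma rev_upt_conv_map': "y \<le> q \<Longrightarrow> map (\<lambda>a. q - a) [x..<y] = rev [q - y + 1..<q - x + 1]"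
  by (rule nth_equalityI) (auto simp: rev_nth simp del: upt_Suc)

context ring
begin

lemma ordered_prod_Nil [simp]: "ordered_prod R f [] = \<one>"
  by (simp add: ordered_prod_def)

lemma ordered_prod_Cons [simp]: "ordered_prod R f (x # xs) = f x \<otimes> ordered_prod R f xs"
  by (simp add: ordered_prod_def)

lemma ordered_prod_closed [simp]: "f ` set xs \<subseteq> carrier R \<Longrightarrow> ordered_prod R f xs \<in> carrier R"
  by (induction xs) auto

lemma ordered_prod_append:
  "f ` set xs \<subseteq> carrier R \<Longrightarrow> f ` set ys \<subseteq> carrier R \<Longrightarrow>
     ordered_prod R f (xs @ ys) = ordered_prod R f xs \<otimes> ordered_prod R f ys"
  by (induction xs) (auto simp: m_assoc)

lemma ordered_prod_map: "ordered_prod R f (map h xs) = ordered_prod R (\<lambda>x. f (h x)) xs"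
  by (induction xs) auto

lemma ordered_prod_cong:
  "(\<And>x. x \<in> set xs \<Longrightarrow> f x = g x) \<Longrightarrow> ordered_prod R f xs = ordered_prod R g xs"
  by (induction xs) auto

lemma yb_closed:
  assumes "\<And>a. a < q \<Longrightarrow> d a \<in> carrier R" "t \<le> q"
  shows "yb_left R d q t \<in> carrier R" "yb_right R d q t \<in> carrier R"
  unfolding yb_left_def yb_right_def using assms by (auto intro!: m_closed ordered_prod_closed)

lemma yb_cong:
  assumes "\<And>a. a < q \<Longrightarrow> d a = e a" "t \<le> q"
  shows "yb_left R d q t = yb_left R e q t" "yb_right R d q t = yb_right R e q t"
  unfolding yb_left_def yb_right_def using assms
  by (auto intro!: arg_cong2 [of _ _ _ _ "(\<otimes>)"] ordered_prod_cong)

lemma pair_sum_closed: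
  "(\<And>a b. a < q \<Longrightarrow> b < q \<Longrightarrow> f a b \<in> carrier R) \<Longrightarrow> pair_sum R f q k \<in> carrier R"
  unfolding pair_sum_def by (rule finsum_closed) auto

lemma pair_sum_cong:
  "(\<And>a b. a < q \<Longrightarrow> b < q \<Longrightarrow> f a b = g a b) \<Longrightarrow> (\<And>a b. a < q \<Longrightarrow> b < q \<Longrightarrow> g a b \<in> carrier R) \<Longrightarrow>
    pair_sum R f q k = pair_sum R g q k"
  unfolding pair_sum_def by (rule finsum_cong') auto

lemma quad_closed:
  assumes "\<And>a. a < q \<Longrightarrow> d a \<in> carrier R"
  shows "quad_left R d q p \<in> carrier R" "quad_right R d q p \<in> carrier R"
  unfolding quad_left_def quad_right_def using assms
  by (auto intro!: pair_sum_closed minus_closed finsum_closed)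

lemma quad_cong:
  assumes "\<And>a. a < q \<Longrightarrow> d a = e a" "\<And>a. a < q \<Longrightarrow> e a \<in> carrier R"
  shows "quad_left R d q p = quad_left R e q p" "quad_right R d q p = quad_right R e q p"
  unfolding quad_left_def quad_right_def using assms
  by (auto intro!: arg_cong2 [of _ _ _ _ "(\<lambda>x y. x \<ominus> y)"] pair_sum_cong finsum_cong')

lemma finsum_pairs:
  assumes "\<And>a b. a < q \<Longrightarrow> b < q \<Longrightarrow> f a b \<in> carrier R" "k \<ge> 1"
  shows "finsum R (\<lambda>(a, b). f a b) {(a, b). a < b \<and> b < q \<and> b - a = k} = pair_sum R f q k"
proof -
  have eq: "{(a, b). a < b \<and> b < q \<and> b - a = k} = (\<lambda>a. (a, a + k)) ` {..<q - k}"
    using assms(2) by (auto simp: image_iff)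
  show ?thesis
    unfolding eq pair_sum_def
    by (subst finsum_reindex) (use assms in \<open>auto simp: inj_on_def\<close>)
qed

lemma pair_sum_flip:
  assumes "\<And>a b. f a b \<in> carrier R"
  shows "pair_sum R (\<lambda>a b. f (q - 1 - a) (q - 1 - b)) q k = pair_sum R (\<lambda>a b. f b a) q k"
proof -
  \<comment> \<open>Reversal sends the pair \<open>(a, a + k)\<close> to a pair at the same distance
    whose smaller entry is \<open>q - k - 1 - a\<close>.\<close>
  have img: "(\<lambda>a. q - k - 1 - a) ` {..<q - k} = {..<q - k}"
  proof (intro equalityI subsetI)
    fix x assume "x \<in> {..<q - k}"
    then show "x \<in> (\<lambda>a. q - k - 1 - a) ` {..<q - k}"
      by (intro image_eqI [of _ _ "q - k - 1 - x"]) auto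
  qed auto
  have "pair_sum R (\<lambda>a b. f b a) q k = (\<Oplus>a\<in>(\<lambda>a. q - k - 1 - a) ` {..<q - k}. f (a + k) a)"
    unfolding img by (simp add: pair_sum_def)
  also have "\<dots> = (\<Oplus>a\<in>{..<q - k}. f (q - k - 1 - a + k) (q - k - 1 - a))"
    using assms by (subst finsum_reindex) (auto simp: inj_on_def)
  also have "\<dots> = (\<Oplus>a\<in>{..<q - k}. f (q - 1 - a) (q - 1 - (a + k)))"
    using assms by (intro finsum_cong') (auto intro!: arg_cong2 [of _ _ _ _ f])
  finally show ?thesis by (simp add: pair_sum_def)
qed

lemma finsum_flip:
  fixes f :: "nat \<Rightarrow> 'a"
  assumes "\<And>a. f a \<in> carrier R" "x + y = z"
  shows "(\<Oplus>c\<in>{x..y}. f (z - c)) = (\<Oplus>c\<in>{x..y}. f c)"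
proof -
  have img: "(\<lambda>a. z - a) ` {x..y} = {x..y}"
  proof (intro equalityI subsetI)
    fix w assume "w \<in> {x..y}"
    then show "w \<in> (\<lambda>a. z - a) ` {x..y}"
      using assms(2) by (intro image_eqI [of _ _ "z - w"]) auto
  qed (use assms(2) in auto)
  have "(\<Oplus>c\<in>(\<lambda>a. z - a) ` {x..y}. f c) = (\<Oplus>c\<in>{x..y}. f (z - c))"
    using assms by (subst finsum_reindex) (auto simp: inj_on_def)
  then show ?thesis unfolding img by simp
qed

lemma quad_flip:
  assumes "\<And>a. d a \<in> carrier R"
  shows "quad_left R (flip_chain q d) q p = pair_sum R (\<lambda>a b. d b \<otimes> d a) q (q - p)"
    and "quad_right R (flip_chain q d) q p
      = pair_sum R (\<lambda>a b. d a \<otimes> d b) q p \<ominus> (\<Oplus>c\<in>{p..<q - p}. d c)"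
proof -
  show "quad_left R (flip_chain q d) q p = pair_sum R (\<lambda>a b. d b \<otimes> d a) q (q - p)"
    unfolding quad_left_def flip_chain_def using assms
    by (intro pair_sum_flip [of "\<lambda>a b. d a \<otimes> d b"]) simp
  have "pair_sum R (\<lambda>a b. d (q - 1 - b) \<otimes> d (q - 1 - a)) q p = pair_sum R (\<lambda>a b. d a \<otimes> d b) q p"
    using assms by (intro pair_sum_flip [of "\<lambda>a b. d b \<otimes> d a"]) simp
  moreover have "(\<Oplus>c\<in>{p..<q - p}. d (q - 1 - c)) = (\<Oplus>c\<in>{p..<q - p}. d c)"
  proof (cases "p < q - p")
    case True
    then have "{p..<q - p} = {p..q - 1 - p}" by auto
    then show ?thesis using finsum_flip [of d p "q - 1 - p" "q - 1"] assms True by simp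
  qed simp
  ultimately show "quad_right R (flip_chain q d) q p
      = pair_sum R (\<lambda>a b. d a \<otimes> d b) q p \<ominus> (\<Oplus>c\<in>{p..<q - p}. d c)"
    unfolding quad_right_def flip_chain_def by simp
qed

lemma lessThan_split: "0 < k \<Longrightarrow> {..<k} = insert 0 {1..<k::nat}" by auto

lemma pair_sum_split:
  assumes "k < q" "\<And>a b. f a b \<in> carrier R"
  shows "pair_sum R f q k = f 0 k \<oplus> (\<Oplus>a\<in>{1..<q - k}. f a (a + k))"
  using assms by (simp add: pair_sum_def lessThan_split)

end

section \<open>Transport of the relations along ring homomorphisms\<close>

context ring_hom_ring
begin

lemma hom_minus: "x \<in> carrier R \<Longrightarrow> y \<in> carrier R \<Longrightarrow> h (x \<ominus>\<^bsub>R\<^esub> y) = h x \<ominus>\<^bsub>S\<^esub> h y"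
  by (simp add: a_minus_def)

lemma hom_ordered_prod:
  "f ` set xs \<subseteq> carrier R \<Longrightarrow> h (ordered_prod R f xs) = ordered_prod S (\<lambda>x. h (f x)) xs"
  by (induction xs) auto

lemma hom_yb:
  assumes "\<And>a. a < q \<Longrightarrow> d a \<in> carrier R" "t \<le> q"
  shows "h (yb_left R d q t) = yb_left S (\<lambda>a. h (d a)) q t"
    and "h (yb_right R d q t) = yb_right S (\<lambda>a. h (d a)) q t"
proof -
  have P: "h (ordered_prod R d xs) = ordered_prod S (\<lambda>a. h (d a)) xs" if "set xs \<subseteq> {..<q}" for xs
    using that assms by (intro hom_ordered_prod) auto
  have N: "h (ordered_prod R (\<lambda>a. \<one>\<^bsub>R\<^esub> \<ominus>\<^bsub>R\<^esub> d a) xs) = ordered_prod S (\<lambda>a. \<one>\<^bsub>S\<^esub> \<ominus>\<^bsub>S\<^esub> h (d a)) xs"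
    if "set xs \<subseteq> {..<q}" for xs
  proof -
    have "h (ordered_prod R (\<lambda>a. \<one>\<^bsub>R\<^esub> \<ominus>\<^bsub>R\<^esub> d a) xs) = ordered_prod S (\<lambda>a. h (\<one>\<^bsub>R\<^esub> \<ominus>\<^bsub>R\<^esub> d a)) xs"
      using that assms by (intro hom_ordered_prod) auto
    also have "\<dots> = ordered_prod S (\<lambda>a. \<one>\<^bsub>S\<^esub> \<ominus>\<^bsub>S\<^esub> h (d a)) xs"
      using that assms by (intro S.ordered_prod_cong) (auto simp: hom_minus)
    finally show ?thesis .
  qed
  have "ordered_prod R d xs \<in> carrier R" "ordered_prod R (\<lambda>a. \<one>\<^bsub>R\<^esub> \<ominus>\<^bsub>R\<^esub> d a) xs \<in> carrier R"
    if "set xs \<subseteq> {..<q}" for xs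
    using that assms by (auto intro!: R.ordered_prod_closed)
  moreover have "{0..<t} \<subseteq> {..<q}" "{t..<q} \<subseteq> {..<q}" using assms(2) by auto
  ultimately show "h (yb_left R d q t) = yb_left S (\<lambda>a. h (d a)) q t"
    and "h (yb_right R d q t) = yb_right S (\<lambda>a. h (d a)) q t"
    using P N \<open>{0..<t} \<subseteq> {..<q}\<close> \<open>{t..<q} \<subseteq> {..<q}\<close> by (simp_all add: yb_left_def yb_right_def)
qed

lemma hom_pair_sum:
  assumes "\<And>a b. a < q \<Longrightarrow> b < q \<Longrightarrow> f a b \<in> carrier R"
  shows "h (pair_sum R f q k) = pair_sum S (\<lambda>a b. h (f a b)) q k"
  unfolding pair_sum_def using assms by (subst hom_finsum) (auto simp: comp_def)

lemma hom_quad: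
  assumes "\<And>a. a < q \<Longrightarrow> d a \<in> carrier R"
  shows "h (quad_left R d q p) = quad_left S (\<lambda>a. h (d a)) q p"
    and "h (quad_right R d q p) = quad_right S (\<lambda>a. h (d a)) q p"
proof -
  show "h (quad_left R d q p) = quad_left S (\<lambda>a. h (d a)) q p"
    unfolding quad_left_def using assms
    by (subst hom_pair_sum) (auto intro!: S.pair_sum_cong)
  have "h (pair_sum R (\<lambda>a b. d b \<otimes>\<^bsub>R\<^esub> d a) q p) = pair_sum S (\<lambda>a b. h (d b) \<otimes>\<^bsub>S\<^esub> h (d a)) q p"
    using assms by (subst hom_pair_sum) (auto intro!: S.pair_sum_cong)
  moreover have "h (\<Oplus>\<^bsub>R\<^esub>c\<in>{p..<q - p}. d c) = (\<Oplus>\<^bsub>S\<^esub>c\<in>{p..<q - p}. h (d c))"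
    using assms by (subst hom_finsum) (auto simp: comp_def)
  moreover have "pair_sum R (\<lambda>a b. d b \<otimes>\<^bsub>R\<^esub> d a) q p \<in> carrier R" "(\<Oplus>\<^bsub>R\<^esub>c\<in>{p..<q - p}. d c) \<in> carrier R"
    using assms by (auto intro!: R.pair_sum_closed R.finsum_closed)
  ultimately show "h (quad_right R d q p) = quad_right S (\<lambda>a. h (d a)) q p"
    unfolding quad_right_def by (simp add: hom_minus)
qed

end

section \<open>Conjugation by an involution and its effect on a chain through
  \<open>D_1\<close>\<close>

locale ring_involution = ring R for R (structure) +
  fixes s
  assumes s_closed [simp]: "s \<in> carrier R" and s_square: "s \<otimes> s = \<one>"
begin

definition cnj where "cnj x = s \<otimes> x \<otimes> s"

lemma s_cancel [simp]: "x \<in> carrier R \<Longrightarrow> s \<otimes> (s \<otimes> x) = x"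
  by (simp add: m_assoc [symmetric] s_square)

lemma s_cnj: "x \<in> carrier R \<Longrightarrow> s \<otimes> cnj x = x \<otimes> s"
  by (simp add: cnj_def m_assoc)

lemma cnj_cnj [simp]: "x \<in> carrier R \<Longrightarrow> cnj (cnj x) = x"
  by (simp add: cnj_def m_assoc s_square)

lemma cnj_hom: "ring_hom_ring R R cnj"
proof (rule ring_hom_ringI2)
  show "cnj \<in> ring_hom R R"
    by (rule ring_hom_memI) (simp_all add: cnj_def m_assoc s_square l_distr r_distr)
qed (simp_all add: ring_axioms)

sublocale cnj: ring_hom_ring R R cnj by (rule cnj_hom)

end

text \<open>The model is \<open>s = s_i\<close> and \<open>d a = D_(1 + a n)\<close>, the residue
  class containing \<open>D_1\<close>. The assumption \<open>cnj_d\<close> reflects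
  \<open>m + 2 - (1 + a n) = 1 + (q - a) n\<close>.\<close>

locale special_chain = ring_involution +
  fixes d :: "nat \<Rightarrow> 'a" and q :: nat
  assumes d_closed [simp]: "d a \<in> carrier R"
    and d_idem: "d a \<otimes> d a = d a"
    and cnj_d_0: "cnj (d 0) = \<one> \<ominus> d 0 \<ominus> s"
    and cnj_d: "1 \<le> a \<Longrightarrow> a < q \<Longrightarrow> cnj (d a) = d (q - a)"
    and q_pos: "q \<ge> 1"
begin

definition P where "P xs = ordered_prod R d xs"
definition N where "N xs = ordered_prod R (\<lambda>a. \<one> \<ominus> d a) xs"

lemma PN_closed [simp]: "P xs \<in> carrier R" "N xs \<in> carrier R"
  by (auto simp: P_def N_def intro!: ordered_prod_closed)

lemma PN_append: "P (xs @ ys) = P xs \<otimes> P ys" "N (xs @ ys) = N xs \<otimes> N ys"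
  by (auto simp: P_def N_def intro!: ordered_prod_append)

lemma PN_single [simp]: "P [a] = d a" "N [a] = \<one> \<ominus> d a" "P [] = \<one>" "N [] = \<one>"
  by (simp_all add: P_def N_def)

lemma PN_head:
  assumes "x < y"
  shows "P [x..<y] = d x \<otimes> P [Suc x..<y]" "N [x..<y] = (\<one> \<ominus> d x) \<otimes> N [Suc x..<y]"
    "P (rev [x..<y]) = P (rev [Suc x..<y]) \<otimes> d x" "N (rev [x..<y]) = N (rev [Suc x..<y]) \<otimes> (\<one> \<ominus> d x)"
proof -
  have "[x..<y] = [x] @ [Suc x..<y]" using assms by (simp add: upt_conv_Cons)
  then show "P [x..<y] = d x \<otimes> P [Suc x..<y]" "N [x..<y] = (\<one> \<ominus> d x) \<otimes> N [Suc x..<y]"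
    "P (rev [x..<y]) = P (rev [Suc x..<y]) \<otimes> d x" "N (rev [x..<y]) = N (rev [Suc x..<y]) \<otimes> (\<one> \<ominus> d x)"
    by (simp_all only: PN_append PN_single rev_append rev_singleton_conv) (simp_all add: PN_append)
qed

lemma PN_last:
  assumes "x \<le> y"
  shows "N [x..<Suc y] = N [x..<y] \<otimes> (\<one> \<ominus> d y)" "P (rev [x..<Suc y]) = d y \<otimes> P (rev [x..<y])"
  using assms PN_append(2) [of "[x..<y]" "[y]"] PN_append(1) [of "[y]" "rev [x..<y]"] by simp_all

lemma cnj_compl: "cnj (\<one> \<ominus> x) = \<one> \<ominus> cnj x" if "x \<in> carrier R"
  using that by (simp add: cnj.hom_minus)

lemma cnj_PN:
  assumes "set xs \<subseteq> {1..<q}"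
  shows "cnj (P xs) = P (map (\<lambda>a. q - a) xs)" "cnj (N xs) = N (map (\<lambda>a. q - a) xs)"
proof -
  have "cnj (P xs) = ordered_prod R (\<lambda>a. cnj (d a)) xs"
    unfolding P_def by (rule cnj.hom_ordered_prod) auto
  also have "\<dots> = ordered_prod R (\<lambda>a. d (q - a)) xs"
    using assms by (intro ordered_prod_cong cnj_d) auto
  finally show "cnj (P xs) = P (map (\<lambda>a. q - a) xs)" by (simp add: P_def ordered_prod_map)
  have "cnj (N xs) = ordered_prod R (\<lambda>a. cnj (\<one> \<ominus> d a)) xs"
    unfolding N_def by (rule cnj.hom_ordered_prod) auto
  also have "\<dots> = ordered_prod R (\<lambda>a. \<one> \<ominus> d (q - a)) xs"
    using assms by (intro ordered_prod_cong) (auto simp: cnj_compl cnj_d)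
  finally show "cnj (N xs) = N (map (\<lambda>a. q - a) xs)" by (simp add: N_def ordered_prod_map)
qed

lemma cnj_PN_upt:
  assumes "1 \<le> x" "y \<le> q"
  shows "cnj (P [x..<y]) = P (rev [q - y + 1..<q - x + 1])" "cnj (N [x..<y]) = N (rev [q - y + 1..<q - x + 1])"
    "cnj (P (rev [x..<y])) = P [q - y + 1..<q - x + 1]" "cnj (N (rev [x..<y])) = N [q - y + 1..<q - x + 1]"
  using assms cnj_PN [of "[x..<y]"] cnj_PN [of "rev [x..<y]"]
  by (simp_all add: rev_upt_conv_map' flip: rev_map)

lemma yb_PN:
  "yb_left R d q t = N [t..<q] \<otimes> P [0..<t]" "yb_right R d q t = P (rev [0..<t]) \<otimes> N (rev [t..<q])"
  by (simp_all add: yb_left_def yb_right_def P_def N_def)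

lemma yb_flip_PN:
  assumes "t \<le> q"
  shows "yb_left R (flip_chain q d) q t = N (rev [0..<q - t]) \<otimes> P (rev [q - t..<q])"
    "yb_right R (flip_chain q d) q t = P [q - t..<q] \<otimes> N [0..<q - t]"
proof -
  let ?f = "\<lambda>a. q - 1 - a"
  have m: "map ?f [t..<q] = rev [0..<q - t]" "map ?f [0..<t] = rev [q - t..<q]"
    using assms rev_upt_conv_map [of q q t] rev_upt_conv_map [of t q 0] by simp_all
  then have m': "map ?f (rev [t..<q]) = [0..<q - t]" "map ?f (rev [0..<t]) = [q - t..<q]"
    by (simp_all only: rev_map [symmetric] rev_rev_ident)
  have "yb_left R (flip_chain q d) q t = N (map ?f [t..<q]) \<otimes> P (map ?f [0..<t])"
    "yb_right R (flip_chain q d) q t = P (map ?f (rev [0..<t])) \<otimes> N (map ?f (rev [t..<q]))"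
    by (simp_all only: yb_left_def yb_right_def P_def N_def flip_chain_def [abs_def] ordered_prod_map)
  then show "yb_left R (flip_chain q d) q t = N (rev [0..<q - t]) \<otimes> P (rev [q - t..<q])"
    "yb_right R (flip_chain q d) q t = P [q - t..<q] \<otimes> N [0..<q - t]"
    by (simp_all only: m m')
qed

lemma d_compl: "d a \<otimes> (\<one> \<ominus> d a) = \<zero>" "(\<one> \<ominus> d a) \<otimes> d a = \<zero>"
proof -
  have "d a \<otimes> (\<one> \<ominus> d a) = d a \<ominus> d a \<otimes> d a" "(\<one> \<ominus> d a) \<otimes> d a = d a \<ominus> d a \<otimes> d a"
    by (simp_all add: a_minus_def l_distr r_distr l_minus r_minus)
  then show "d a \<otimes> (\<one> \<ominus> d a) = \<zero>" "(\<one> \<ominus> d a) \<otimes> d a = \<zero>" by (simp_all add: d_idem)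
qed

text \<open>In the middle range both sides vanish, because \<open>d a\<close> meets \<open>1 - d a\<close>.\<close>

lemma NP_eq_PN:
  assumes "1 \<le> t" "t \<le> q"
  shows "N [t..<q] \<otimes> P (rev [q - t + 1..<q]) = P (rev [1..<t]) \<otimes> N [1..<q - t + 1]"
proof -
  \<comment> \<open>For \<open>t = 1\<close> and \<open>t = q\<close> one product on each side is
    empty and the remaining ones coincide.\<close>
  consider "t = 1" | "t = q" | "1 < t" "t < q" using assms by linarith
  then show ?thesis
  proof cases
    case 3
    then obtain k where k: "q = Suc k" "t \<le> k" by (cases q) auto
    have z1: "(\<one> \<ominus> d k) \<otimes> (d k \<otimes> x) = \<zero>" if "x \<in> carrier R" for x
      using that d_compl(2) [of k] by (simp add: m_assoc [symmetric])
    have z2: "d 1 \<otimes> ((\<one> \<ominus> d 1) \<otimes> x) = \<zero>" if "x \<in> carrier R" for x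
      using that d_compl(1) [of 1] by (simp add: m_assoc [symmetric])
    have "N [t..<q] \<otimes> P (rev [q - t + 1..<q]) = N [t..<k] \<otimes> ((\<one> \<ominus> d k) \<otimes> (d k \<otimes> P (rev [q - t + 1..<k])))"
    proof -
      have le: "q - t + 1 \<le> k" using k 3 by linarith
      have "N [t..<q] = N [t..<k] \<otimes> (\<one> \<ominus> d k)" unfolding k(1) by (rule PN_last(1) [OF k(2)])
      moreover have "P (rev [q - t + 1..<q]) = d k \<otimes> P (rev [q - t + 1..<k])"
        using PN_last(2) [OF le] unfolding k(1) .
      ultimately show ?thesis by (simp add: m_assoc del: upt_Suc)
    qed
    also have "\<dots> = \<zero>" by (simp add: z1)
    also have "\<zero> = P (rev [Suc 1..<t]) \<otimes> (d 1 \<otimes> ((\<one> \<ominus> d 1) \<otimes> N [Suc 1..<q - t + 1]))"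
      by (simp only: z2 PN_closed r_null)
    also have "\<dots> = P (rev [1..<t]) \<otimes> N [1..<q - t + 1]"
      using 3 PN_head [of 1 t] PN_head [of 1 "q - t + 1"] by (simp add: m_assoc)
    finally show ?thesis .
  qed (use assms in simp_all)
qed

text \<open>The factor \<open>d 0\<close> becomes \<open>1 - d 0 - s\<close>, and every other
  position \<open>a\<close> moves to \<open>q - a\<close>, which is position \<open>a - 1\<close> of
  the reversed chain. The part \<open>1 - d 0\<close> sits at the last position of that chain, so
  one plain factor has become a complementary one and \<open>t\<close> drops by one. The parts with
  \<open>s\<close> agree on both sides.\<close>

lemma cnj_yb_pos:
  assumes "1 \<le> t" "t \<le> q"
  shows "cnj (yb_left R d q t \<ominus> yb_right R d q t)
    = yb_left R (flip_chain q d) q (t - 1) \<ominus> yb_right R (flip_chain q d) q (t - 1)"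
proof -
  define A A' B B' where "A = N (rev [1..<q - t + 1])" and "A' = N [1..<q - t + 1]"
    and "B = P (rev [q - t + 1..<q])" and "B' = P [q - t + 1..<q]"
  have c [simp]: "A \<in> carrier R" "A' \<in> carrier R" "B \<in> carrier R" "B' \<in> carrier R"
    by (simp_all add: A_def A'_def B_def B'_def)
  have cA: "cnj (N [t..<q]) = A" "cnj (N (rev [t..<q])) = A'"
    using cnj_PN_upt [of t q] assms by (simp_all add: A_def A'_def)
  have cB: "cnj (P [1..<t]) = B" "cnj (P (rev [1..<t])) = B'"
    using cnj_PN_upt [of 1 t] assms by (simp_all add: B_def B'_def)
  have "yb_left R d q t = N [t..<q] \<otimes> (d 0 \<otimes> P [1..<t])" "yb_right R d q t = P (rev [1..<t]) \<otimes> d 0 \<otimes> N (rev [t..<q])"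
    using assms PN_head [of 0 t] by (simp_all add: yb_PN)
  then have l: "cnj (yb_left R d q t) = A \<otimes> ((\<one> \<ominus> d 0 \<ominus> s) \<otimes> B)"
    and r: "cnj (yb_right R d q t) = B' \<otimes> (\<one> \<ominus> d 0 \<ominus> s) \<otimes> A'"
    by (simp_all add: cA cB [unfolded One_nat_def] cnj_d_0)
  have "q - (t - 1) = q - t + 1" using assms by simp
  then have fl: "yb_left R (flip_chain q d) q (t - 1) = A \<otimes> (\<one> \<ominus> d 0) \<otimes> B"
    and fr: "yb_right R (flip_chain q d) q (t - 1) = B' \<otimes> ((\<one> \<ominus> d 0) \<otimes> A')"
    using yb_flip_PN [of "t - 1"] assms PN_head [of 0 "q - t + 1"]
    by (simp_all add: A_def A'_def B_def B'_def)
  \<comment> \<open>Moving \<open>s\<close> to the left undoes the conjugation of \<open>A\<close>;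
    then \<open>NP_eq_PN\<close> applies, and moving \<open>s\<close> back conjugates the left
    factor on the other side.\<close>
  have "A \<otimes> s \<otimes> B = s \<otimes> (N [t..<q] \<otimes> B)"
    using s_cnj [of A] cA(1) cnj_cnj [of "N [t..<q]"] by (simp add: m_assoc [symmetric])
  also have "\<dots> = s \<otimes> (P (rev [1..<t]) \<otimes> A')" using NP_eq_PN [OF assms] by (simp add: A'_def B_def)
  also have "\<dots> = B' \<otimes> s \<otimes> A'"
    using s_cnj [of B'] cB(2) cnj_cnj [of "P (rev [1..<t])"] by (simp add: m_assoc [symmetric])
  finally have key: "A \<otimes> s \<otimes> B = B' \<otimes> s \<otimes> A'" .
  have "cnj (yb_left R d q t \<ominus> yb_right R d q t)
      = A \<otimes> ((\<one> \<ominus> d 0 \<ominus> s) \<otimes> B) \<ominus> B' \<otimes> (\<one> \<ominus> d 0 \<ominus> s) \<otimes> A'"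
    using yb_closed [of q d t] assms by (simp add: cnj.hom_minus l r)
  also have "\<dots> = (A \<otimes> (\<one> \<ominus> d 0) \<otimes> B \<ominus> A \<otimes> s \<otimes> B) \<ominus> (B' \<otimes> ((\<one> \<ominus> d 0) \<otimes> A') \<ominus> B' \<otimes> s \<otimes> A')"
  proof -
    have e [simp]: "\<one> \<ominus> d 0 \<in> carrier R" by simp
    have "A \<otimes> ((e \<ominus> s) \<otimes> B) = A \<otimes> e \<otimes> B \<ominus> A \<otimes> s \<otimes> B"
      "B' \<otimes> (e \<ominus> s) \<otimes> A' = B' \<otimes> (e \<otimes> A') \<ominus> B' \<otimes> s \<otimes> A'" if "e \<in> carrier R" for e
      using that by (simp_all add: a_minus_def l_distr r_distr l_minus r_minus m_assoc)
    then show ?thesis by simp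
  qed
  also have "\<dots> = A \<otimes> (\<one> \<ominus> d 0) \<otimes> B \<ominus> B' \<otimes> ((\<one> \<ominus> d 0) \<otimes> A')"
  proof -
    have "(x \<ominus> z) \<ominus> (y \<ominus> z) = x \<ominus> y" if "x \<in> carrier R" "y \<in> carrier R" "z \<in> carrier R" for x y z
      using that by algebra
    then show ?thesis unfolding key by simp
  qed
  finally show ?thesis by (simp only: fl fr)
qed

text \<open>Now position 0 carries \<open>1 - d 0\<close>, whose conjugate is
  \<open>d 0 + s\<close>. The other factors form \<open>A'\<close>, with conjugate \<open>A\<close>,
  so the terms \<open>s A\<close> and \<open>A' s\<close> cancel. What remains is the case
  \<open>t = 1\<close> with its sides interchanged, hence the sign.\<close>

lemma cnj_yb_0:
  "cnj (yb_left R d q 0 \<ominus> yb_right R d q 0) = \<ominus> (yb_left R d q 1 \<ominus> yb_right R d q 1)"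
proof -
  define A A' where "A = N (rev [1..<q])" and "A' = N [1..<q]"
  have c [simp]: "A \<in> carrier R" "A' \<in> carrier R" by (simp_all add: A_def A'_def)
  have cA: "cnj A = A'" "cnj A' = A"
  proof -
    have "q - q + 1 = 1" "q - 1 + 1 = q" using q_pos by simp_all
    then show "cnj A = A'" "cnj A' = A"
      using cnj_PN_upt [of 1 q] unfolding A_def A'_def by (simp_all only: order_refl simp_thms)
  qed
  have c0: "cnj (\<one> \<ominus> d 0) = d 0 \<oplus> s"
  proof -
    have "\<one> \<ominus> (\<one> \<ominus> x \<ominus> y) = x \<oplus> y" if "x \<in> carrier R" "y \<in> carrier R" for x y
      using that by algebra
    then show ?thesis by (simp add: cnj_compl cnj_d_0)
  qed
  have y0: "yb_left R d q 0 = (\<one> \<ominus> d 0) \<otimes> A'" "yb_right R d q 0 = A \<otimes> (\<one> \<ominus> d 0)"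
    using q_pos PN_head [of 0 q] by (simp_all add: yb_PN A_def A'_def)
  have y1: "yb_left R d q 1 = A' \<otimes> d 0" "yb_right R d q 1 = d 0 \<otimes> A"
    by (simp_all add: yb_PN A_def A'_def)
  have key: "s \<otimes> A = A' \<otimes> s" using s_cnj [of A'] cA by simp
  have "cnj (yb_left R d q 0 \<ominus> yb_right R d q 0) = (d 0 \<oplus> s) \<otimes> A \<ominus> A' \<otimes> (d 0 \<oplus> s)"
    by (simp add: y0 cnj.hom_minus cA c0)
  also have "\<dots> = (d 0 \<otimes> A \<oplus> s \<otimes> A) \<ominus> (A' \<otimes> d 0 \<oplus> A' \<otimes> s)" by (simp add: l_distr r_distr)
  also have "\<dots> = \<ominus> (A' \<otimes> d 0 \<ominus> d 0 \<otimes> A)"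
  proof -
    have "(x \<oplus> z) \<ominus> (y \<oplus> z) = \<ominus> (y \<ominus> x)" if "x \<in> carrier R" "y \<in> carrier R" "z \<in> carrier R" for x y z
      using that by algebra
    then show ?thesis unfolding key by simp
  qed
  finally show ?thesis by (simp only: y1)
qed

text \<open>Counterpart of \<open>cnj_yb_0\<close>: in the reversed chain \<open>d 0\<close> stands
  last, and at \<open>t = q\<close> it is a plain factor. It turns into a complementary factor and
  the sides are interchanged.\<close>

lemma cnj_yb_flip_q:
  "cnj (yb_left R (flip_chain q d) q q \<ominus> yb_right R (flip_chain q d) q q)
    = \<ominus> (yb_left R (flip_chain q d) q (q - 1) \<ominus> yb_right R (flip_chain q d) q (q - 1))"
proof -
  define A A' where "A = P (rev [1..<q])" and "A' = P [1..<q]"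
  have c [simp]: "A \<in> carrier R" "A' \<in> carrier R" by (simp_all add: A_def A'_def)
  have cA: "cnj A = A'" "cnj A' = A"
  proof -
    have "q - q + 1 = 1" "q - 1 + 1 = q" using q_pos by simp_all
    then show "cnj A = A'" "cnj A' = A"
      using cnj_PN_upt [of 1 q] unfolding A_def A'_def by (simp_all only: order_refl simp_thms)
  qed
  have yq: "yb_left R (flip_chain q d) q q = A \<otimes> d 0" "yb_right R (flip_chain q d) q q = d 0 \<otimes> A'"
    using q_pos PN_head [of 0 q] yb_flip_PN [of q] by (simp_all add: A_def A'_def)
  have "q - (q - 1) = 1" using q_pos by simp
  then have y1: "yb_left R (flip_chain q d) q (q - 1) = (\<one> \<ominus> d 0) \<otimes> A"
    "yb_right R (flip_chain q d) q (q - 1) = A' \<otimes> (\<one> \<ominus> d 0)"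
    using yb_flip_PN [of "q - 1"] by (simp_all add: A_def A'_def)
  have key: "s \<otimes> A = A' \<otimes> s" using s_cnj [of A'] cA by simp
  have "cnj (yb_left R (flip_chain q d) q q \<ominus> yb_right R (flip_chain q d) q q)
      = A' \<otimes> (\<one> \<ominus> d 0 \<ominus> s) \<ominus> (\<one> \<ominus> d 0 \<ominus> s) \<otimes> A"
    by (simp add: yq cnj.hom_minus cA cnj_d_0)
  also have "\<dots> = (A' \<otimes> (\<one> \<ominus> d 0) \<ominus> A' \<otimes> s) \<ominus> ((\<one> \<ominus> d 0) \<otimes> A \<ominus> s \<otimes> A)"
  proof -
    have "A' \<otimes> (e \<ominus> s) = A' \<otimes> e \<ominus> A' \<otimes> s" "(e \<ominus> s) \<otimes> A = e \<otimes> A \<ominus> s \<otimes> A" if "e \<in> carrier R" for e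
      using that by (simp_all add: a_minus_def l_distr r_distr l_minus r_minus)
    then show ?thesis by simp
  qed
  also have "\<dots> = \<ominus> ((\<one> \<ominus> d 0) \<otimes> A \<ominus> A' \<otimes> (\<one> \<ominus> d 0))"
  proof -
    have "(x \<ominus> z) \<ominus> (y \<ominus> z) = \<ominus> (y \<ominus> x)" if "x \<in> carrier R" "y \<in> carrier R" "z \<in> carrier R" for x y z
      using that by algebra
    then show ?thesis unfolding key by simp
  qed
  finally show ?thesis by (simp only: y1)
qed

text \<open>Inverse of \<open>cnj_yb_pos\<close>, since conjugating twice is the identity.\<close>

lemma cnj_yb_flip:
  assumes "t < q"
  shows "cnj (yb_left R (flip_chain q d) q t \<ominus> yb_right R (flip_chain q d) q t)
    = yb_left R d q (Suc t) \<ominus> yb_right R d q (Suc t)"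
  using cnj_yb_pos [of "Suc t"] assms yb_closed [of q d "Suc t"]
  by (metis One_nat_def Suc_leI cnj_cnj d_closed diff_Suc_1 le_add1 minus_closed plus_1_eq_Suc)

text \<open>Each side has one pair involving index 0: \<open>(0, q - p)\<close> on the left and
  \<open>(0, p)\<close> on the right. After conjugation their terms \<open>s d p\<close> and
  \<open>d (q - p) s\<close> are equal and cancel, and the products with \<open>d 0\<close> change
  sides to become the missing end pairs of the reversed chain. In the linear sum the endpoint
  \<open>p\<close> moves to \<open>q - p\<close> and cancels the linear term from the right pair,
  while the term \<open>d p\<close> from the left pair restores the endpoint.\<close>

lemma cnj_quad:
  assumes "1 \<le> p" "2 * p < q"
  shows "cnj (quad_left R d q p \<ominus> quad_right R d q p)
    = quad_left R (flip_chain q d) q p \<ominus> quad_right R (flip_chain q d) q p"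
proof -
  define X where "X = (\<Oplus>a\<in>{1..<p}. d (a + (q - p)) \<otimes> d a)"
  define Y where "Y = (\<Oplus>a\<in>{1..<q - p}. d a \<otimes> d (a + p))"
  define L where "L = (\<Oplus>c\<in>{p..<q - p}. d c)"
  define L' where "L' = (\<Oplus>c\<in>{Suc p..<q - p}. d c)"
  have c [simp]: "X \<in> carrier R" "Y \<in> carrier R" "L \<in> carrier R" "L' \<in> carrier R"
    by (auto simp: X_def Y_def L_def L'_def intro!: finsum_closed)
  have qp: "q - (q - p) = p" "q - p < q" "p < q" using assms by auto
  have QF: "quad_left R (flip_chain q d) q p = d (q - p) \<otimes> d 0 \<oplus> X"
    "quad_right R (flip_chain q d) q p = (d 0 \<otimes> d p \<oplus> Y) \<ominus> L"
    using qp by (simp_all add: quad_flip pair_sum_split X_def Y_def L_def)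
  have cX: "cnj (\<Oplus>a\<in>{1..<p}. d a \<otimes> d (a + (q - p))) = X"
  proof -
    have "cnj (\<Oplus>a\<in>{1..<p}. d a \<otimes> d (a + (q - p))) = (\<Oplus>a\<in>{1..<p}. cnj (d a \<otimes> d (a + (q - p))))"
      by (subst cnj.hom_finsum) (auto simp: comp_def)
    also have "\<dots> = (\<Oplus>a\<in>{1..<p}. d (p - a + (q - p)) \<otimes> d (p - a))"
    proof (rule finsum_cong')
      fix a assume a: "a \<in> {1..<p}"
      then have "q - a = p - a + (q - p)" "q - (a + (q - p)) = p - a" using assms by auto
      moreover have "cnj (d a) = d (q - a)" "cnj (d (a + (q - p))) = d (q - (a + (q - p)))"
        using a assms by (intro cnj_d; auto)+
      ultimately show "cnj (d a \<otimes> d (a + (q - p))) = d (p - a + (q - p)) \<otimes> d (p - a)"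
        by (simp only: cnj.hom_mult d_closed)
    qed auto
    also have "\<dots> = X"
      unfolding X_def using finsum_flip [of "\<lambda>a. d (a + (q - p)) \<otimes> d a" 1 "p - 1" p] assms
      by (simp add: atLeastLessThanSuc_atLeastAtMost [symmetric])
    finally show ?thesis .
  qed
  have cY: "cnj (\<Oplus>a\<in>{1..<q - p}. d (a + p) \<otimes> d a) = Y"
  proof -
    have "cnj (\<Oplus>a\<in>{1..<q - p}. d (a + p) \<otimes> d a) = (\<Oplus>a\<in>{1..<q - p}. cnj (d (a + p) \<otimes> d a))"
      by (subst cnj.hom_finsum) (auto simp: comp_def)
    also have "\<dots> = (\<Oplus>a\<in>{1..<q - p}. d (q - p - a) \<otimes> d (q - p - a + p))"
    proof (rule finsum_cong')
      fix a assume a: "a \<in> {1..<q - p}"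
      then have "q - (a + p) = q - p - a" "q - a = q - p - a + p" by auto
      moreover have "cnj (d a) = d (q - a)" "cnj (d (a + p)) = d (q - (a + p))"
        using a assms by (intro cnj_d; auto)+
      ultimately show "cnj (d (a + p) \<otimes> d a) = d (q - p - a) \<otimes> d (q - p - a + p)"
        by (simp only: cnj.hom_mult d_closed)
    qed auto
    also have "\<dots> = Y"
      unfolding Y_def using finsum_flip [of "\<lambda>a. d a \<otimes> d (a + p)" 1 "q - p - 1" "q - p"] assms
      by (simp add: atLeastLessThanSuc_atLeastAtMost [symmetric])
    finally show ?thesis .
  qed
  have "{p..<q - p} = insert p {Suc p..<q - p}" using assms by auto
  then have L: "L = d p \<oplus> L'" by (simp add: L_def L'_def)
  have cL': "cnj L' = L'"
  proof -
    have "cnj L' = (\<Oplus>c\<in>{Suc p..<q - p}. cnj (d c))"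
      unfolding L'_def by (subst cnj.hom_finsum) (auto simp: comp_def)
    also have "\<dots> = (\<Oplus>c\<in>{Suc p..<q - p}. d (q - c))"
      by (rule finsum_cong') (auto simp: cnj_d)
    also have "\<dots> = L'"
    proof (cases "Suc p < q - p")
      case True
      then have "{Suc p..<q - p} = {Suc p..q - p - 1}" by auto
      then show ?thesis unfolding L'_def using finsum_flip [of d "Suc p" "q - p - 1" q] True by simp
    qed (simp add: L'_def)
    finally show ?thesis .
  qed
  have cdp: "cnj (d p) = d (q - p)" "cnj (d (q - p)) = d p" using assms cnj_d qp by auto
  have "quad_left R d q p = d 0 \<otimes> d (q - p) \<oplus> (\<Oplus>a\<in>{1..<p}. d a \<otimes> d (a + (q - p)))"
    using qp by (simp add: quad_left_def pair_sum_split)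
  then have cl: "cnj (quad_left R d q p) = (\<one> \<ominus> d 0 \<ominus> s) \<otimes> d p \<oplus> X"
    using cX by (simp add: cnj_d_0 cdp Pi_def finsum_closed del: cnj.hom_finsum)
  have "quad_right R d q p = (d p \<otimes> d 0 \<oplus> (\<Oplus>a\<in>{1..<q - p}. d (a + p) \<otimes> d a)) \<ominus> (d p \<oplus> L')"
    using qp L by (simp add: quad_right_def pair_sum_split L_def)
  then have cr: "cnj (quad_right R d q p) = (d (q - p) \<otimes> (\<one> \<ominus> d 0 \<ominus> s) \<oplus> Y) \<ominus> (d (q - p) \<oplus> L')"
    using cY cL' by (simp add: cnj_d_0 cdp cnj.hom_minus Pi_def finsum_closed del: cnj.hom_finsum)
  have key: "s \<otimes> d p = d (q - p) \<otimes> s" using s_cnj [of "d (q - p)"] cdp by simp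
  have "cnj (quad_left R d q p \<ominus> quad_right R d q p)
      = ((\<one> \<ominus> d 0 \<ominus> s) \<otimes> d p \<oplus> X) \<ominus> ((d (q - p) \<otimes> (\<one> \<ominus> d 0 \<ominus> s) \<oplus> Y) \<ominus> (d (q - p) \<oplus> L'))"
    using quad_closed [of q d p] by (simp add: cnj.hom_minus cl cr)
  also have "\<dots> = ((d p \<ominus> d 0 \<otimes> d p \<ominus> s \<otimes> d p) \<oplus> X)
      \<ominus> (((d (q - p) \<ominus> d (q - p) \<otimes> d 0 \<ominus> d (q - p) \<otimes> s) \<oplus> Y) \<ominus> (d (q - p) \<oplus> L'))"
    by (simp add: a_minus_def l_distr r_distr l_minus r_minus)
  also have "\<dots> = (d (q - p) \<otimes> d 0 \<oplus> X) \<ominus> ((d 0 \<otimes> d p \<oplus> Y) \<ominus> (d p \<oplus> L'))"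
  proof -
    have "((p1 \<ominus> u \<ominus> z) \<oplus> x) \<ominus> (((p2 \<ominus> v \<ominus> z) \<oplus> y) \<ominus> (p2 \<oplus> l)) = (v \<oplus> x) \<ominus> ((u \<oplus> y) \<ominus> (p1 \<oplus> l))"
      if "p1 \<in> carrier R" "p2 \<in> carrier R" "u \<in> carrier R" "v \<in> carrier R" "x \<in> carrier R"
        "y \<in> carrier R" "z \<in> carrier R" "l \<in> carrier R" for p1 p2 u v x y z l
      using that by algebra
    then show ?thesis unfolding key by simp
  qed
  finally show ?thesis by (simp add: QF L)
qed

lemma cnj_quad_flip:
  assumes "1 \<le> p" "2 * p < q"
  shows "cnj (quad_left R (flip_chain q d) q p \<ominus> quad_right R (flip_chain q d) q p)
    = quad_left R d q p \<ominus> quad_right R d q p"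
  using cnj_quad [OF assms, symmetric] quad_closed [of q d p] by simp

end

section \<open>The relations in a dihedral subgroup\<close>

context ring
begin

lemma subring_inclusion_hom: "subring K R \<Longrightarrow> ring_hom_ring (R\<lparr>carrier := K\<rparr>) R (\<lambda>x. x)"
  by (rule ring_hom_ringI2 [OF subring_is_ring ring_axioms])
    (auto simp: ring_hom_def dest: subsetD [OF subringE(1)])

text \<open>Form the expressions in the subring, regarded as a ring of its own, where they are
  closed; the inclusion is a homomorphism, so they agree with those of the big ring.\<close>

lemma subring_yb_quad:
  assumes K: "subring K R" and d: "\<And>a. a < q \<Longrightarrow> d a \<in> K"
  shows "t \<le> q \<Longrightarrow> yb_left R d q t \<in> K" "t \<le> q \<Longrightarrow> yb_right R d q t \<in> K"
    "quad_left R d q p \<in> K" "quad_right R d q p \<in> K"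
proof -
  interpret incl: ring_hom_ring "R\<lparr>carrier := K\<rparr>" R "\<lambda>x. x" by (rule subring_inclusion_hom [OF K])
  show "yb_left R d q t \<in> K" "yb_right R d q t \<in> K" if "t \<le> q"
    using incl.hom_yb [of q d t] incl.R.yb_closed [of q d t] d that by simp_all
  show "quad_left R d q p \<in> K" "quad_right R d q p \<in> K"
    using incl.hom_quad [of q d p] incl.R.quad_closed [of q d p] d by simp_all
qed

text \<open>Both signs of the Yang-Baxter type differences occur, because at \<open>t = 0\<close> and \<open>t = q\<close>
  conjugation by a generator exchanges the two sides.\<close>

definition relators :: "(nat \<Rightarrow> 'a) \<Rightarrow> nat \<Rightarrow> 'a set" where
  "relators d q =
     {yb_left R d q t \<ominus> yb_right R d q t | t. t \<le> q}
   \<union> {\<ominus> (yb_left R d q t \<ominus> yb_right R d q t) | t. t \<le> q}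
   \<union> {quad_left R d q p \<ominus> quad_right R d q p | p. 1 \<le> p \<and> 2 * p < q}"

lemma relatorsE [consumes 1]:
  assumes "x \<in> relators d q"
  obtains (yb) t where "t \<le> q" "x = yb_left R d q t \<ominus> yb_right R d q t"
  | (minus_yb) t where "t \<le> q" "x = \<ominus> (yb_left R d q t \<ominus> yb_right R d q t)"
  | (quad) p where "1 \<le> p" "2 * p < q" "x = quad_left R d q p \<ominus> quad_right R d q p"
  using assms unfolding relators_def by auto

lemma relatorsI:
  "t \<le> q \<Longrightarrow> yb_left R d q t \<ominus> yb_right R d q t \<in> relators d q"
  "t \<le> q \<Longrightarrow> \<ominus> (yb_left R d q t \<ominus> yb_right R d q t) \<in> relators d q"
  "1 \<le> p \<Longrightarrow> 2 * p < q \<Longrightarrow> quad_left R d q p \<ominus> quad_right R d q p \<in> relators d q"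
  unfolding relators_def by blast+

lemma relators_cong_subset:
  assumes "\<And>a. a < q \<Longrightarrow> d a = e a" "\<And>a. a < q \<Longrightarrow> e a \<in> carrier R"
  shows "relators d q \<subseteq> relators e q"
proof
  fix x assume "x \<in> relators d q"
  then show "x \<in> relators e q"
    by (cases rule: relatorsE) (simp_all add: yb_cong [OF assms(1)] quad_cong [OF assms] relatorsI)
qed

lemma relators_cong:
  assumes "\<And>a. a < q \<Longrightarrow> d a = e a" "\<And>a. a < q \<Longrightarrow> e a \<in> carrier R"
  shows "relators d q = relators e q"
  using relators_cong_subset [of q d e] relators_cong_subset [of q e d] assms by force

end

lemma (in ring_hom_ring) hom_relators:
  assumes d: "\<And>a. a < q \<Longrightarrow> d a \<in> carrier R" and x: "x \<in> R.relators d q"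
  shows "h x \<in> S.relators (\<lambda>a. h (d a)) q"
  using x
proof (cases rule: R.relatorsE)
  case (yb t)
  then show ?thesis using R.yb_closed [of q d t] d hom_yb [of q d t] S.relatorsI(1) [of t q]
    by (simp add: hom_minus)
next
  case (minus_yb t)
  then show ?thesis using R.yb_closed [of q d t] d hom_yb [of q d t] S.relatorsI(2) [of t q]
    by (simp add: hom_minus)
next
  case (quad p)
  then show ?thesis using R.quad_closed [of q d p] d hom_quad [of q d p] S.relatorsI(3) [of p q]
    by (simp add: hom_minus)
qed

context special_chain
begin

lemma cnj_relators:
  assumes "x \<in> relators d q" shows "cnj x \<in> relators d q \<union> relators (flip_chain q d) q"
  using assms
proof (cases rule: relatorsE)
  case (yb t)
  then show ?thesis
    using cnj_yb_0 cnj_yb_pos [of t] q_pos relatorsI(2) [of 1 q d] relatorsI(1) [of "t - 1" q "flip_chain q d"]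
    by (cases "t = 0") auto
next
  case (minus_yb t)
  have c: "yb_left R d q t \<ominus> yb_right R d q t \<in> carrier R" "yb_left R d q 1 \<ominus> yb_right R d q 1 \<in> carrier R"
    using yb_closed [of q d t] yb_closed [of q d 1] minus_yb q_pos by simp_all
  show ?thesis
  proof (cases "t = 0")
    case True
    then have "cnj x = yb_left R d q 1 \<ominus> yb_right R d q 1"
      using minus_yb c cnj_yb_0 by (simp add: cnj.hom_a_inv)
    then show ?thesis using relatorsI(1) [of 1 q d] q_pos by simp
  next
    case False
    then have "cnj x = \<ominus> (yb_left R (flip_chain q d) q (t - 1) \<ominus> yb_right R (flip_chain q d) q (t - 1))"
      using minus_yb c cnj_yb_pos [of t] by (simp add: cnj.hom_a_inv)
    then show ?thesis using relatorsI(2) [of "t - 1" q "flip_chain q d"] minus_yb by simp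
  qed
next
  case (quad p)
  then show ?thesis using cnj_quad relatorsI(3) [of p q "flip_chain q d"] by simp
qed

lemma cnj_relators_flip:
  assumes "x \<in> relators (flip_chain q d) q"
  shows "cnj x \<in> relators d q \<union> relators (flip_chain q d) q"
  using assms
proof (cases rule: relatorsE)
  case (yb t)
  then show ?thesis
    using cnj_yb_flip_q cnj_yb_flip [of t] relatorsI(2) [of "q - 1" q "flip_chain q d"] relatorsI(1) [of "Suc t" q d]
    by (cases "t = q") auto
next
  case (minus_yb t)
  let ?e = "flip_chain q d"
  have c: "yb_left R ?e q t \<ominus> yb_right R ?e q t \<in> carrier R"
    "yb_left R ?e q (q - 1) \<ominus> yb_right R ?e q (q - 1) \<in> carrier R"
    using yb_closed [of q ?e t] yb_closed [of q ?e "q - 1"] minus_yb by (simp_all add: flip_chain_def)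
  show ?thesis
  proof (cases "t = q")
    case True
    then have "cnj x = yb_left R ?e q (q - 1) \<ominus> yb_right R ?e q (q - 1)"
      using minus_yb c cnj_yb_flip_q by (simp add: cnj.hom_a_inv)
    then show ?thesis using relatorsI(1) [of "q - 1" q ?e] by simp
  next
    case False
    then have "cnj x = \<ominus> (yb_left R d q (Suc t) \<ominus> yb_right R d q (Suc t))"
      using minus_yb c cnj_yb_flip [of t] by (simp add: cnj.hom_a_inv)
    then show ?thesis using relatorsI(2) [of "Suc t" q d] minus_yb False by simp
  qed
next
  case (quad p)
  then show ?thesis using cnj_quad_flip relatorsI(3) [of p q d] by simp
qed

end

section \<open>Reflections of the dihedral subgroup and the action of its generators\<close>

context coxeter
begin

lemma parabolic_cls: "set u \<subseteq> J \<Longrightarrow> cls u \<in> parabolic m J"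
proof (induction u)
  case Nil
  show ?case unfolding parabolic_def cls_one [symmetric] by (rule generate.one)
next
  case (Cons a u)
  then have "gen a \<in> parabolic m J" "cls u \<in> parabolic m J"
    by (auto simp: parabolic_def intro: generate.incl)
  then have "gen a \<otimes>\<^bsub>W\<^esub> cls u \<in> parabolic m J" unfolding parabolic_def by (rule generate.eng)
  then show ?case by (simp add: gen_eq cls_mult)
qed

lemma parabolicE:
  assumes "x \<in> parabolic m J" obtains u where "set u \<subseteq> J" "x = cls u"
proof -
  have "\<exists>u. set u \<subseteq> J \<and> x = cls u"
    using assms unfolding parabolic_def
  proof (induction rule: generate.induct)
    case one
    show ?case by (intro exI [of _ "[]"]) (simp add: cls_one)
  next
    case (incl h)
    then obtain a where "a \<in> J" "h = gen a" by auto
    then show ?case by (intro exI [of _ "[a]"]) (simp add: gen_eq)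
  next
    case ("inv" h)
    then obtain a where "a \<in> J" "h = gen a" by auto
    then show ?case by (intro exI [of _ "[a]"]) (simp add: inv_gen, simp add: gen_eq)
  next
    case (eng h1 h2)
    then obtain u v where "set u \<subseteq> J" "h1 = cls u" "set v \<subseteq> J" "h2 = cls v" by auto
    then show ?case by (intro exI [of _ "u @ v"]) (simp add: cls_mult)
  qed
  then show ?thesis using that by blast
qed

definition dref :: "'i \<Rightarrow> 'i \<Rightarrow> nat \<Rightarrow> 'i list set" where
  "dref i j k = cls (alternating i j (2 * k - 1))"

lemma dref_rot: "k \<ge> 1 \<Longrightarrow> dref i j k = rot i j [^]\<^bsub>W\<^esub> (k - 1) \<otimes>\<^bsub>W\<^esub> gen i"
  using cls_alternating_odd [of i j "k - 1"] by (cases k) (simp_all add: dref_def)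

lemma dref_reflection: "k \<ge> 1 \<Longrightarrow> dref i j k \<in> reflections m"
  unfolding dref_rot cj_alternating_gen [symmetric] by (rule cj_in_reflections)

lemma dref_1: "dref i j 1 = gen i"
  by (simp add: dref_def gen_eq)

lemma dref_parabolic: "dref i j k \<in> parabolic m {i, j}"
  unfolding dref_def by (intro parabolic_cls set_alternating)

text \<open>Here the exact order of \<open>s_i s_j\<close> enters: \<open>s_i D_k s_i\<close> is the
  element of the conjugate reflection only as long as \<open>k\<close> does not name
  \<open>s_i\<close> itself.\<close>

lemma dref_neq_gen:
  assumes "i \<noteq> j" "2 \<le> k" "k \<le> m i j" shows "dref i j k \<noteq> gen i"
proof
  assume "dref i j k = gen i"
  then have "rot i j [^]\<^bsub>W\<^esub> (k - 1) = \<one>\<^bsub>W\<^esub>"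
    using assms by (simp add: dref_rot W.l_cancel_one')
  then show False using rot_order [OF assms(1), of "k - 1"] assms by simp
qed

lemma cls_involution_eqI:
  assumes "cls (u @ v) = cls []" "cls (v @ v) = cls []" shows "cls u = cls v"
  using assms W.right_cancel [of "cls v" "cls u" "cls v"] by (simp add: cls_mult)

text \<open>The two odd alternating words concatenate to an alternating word of length
  \<open>2 * m i j\<close>, which is trivial in \<open>W\<close>. So they are mutually inverse, and
  being palindromes they are involutions.\<close>

lemma dref_swap:
  assumes "1 \<le> l" "l \<le> m i j" shows "dref j i l = dref i j (m i j + 1 - l)"
proof -
  define k where "k = m i j + 1 - l"
  have k: "k \<ge> 1" using assms by (simp add: k_def)
  have "alternating j i (2 * l - 1) @ alternating i j (2 * k - 1) = alternating j i ((2 * l - 1) + (2 * k - 1))"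
    using assms by (subst alternating_add) simp
  also have "(2 * l - 1) + (2 * k - 1) = 2 * m i j" using assms by (simp add: k_def)
  finally have 1: "cls (alternating j i (2 * l - 1) @ alternating i j (2 * k - 1)) = cls []"
    using rot_pow_m [of j i] m_sym [of i j] by (simp add: cls_alternating_even cls_one)
  have "alternating i j (2 * k - 1) = rev (alternating i j (2 * k - 1))"
  proof -
    have "alternating i j (Suc (2 * n)) = rev (alternating i j (Suc (2 * n)))" for n
    proof (induction n)
      case (Suc n)
      have "alternating i j (Suc (2 * Suc n)) = alternating i j (Suc (2 * n)) @ [j, i]"
        using alternating_snoc [of i j "Suc (2 * n)"] alternating_snoc [of i j "Suc (Suc (2 * n))"] by simp
      moreover have "alternating i j (Suc (2 * Suc n)) = [i, j] @ alternating i j (Suc (2 * n))" by simp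
      ultimately show ?case using Suc.IH by (metis append_Cons append_Nil rev.simps(1,2) rev_append)
    qed simp
    then show ?thesis using k by (cases k) simp_all
  qed
  then have "cls (alternating i j (2 * k - 1) @ alternating i j (2 * k - 1)) = cls []"
    using cls_rev [of "alternating i j (2 * k - 1)"] by simp
  from cls_involution_eqI [OF 1 this] show ?thesis by (simp add: dref_def k_def)
qed

text \<open>For \<open>k >= 2\<close> the palindrome starts and ends with \<open>i\<close> and has
  an inner part. Conjugation strips both ends and leaves the palindrome of index
  \<open>k - 1\<close> starting with \<open>j\<close>, to which \<open>dref_swap\<close>
  applies.\<close>

lemma cj_dref:
  assumes "2 \<le> k" "k \<le> m i j" shows "cj [i] (dref i j k) = dref i j (m i j + 2 - k)"
proof -
  obtain l where l: "k = Suc (Suc l)" using assms by (metis add_2_eq_Suc le_iff_add)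
  have e: "2 * k - 1 = Suc (Suc (Suc (2 * l)))" by (simp add: l)
  have "alternating i j (2 * k - 1) = i # alternating j i (Suc (2 * l)) @ [i]"
    unfolding e using alternating_snoc [of j i "Suc (2 * l)"] by simp
  then have "cj [i] (dref i j k) = cls ([i, i] @ alternating j i (Suc (2 * l)) @ [i, i])"
    by (simp add: dref_def cj_cls)
  also have "\<dots> = cls (alternating j i (Suc (2 * l)))"
    using cls_square [of "[]" i "alternating j i (Suc (2 * l)) @ [i, i]"]
      cls_square [of "alternating j i (Suc (2 * l))" i "[]"] by simp
  also have "\<dots> = dref j i (k - 1)" by (simp add: dref_def l)
  also have "\<dots> = dref i j (m i j + 1 - (k - 1))" by (rule dref_swap) (use assms in auto)
  also have "m i j + 1 - (k - 1) = m i j + 2 - k" using assms by simp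
  finally show ?thesis .
qed

definition dihedral_D :: "'i \<Rightarrow> 'i \<Rightarrow> nat \<Rightarrow> 'i free set" where
  "dihedral_D i j k = refl_D m (dref i j k)"

lemma dihedral_D_closed [simp]: "k \<ge> 1 \<Longrightarrow> dihedral_D i j k \<in> carrier H"
  by (simp add: dihedral_D_def dref_reflection)

lemma dihedral_D_swap:
  "1 \<le> l \<Longrightarrow> l \<le> m i j \<Longrightarrow> dihedral_D j i l = dihedral_D i j (m i j + 1 - l)"
  by (simp add: dihedral_D_def dref_swap)

lemma gen_involution: "ring_involution H (hW [i])"
  by (intro ring_involution.intro ring_involution_axioms.intro ring_Hhat)
    (use hW_rev(1) [of "[i]"] in simp_all)

lemma cnj_dihedral_D:
  assumes "i \<noteq> j" "2 \<le> k" "k \<le> m i j"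
  shows "ring_involution.cnj H (hW [i]) (dihedral_D i j k) = dihedral_D i j (m i j + 2 - k)"
proof -
  have "refl_D m (cj [i] (dref i j k)) = hW [i] \<otimes>\<^bsub>H\<^esub> refl_D m (dref i j k) \<otimes>\<^bsub>H\<^esub> hW (rev [i])"
    using assms dref_neq_gen [OF assms] by (intro refl_D_conj dref_reflection) (simp_all add: par_single)
  then show ?thesis
    using assms by (simp add: ring_involution.cnj_def [OF gen_involution] dihedral_D_def cj_dref)
qed

lemma cnj_hD: "ring_involution.cnj H (hW [i]) (hD i) = \<one>\<^bsub>H\<^esub> \<ominus>\<^bsub>H\<^esub> hD i \<ominus>\<^bsub>H\<^esub> hW [i]"
proof -
  interpret ring_involution H "hW [i]" by (rule gen_involution)
  let ?s = "hW [i]" and ?d = "hD i"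
  \<comment> \<open>The mixed relation of (i), multiplied on the right by
    \<open>s_i\<close>.\<close>
  have "(?s \<otimes>\<^bsub>H\<^esub> ?d \<oplus>\<^bsub>H\<^esub> ?d \<otimes>\<^bsub>H\<^esub> ?s) \<otimes>\<^bsub>H\<^esub> ?s = (?s \<ominus>\<^bsub>H\<^esub> \<one>\<^bsub>H\<^esub>) \<otimes>\<^bsub>H\<^esub> ?s"
    by (simp only: hW_hD)
  then have "cnj ?d \<oplus>\<^bsub>H\<^esub> ?d = \<one>\<^bsub>H\<^esub> \<ominus>\<^bsub>H\<^esub> ?s"
    by (simp add: cnj_def H.l_distr H.m_assoc s_square a_minus_def H.l_minus)
  then have "cnj ?d = (\<one>\<^bsub>H\<^esub> \<ominus>\<^bsub>H\<^esub> ?s) \<ominus>\<^bsub>H\<^esub> ?d"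
    by (simp add: H.add.inv_solve_right' [unfolded a_minus_def] a_minus_def H.add.inv_solve_right)
  also have "\<dots> = \<one>\<^bsub>H\<^esub> \<ominus>\<^bsub>H\<^esub> ?d \<ominus>\<^bsub>H\<^esub> ?s"
  proof -
    have "(x \<ominus>\<^bsub>H\<^esub> y) \<ominus>\<^bsub>H\<^esub> z = x \<ominus>\<^bsub>H\<^esub> z \<ominus>\<^bsub>H\<^esub> y"
      if "x \<in> carrier H" "y \<in> carrier H" "z \<in> carrier H" for x y z
      using that by (simp add: a_minus_def H.a_ac)
    then show ?thesis by simp
  qed
  finally show ?thesis .
qed

definition chain :: "'i \<Rightarrow> 'i \<Rightarrow> nat \<Rightarrow> nat \<Rightarrow> nat \<Rightarrow> 'i free set" where
  "chain i j n r a = dihedral_D i j (r + a * n)"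

text \<open>All residues and both directions are taken together, since conjugation by
  \<open>s_i\<close> leads from \<open>r\<close> to \<open>n + 2 - r\<close> and exchanging
  \<open>i\<close> with \<open>j\<close> leads from \<open>r\<close> to \<open>n + 1 - r\<close>,
  each time reversing the chain; for \<open>r = 1\<close> conjugation stays within the
  class.\<close>

definition dihedral_relators :: "'i \<Rightarrow> 'i \<Rightarrow> nat \<Rightarrow> 'i free set set" where
  "dihedral_relators i j n = (\<Union>r\<in>{1..n}.
     H.relators (chain i j n r) (m i j div n) \<union> H.relators (flip_chain (m i j div n) (chain i j n r)) (m i j div n))"

lemma chain_closed: "r \<ge> 1 \<Longrightarrow> chain i j n r a \<in> carrier H"
  by (simp add: chain_def)

text \<open>Written additively so that the index computations become linear in the products
  \<open>a * n\<close> and \<open>(q - 1 - a) * n\<close>.\<close>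

lemma chain_flip_index:
  assumes "M = q * n" "a < q"
  shows "(q - 1 - a) * n + (a * n + n) = (M::nat)"
proof -
  have "(q - 1 - a) * n + (a * n + n) = (q - 1 - a + a + 1) * n" by (simp add: algebra_simps)
  then show ?thesis using assms by simp
qed

lemma dihedral_relators_cnj:
  assumes "i \<noteq> j" "m i j \<noteq> 0" "n dvd m i j" and x: "x \<in> dihedral_relators i j n"
  shows "ring_involution.cnj H (hW [i]) x \<in> dihedral_relators i j n"
proof -
  interpret ring_involution H "hW [i]" by (rule gen_involution)
  define q where "q = m i j div n"
  have M: "m i j = q * n" using assms(3) by (simp add: q_def)
  have q: "q \<ge> 1" using M assms(2) by (cases q) auto
  obtain r where r: "r \<in> {1..n}" "x \<in> H.relators (chain i j n r) q \<union> H.relators (flip_chain q (chain i j n r)) q"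
    using x unfolding dihedral_relators_def q_def by auto
  show ?thesis
  proof (cases "r = 1")
    case True
    have "special_chain H (hW [i]) (chain i j n 1) q"
    proof (intro special_chain.intro special_chain_axioms.intro ring_involution_axioms)
      show "chain i j n 1 a \<in> carrier H" for a by (simp add: chain_closed)
      show "chain i j n 1 a \<otimes>\<^bsub>H\<^esub> chain i j n 1 a = chain i j n 1 a" for a
        by (simp add: chain_def dihedral_D_def refl_D_idem dref_reflection)
      have "chain i j n 1 0 = hD i" using dref_1 [of i j] by (simp add: chain_def dihedral_D_def refl_D_gen)
      then show "cnj (chain i j n 1 0) = \<one>\<^bsub>H\<^esub> \<ominus>\<^bsub>H\<^esub> chain i j n 1 0 \<ominus>\<^bsub>H\<^esub> hW [i]" by (simp add: cnj_hD)
      show "q \<ge> 1" by (rule q)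
      fix a assume a: "1 \<le> a" "a < q"
      have e: "(q - a) * n + a * n = m i j" using a by (simp add: M flip: add_mult_distrib)
      have n: "n \<ge> 1" using r by simp
      then have "a * n \<ge> 1" "(q - a) * n \<ge> 1" using a by simp_all
      then have "2 \<le> 1 + a * n" "1 + a * n \<le> m i j" "m i j + 2 - (1 + a * n) = 1 + (q - a) * n"
        using e by linarith+
      then show "cnj (chain i j n 1 a) = chain i j n 1 (q - a)"
        using cnj_dihedral_D [OF assms(1), of "1 + a * n"] by (simp add: chain_def)
    qed
    then interpret special_chain H "hW [i]" "chain i j n 1" q .
    show ?thesis
      using cnj_relators cnj_relators_flip r True unfolding dihedral_relators_def q_def [symmetric] by blast
  next
    case False
    \<comment> \<open>Indeed \<open>m + 2 - (r + a n) = (n + 2 - r) + (q - 1 - a) n\<close>. As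
      \<open>D_1\<close> does not occur in this class, conjugation only renames the chain, and being
      a homomorphism it carries relators to relators.\<close>
    define r' where "r' = n + 2 - r"
    have r': "r' \<in> {1..n}" using r False by (auto simp: r'_def)
    have conj: "cnj (chain i j n r a) = flip_chain q (chain i j n r') a" if a: "a < q" for a
    proof -
      note e = chain_flip_index [OF M a]
      have "2 \<le> r + a * n" "r + a * n \<le> m i j" "m i j + 2 - (r + a * n) = r' + (q - 1 - a) * n"
        using e r False by (auto simp: r'_def)
      then show ?thesis
        using cnj_dihedral_D [OF assms(1), of "r + a * n"] by (simp add: chain_def flip_chain_def)
    qed
    have conj': "cnj (flip_chain q (chain i j n r) a) = chain i j n r' a" if a: "a < q" for a
      using conj [of "q - 1 - a"] a by (simp add: flip_chain_def)
    have cl: "chain i j n r a \<in> carrier H" "chain i j n r' a \<in> carrier H" for a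
      using r r' by (simp_all add: chain_closed)
    then have fl: "flip_chain q (chain i j n r) a \<in> carrier H" "flip_chain q (chain i j n r') a \<in> carrier H" for a
      by (simp_all add: flip_chain_def)
    have "cnj x \<in> H.relators (chain i j n r') q \<union> H.relators (flip_chain q (chain i j n r')) q"
      using r(2)
    proof
      assume "x \<in> H.relators (chain i j n r) q"
      then have "cnj x \<in> H.relators (\<lambda>a. cnj (chain i j n r a)) q" using cl by (intro cnj.hom_relators)
      then show ?thesis using H.relators_cong [of q "\<lambda>a. cnj (chain i j n r a)", OF conj fl(2)] by simp
    next
      assume "x \<in> H.relators (flip_chain q (chain i j n r)) q"
      then have "cnj x \<in> H.relators (\<lambda>a. cnj (flip_chain q (chain i j n r) a)) q" using fl by (intro cnj.hom_relators)
      then show ?thesis using H.relators_cong [of q "\<lambda>a. cnj (flip_chain q (chain i j n r) a)", OF conj' cl(2)] by simp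
    qed
    then show ?thesis using r' unfolding dihedral_relators_def q_def [symmetric] by blast
  qed
qed

text \<open>Reduces conjugation by \<open>s_j\<close> to conjugation by \<open>s_i\<close>: with the
  roles of \<open>i\<close> and \<open>j\<close> exchanged, index \<open>k\<close> becomes
  \<open>m i j + 1 - k\<close>.\<close>

lemma dihedral_relators_swap_subset:
  assumes "m i j \<noteq> 0" "n dvd m i j"
  shows "dihedral_relators j i n \<subseteq> dihedral_relators i j n"
proof
  fix x assume x: "x \<in> dihedral_relators j i n"
  define q where "q = m i j div n"
  have M: "m i j = q * n" using assms by (simp add: q_def)
  have qq: "m j i div n = q" by (simp add: q_def m_sym [of j i])
  obtain r where r: "r \<in> {1..n}" "x \<in> H.relators (chain j i n r) q \<union> H.relators (flip_chain q (chain j i n r)) q"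
    using x unfolding dihedral_relators_def qq by auto
  define r' where "r' = n + 1 - r"
  have r': "r' \<in> {1..n}" using r by (auto simp: r'_def)
  have sw: "chain j i n r a = flip_chain q (chain i j n r') a" if a: "a < q" for a
  proof -
    note e = chain_flip_index [OF M a]
    have "1 \<le> r + a * n" "r + a * n \<le> m i j" "m i j + 1 - (r + a * n) = r' + (q - 1 - a) * n"
      using e r by (auto simp: r'_def)
    then show ?thesis
      using dihedral_D_swap [of "r + a * n" i j] by (simp add: chain_def flip_chain_def)
  qed
  have sw': "flip_chain q (chain j i n r) a = chain i j n r' a" if a: "a < q" for a
    using sw [of "q - 1 - a"] a by (simp add: flip_chain_def)
  have cl: "chain i j n r' a \<in> carrier H" for a using r' by (simp add: chain_closed)
  then have fl: "flip_chain q (chain i j n r') a \<in> carrier H" for a by (simp add: flip_chain_def)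
  have "H.relators (chain j i n r) q = H.relators (flip_chain q (chain i j n r')) q"
    by (rule H.relators_cong) (simp_all add: sw fl)
  moreover have "H.relators (flip_chain q (chain j i n r)) q = H.relators (chain i j n r') q"
    by (rule H.relators_cong) (simp_all add: sw' cl)
  ultimately show "x \<in> dihedral_relators i j n"
    using r r' unfolding dihedral_relators_def q_def [symmetric] by blast
qed

lemma Dhat_subring: "subring (Dhat m J) H"
  unfolding Dhat_def by (rule H.generate_ring_is_subring) auto

lemma dihedral_relators_Dhat: "dihedral_relators i j n \<subseteq> Dhat m {i, j}"
proof
  fix x assume x: "x \<in> dihedral_relators i j n"
  have D: "chain i j n r a \<in> Dhat m {i, j}" if "r \<ge> 1" for r a
    using that dref_reflection [of "r + a * n" i j] dref_parabolic [of i j "r + a * n"]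
    unfolding Dhat_def chain_def dihedral_D_def by (intro generate_ring.incl) auto
  then have F: "flip_chain q (chain i j n r) a \<in> Dhat m {i, j}" if "r \<ge> 1" for q r a
    using that by (simp add: flip_chain_def)
  have rel: "H.relators d q \<subseteq> Dhat m {i, j}" if d: "\<And>a. d a \<in> Dhat m {i, j}" for d q
  proof
    fix y assume "y \<in> H.relators d q"
    then show "y \<in> Dhat m {i, j}"
      using H.subring_yb_quad [OF Dhat_subring, of q d "{i, j}"] d subringE(5,7) [OF Dhat_subring]
      by (cases rule: H.relatorsE) (auto simp: a_minus_def)
  qed
  obtain r where r: "r \<ge> 1" "x \<in> H.relators (chain i j n r) (m i j div n)
      \<union> H.relators (flip_chain (m i j div n) (chain i j n r)) (m i j div n)"
    using x unfolding dihedral_relators_def by auto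
  show "x \<in> Dhat m {i, j}"
    using r(2) rel [of "chain i j n r", OF D [OF r(1)]]
      rel [of "flip_chain (m i j div n) (chain i j n r)", OF F [OF r(1)]] by blast
qed

lemma Dhat_closed: "x \<in> Dhat m J \<Longrightarrow> x \<in> carrier H"
  using subringE(1) [OF Dhat_subring] by blast

lemma dihedral_relators_word:
  assumes "i \<noteq> j" "m i j \<noteq> 0" "n dvd m i j" "set u \<subseteq> {i, j}" "x \<in> dihedral_relators i j n"
  shows "hW (rev u) \<otimes>\<^bsub>H\<^esub> x \<otimes>\<^bsub>H\<^esub> hW u \<in> dihedral_relators i j n"
  using assms(4,5)
proof (induction u arbitrary: x)
  case Nil
  then have "x \<in> carrier H" using dihedral_relators_Dhat Dhat_closed by blast
  then show ?case using Nil by simp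
next
  case (Cons a u)
  have xc: "x \<in> carrier H" using Cons.prems dihedral_relators_Dhat Dhat_closed by blast
  have "hW [a] \<otimes>\<^bsub>H\<^esub> x \<otimes>\<^bsub>H\<^esub> hW [a] \<in> dihedral_relators i j n"
  proof (cases "a = i")
    case True
    then show ?thesis
      using dihedral_relators_cnj [OF assms(1-3) Cons.prems(2)]
      by (simp add: ring_involution.cnj_def [OF gen_involution])
  next
    case False
    then have a: "a = j" using Cons.prems by auto
    have ji: "j \<noteq> i" "m j i \<noteq> 0" "n dvd m j i" using assms m_sym [of i j] by auto
    have "x \<in> dihedral_relators j i n" using dihedral_relators_swap_subset [OF ji(2,3)] Cons.prems by blast
    from dihedral_relators_cnj [OF ji this] show ?thesis
      using dihedral_relators_swap_subset [OF assms(2,3)] a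
      by (auto simp: ring_involution.cnj_def [OF gen_involution])
  qed
  from Cons.IH [OF _ this] Cons.prems show ?case
    using xc hW_append [of "[a]" u] by (simp add: hW_append H.m_assoc)
qed

text \<open>For each \<open>u\<close> in the dihedral subgroup, \<open>x\<close> is the
  \<open>u\<close>-conjugate of \<open>u^-1 x u\<close>, which is again a relator and hence lies in
  \<open>Dhat\<close>.\<close>

lemma dihedral_relators_K_alg:
  assumes "i \<noteq> j" "m i j \<noteq> 0" "n dvd m i j"
  shows "dihedral_relators i j n \<subseteq> K_alg m {i, j}"
proof
  fix x assume x: "x \<in> dihedral_relators i j n"
  have xc: "x \<in> carrier H" using x dihedral_relators_Dhat Dhat_closed by blast
  show "x \<in> K_alg m {i, j}"
    unfolding K_alg_def
  proof
    fix w assume "w \<in> parabolic m {i, j}"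
    then obtain u where u: "set u \<subseteq> {i, j}" "w = cls u" by (rule parabolicE)
    have "hW (rev u) \<otimes>\<^bsub>H\<^esub> x \<otimes>\<^bsub>H\<^esub> hW u \<in> Dhat m {i, j}"
      using dihedral_relators_word [OF assms u(1) x] dihedral_relators_Dhat by blast
    moreover have "x = hW u \<otimes>\<^bsub>H\<^esub> (hW (rev u) \<otimes>\<^bsub>H\<^esub> x \<otimes>\<^bsub>H\<^esub> hW u) \<otimes>\<^bsub>H\<^esub> hW (rev u)"
      using xc by (simp add: H.m_assoc)
    ultimately show "x \<in> (\<lambda>x. W_Hhat m w \<otimes>\<^bsub>H\<^esub> x \<otimes>\<^bsub>H\<^esub> W_Hhat m (inv\<^bsub>W\<^esub> w)) ` Dhat m {i, j}"
      unfolding u(2) inv_cls W_Hhat_cls by (rule image_eqI [rotated])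
  qed
qed

section \<open>Counit and degree of the relators\<close>

lemma counit_hom: "ring_hom_ring H int_ring counit"
proof (rule ring_hom_ringI2 [OF ring_Hhat])
  show "ring int_ring" using int_is_cring by (rule cring.axioms(1))
  show "counit \<in> ring_hom H int_ring"
    by (rule ring_hom_memI) (simp_all add: counit_mult counit_add counit_one)
qed

lemma counit_relators:
  assumes d: "\<And>a. d a \<in> carrier H" "\<And>a. counit (d a) = 0" and x: "x \<in> H.relators d q"
  shows "counit x = 0"
proof -
  interpret counit: ring_hom_ring H int_ring counit by (rule counit_hom)
  \<comment> \<open>The counit turns the chain into the zero chain, where all factors of one block
    are equal, so reversing the block changes nothing.\<close>
  have const: "ordered_prod int_ring (\<lambda>_. c) (rev xs) = ordered_prod int_ring (\<lambda>_. c) xs" for c and xs :: "nat list"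
  proof -
    have "ordered_prod int_ring (\<lambda>_. c) xs = c ^ length xs" for xs :: "nat list"
      by (induction xs) (simp_all add: ordered_prod_def)
    then show ?thesis by simp
  qed
  have yb: "counit (yb_left H d q t) = counit (yb_right H d q t)" if "t \<le> q" for t
  proof -
    have "counit (yb_left H d q t) = yb_left int_ring (\<lambda>a. 0) q t"
      "counit (yb_right H d q t) = yb_right int_ring (\<lambda>a. 0) q t"
      using counit.hom_yb [of q d t] d that by simp_all
    then show ?thesis by (simp add: yb_left_def yb_right_def const)
  qed
  have quad: "counit (quad_left H d q p) = counit (quad_right H d q p)" for p
  proof -
    have Z: "ring int_ring" using int_is_cring by (rule cring.axioms(1))
    have ag: "abelian_group int_ring" by (rule ring.is_abelian_group [OF Z])
    have "finsum int_ring (\<lambda>_. 0) A = 0" for A :: "nat set"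
      using abelian_monoid.finsum_zero [OF abelian_group.axioms(1) [OF ag], of A] by simp
    moreover have "0 \<ominus>\<^bsub>int_ring\<^esub> 0 = (0 :: int)"
      using ring.r_right_minus_eq [OF Z, of 0 0] by simp
    ultimately have "quad_left int_ring (\<lambda>a. 0) q p = quad_right int_ring (\<lambda>a. 0) q p"
      by (simp add: quad_left_def quad_right_def pair_sum_def)
    then show ?thesis using counit.hom_quad [of q d p] d by simp
  qed
  have m: "counit (a \<ominus>\<^bsub>H\<^esub> b) = 0" "counit (\<ominus>\<^bsub>H\<^esub> (a \<ominus>\<^bsub>H\<^esub> b)) = 0"
    if "a \<in> carrier H" "b \<in> carrier H" "counit a = counit b" for a b
  proof -
    show 1: "counit (a \<ominus>\<^bsub>H\<^esub> b) = 0" using that by (simp add: counit_minus)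
    show "counit (\<ominus>\<^bsub>H\<^esub> (a \<ominus>\<^bsub>H\<^esub> b)) = 0"
      using counit_minus [of "\<zero>\<^bsub>H\<^esub>" "a \<ominus>\<^bsub>H\<^esub> b"] that 1 by (simp add: counit_zero a_minus_def)
  qed
  from x show ?thesis
    by (cases rule: H.relatorsE)
      (use H.yb_closed [of q d] H.quad_closed [of q d] d(1) yb quad m in auto)
qed

lemma degree_le_subgroup: "subgroup (degree_le m k) (add_monoid H)"
  unfolding degree_le_def
  by (rule group.generate_is_subgroup [OF H.add.is_group]) (auto intro!: H.ordered_prod_closed)

lemma degree_le_closed: "x \<in> degree_le m k \<Longrightarrow> x \<in> carrier H"
  using subgroup.subset [OF degree_le_subgroup] by auto

lemma degree_le_add: "x \<in> degree_le m k \<Longrightarrow> y \<in> degree_le m k \<Longrightarrow> x \<oplus>\<^bsub>H\<^esub> y \<in> degree_le m k"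
  using subgroup.m_closed [OF degree_le_subgroup] by simp

lemma degree_le_uminus: "x \<in> degree_le m k \<Longrightarrow> \<ominus>\<^bsub>H\<^esub> x \<in> degree_le m k"
  using subgroup.m_inv_closed [OF degree_le_subgroup] by (simp add: a_inv_def)

lemma degree_le_minus: "x \<in> degree_le m k \<Longrightarrow> y \<in> degree_le m k \<Longrightarrow> x \<ominus>\<^bsub>H\<^esub> y \<in> degree_le m k"
  by (simp add: a_minus_def degree_le_add degree_le_uminus)

lemma degree_le_zero: "\<zero>\<^bsub>H\<^esub> \<in> degree_le m k"
  using subgroup.one_closed [OF degree_le_subgroup] by simp

lemma degree_le_mono:
  assumes "k \<le> l" shows "degree_le m k \<subseteq> degree_le m l"
  unfolding degree_le_def by (rule group.mono_generate [OF H.add.is_group]) (use assms in auto)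

lemma degree_le_one: "\<one>\<^bsub>H\<^esub> \<in> degree_le m k"
  unfolding degree_le_def by (rule generate.incl) (auto intro!: exI [of _ "[]"])

lemma degree_le_mult:
  assumes t: "t \<in> reflections m" and x: "x \<in> degree_le m k"
  shows "refl_D m t \<otimes>\<^bsub>H\<^esub> x \<in> degree_le m (Suc k)"
  using x unfolding degree_le_def [of m k]
proof (induction rule: generate.induct)
  case one
  show ?case using t by (simp add: degree_le_zero)
next
  case (incl h)
  then obtain ss where ss: "h = ordered_prod H (refl_D m) ss" "set ss \<subseteq> reflections m" "length ss \<le> k" by auto
  show ?case
    unfolding degree_le_def by (rule generate.incl) (use ss t in \<open>auto intro!: exI [of _ "t # ss"]\<close>)
next
  case ("inv" h)
  then obtain ss where ss: "h = ordered_prod H (refl_D m) ss" "set ss \<subseteq> reflections m" "length ss \<le> k" by auto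
  then have hc: "h \<in> carrier H" by (auto intro!: H.ordered_prod_closed)
  have "refl_D m t \<otimes>\<^bsub>H\<^esub> h \<in> degree_le m (Suc k)"
    unfolding degree_le_def by (rule generate.incl) (use ss t in \<open>auto intro!: exI [of _ "t # ss"]\<close>)
  from degree_le_uminus [OF this] show ?case
    unfolding a_inv_def [symmetric] using hc t by (simp add: H.r_minus)
next
  case (eng h1 h2)
  then have "h1 \<in> carrier H" "h2 \<in> carrier H"
    using degree_le_closed [of _ k] by (auto simp: degree_le_def)
  then show ?case using eng t by (simp add: H.r_distr degree_le_add)
qed

lemma degree_le_finsum:
  assumes "\<And>a. a \<in> A \<Longrightarrow> f a \<in> degree_le m k" shows "finsum H f A \<in> degree_le m k"
  using assms
proof (induction A rule: infinite_finite_induct)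
  case (insert a A)
  then have "f \<in> A \<rightarrow> carrier H" "f a \<in> carrier H" by (auto intro: degree_le_closed)
  then show ?case using insert by (simp add: degree_le_add)
qed (simp_all add: degree_le_zero)

text \<open>The right factor \<open>x\<close> allows the two blocks of a Yang-Baxter product to be
  bounded one after the other.\<close>

lemma degree_le_ordered_prod:
  assumes "\<And>a. t a \<in> reflections m" "x \<in> degree_le m k"
  shows "ordered_prod H (\<lambda>a. refl_D m (t a)) xs \<otimes>\<^bsub>H\<^esub> x \<in> degree_le m (length xs + k)"
    and "ordered_prod H (\<lambda>a. \<one>\<^bsub>H\<^esub> \<ominus>\<^bsub>H\<^esub> refl_D m (t a)) xs \<otimes>\<^bsub>H\<^esub> x \<in> degree_le m (length xs + k)"
proof -
  have xc: "x \<in> carrier H" by (rule degree_le_closed [OF assms(2)])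
  have D: "refl_D m (t a) \<in> carrier H" for a using assms(1) by simp
  have P: "ordered_prod H (\<lambda>a. refl_D m (t a)) xs \<in> carrier H"
    "ordered_prod H (\<lambda>a. \<one>\<^bsub>H\<^esub> \<ominus>\<^bsub>H\<^esub> refl_D m (t a)) xs \<in> carrier H" for xs
    using D by (auto intro!: H.ordered_prod_closed)
  show "ordered_prod H (\<lambda>a. refl_D m (t a)) xs \<otimes>\<^bsub>H\<^esub> x \<in> degree_le m (length xs + k)"
    using xc D P assms by (induction xs) (simp_all add: H.m_assoc degree_le_mult)
  show "ordered_prod H (\<lambda>a. \<one>\<^bsub>H\<^esub> \<ominus>\<^bsub>H\<^esub> refl_D m (t a)) xs \<otimes>\<^bsub>H\<^esub> x \<in> degree_le m (length xs + k)"
  proof (induction xs)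
    case (Cons a xs)
    let ?y = "ordered_prod H (\<lambda>a. \<one>\<^bsub>H\<^esub> \<ominus>\<^bsub>H\<^esub> refl_D m (t a)) xs \<otimes>\<^bsub>H\<^esub> x"
    have yc: "?y \<in> carrier H" using P xc by simp
    have "?y \<ominus>\<^bsub>H\<^esub> refl_D m (t a) \<otimes>\<^bsub>H\<^esub> ?y \<in> degree_le m (Suc (length xs + k))"
      using Cons.IH degree_le_mono [of "length xs + k" "Suc (length xs + k)"]
      by (intro degree_le_minus degree_le_mult assms) auto
    moreover have "(\<one>\<^bsub>H\<^esub> \<ominus>\<^bsub>H\<^esub> refl_D m (t a)) \<otimes>\<^bsub>H\<^esub> ?y = ?y \<ominus>\<^bsub>H\<^esub> refl_D m (t a) \<otimes>\<^bsub>H\<^esub> ?y"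
      using yc D [of a] by (simp add: a_minus_def H.l_distr H.l_minus)
    ultimately show ?case using P xc D by (simp add: H.m_assoc)
  qed (use assms xc in simp)
qed

text \<open>A Yang-Baxter product has \<open>q\<close> factors and a quadratic term has two, which
  explains the two bounds on \<open>k\<close>; the intended value is
  \<open>k = m i j\<close>.\<close>

lemma degree_le_relators:
  assumes t: "\<And>a. t a \<in> reflections m" and x: "x \<in> H.relators (\<lambda>a. refl_D m (t a)) q"
    and "q \<le> k" "2 \<le> k"
  shows "x \<in> degree_le m k"
proof -
  let ?d = "\<lambda>a. refl_D m (t a)"
  have D: "?d a \<in> carrier H" for a using t by simp
  have P: "ordered_prod H ?d xs \<in> carrier H" "ordered_prod H (\<lambda>a. \<one>\<^bsub>H\<^esub> \<ominus>\<^bsub>H\<^esub> ?d a) xs \<in> carrier H" for xs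
    using D by (auto intro!: H.ordered_prod_closed)
  have base: "ordered_prod H ?d xs \<in> degree_le m (length xs)"
    "ordered_prod H (\<lambda>a. \<one>\<^bsub>H\<^esub> \<ominus>\<^bsub>H\<^esub> ?d a) xs \<in> degree_le m (length xs)" for xs
    using degree_le_ordered_prod [of t "\<one>\<^bsub>H\<^esub>" 0 xs, OF t degree_le_one] P by simp_all
  have yb: "yb_left H ?d q s \<in> degree_le m k" "yb_right H ?d q s \<in> degree_le m k" if "s \<le> q" for s
  proof -
    have "yb_left H ?d q s \<in> degree_le m (length [s..<q] + length [0..<s])"
      unfolding yb_left_def by (intro degree_le_ordered_prod t base)
    moreover have "yb_right H ?d q s \<in> degree_le m (length (rev [0..<s]) + length (rev [s..<q]))"
      unfolding yb_right_def by (intro degree_le_ordered_prod t base)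
    ultimately show "yb_left H ?d q s \<in> degree_le m k" "yb_right H ?d q s \<in> degree_le m k"
      using degree_le_mono [OF \<open>q \<le> k\<close>] that by auto
  qed
  have d1: "?d a \<in> degree_le m 1" for a using base(1) [of "[a]"] D by simp
  then have d2: "?d a \<otimes>\<^bsub>H\<^esub> ?d b \<in> degree_le m 2" for a b
    using degree_le_mult [OF t d1] by (simp add: numeral_2_eq_2)
  have quad: "quad_left H ?d q p \<in> degree_le m k" "quad_right H ?d q p \<in> degree_le m k" for p
    unfolding quad_left_def quad_right_def pair_sum_def
    using d1 d2 degree_le_mono [of 1 k] degree_le_mono [of 2 k] \<open>2 \<le> k\<close>
    by (auto intro!: degree_le_minus degree_le_finsum)
  from x show ?thesis
    by (cases rule: H.relatorsE) (auto intro!: degree_le_minus degree_le_uminus yb quad)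
qed

lemma dihedral_relators_K2:
  assumes "i \<noteq> j" "m i j \<ge> 2" "n dvd m i j"
  shows "dihedral_relators i j n \<subseteq> K2 m i j"
proof
  fix x assume x: "x \<in> dihedral_relators i j n"
  define q where "q = m i j div n"
  have q: "q \<le> m i j" by (simp add: q_def)
  obtain t where t: "\<And>a. t a \<in> reflections m" "x \<in> H.relators (\<lambda>a. refl_D m (t a)) q"
  proof -
    obtain r where r: "r \<in> {1..n}" "x \<in> H.relators (chain i j n r) q \<or> x \<in> H.relators (flip_chain q (chain i j n r)) q"
      using x unfolding dihedral_relators_def q_def by auto
    have "chain i j n r = (\<lambda>a. refl_D m (dref i j (r + a * n)))"
      "flip_chain q (chain i j n r) = (\<lambda>a. refl_D m (dref i j (r + (q - 1 - a) * n)))"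
      by (simp_all add: chain_def flip_chain_def dihedral_D_def fun_eq_iff)
    then show ?thesis using r that dref_reflection by (metis atLeastAtMost_iff trans_le_add1)
  qed
  have "counit x = 0" by (rule counit_relators [OF _ _ t(2)]) (use t(1) in \<open>simp_all add: counit_refl_D\<close>)
  moreover have "x \<in> degree_le m (m i j)" by (rule degree_le_relators [OF t q assms(2)])
  moreover have "x \<in> K_alg m {i, j}" using dihedral_relators_K_alg [of i j n] assms x by auto
  ultimately show "x \<in> K2 m i j" by (simp add: K2_def)
qed

section \<open>Passage to the quotient and to conjugates by \<open>w\<close>\<close>

lemma K2_closed: "K2 m i j \<subseteq> carrier H"
proof
  fix x assume "x \<in> K2 m i j"
  then have "x \<in> degree_le m (m i j)" by (simp add: K2_def)
  then show "x \<in> carrier H" by (rule degree_le_closed)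
qed

lemma J_ideal_ideal: "ideal (J_ideal m) H"
  unfolding J_ideal_def by (rule H.genideal_ideal) (use K2_closed in blast)

lemma K2_J_ideal: "i \<noteq> j \<Longrightarrow> K2 m i j \<subseteq> J_ideal m"
proof -
  let ?S = "\<Union>i. \<Union>j\<in>- {i}. K2 m i j"
  assume "i \<noteq> j"
  then have "K2 m i j \<subseteq> ?S" by (intro subsetI UN_I [of i] UN_I [of j]) auto
  moreover have "?S \<subseteq> carrier H" by (intro UN_least K2_closed)
  ultimately show ?thesis unfolding J_ideal_def using H.genideal_self [of ?S] by (meson subset_trans)
qed

lemma to_H_hom: "ring_hom_ring H (Hecke_Hopf m) (to_H m)"
proof -
  have "to_H m = (+>\<^bsub>H\<^esub>) (J_ideal m)" by (rule ext) (simp add: to_H_def)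
  then show ?thesis using ideal.rcos_ring_hom_ring [OF J_ideal_ideal] by (simp add: Hecke_Hopf_def)
qed

sublocale quot: ring_hom_ring H "Hecke_Hopf m" "to_H m" by (rule to_H_hom)

lemma to_H_ideal: "x \<in> J_ideal m \<Longrightarrow> to_H m x = \<zero>\<^bsub>Hecke_Hopf m\<^esub>"
  unfolding to_H_def Hecke_Hopf_def by (simp add: FactRing_def H.a_rcos_zero [OF J_ideal_ideal])

lemma conj_to_H_hom: "ring_hom_ring H (Hecke_Hopf m) (\<lambda>x. to_H m (hW v \<otimes>\<^bsub>H\<^esub> x \<otimes>\<^bsub>H\<^esub> hW (rev v)))"
proof (rule ring_hom_ringI2 [OF ring_Hhat quot.S.ring_axioms])
  have "(\<lambda>x. hW v \<otimes>\<^bsub>H\<^esub> x \<otimes>\<^bsub>H\<^esub> hW (rev v)) \<in> ring_hom H H"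
    by (rule ring_hom_memI) (simp_all add: H.m_assoc H.l_distr H.r_distr)
  from ring_hom_trans [OF this quot.homh]
  show "(\<lambda>x. to_H m (hW v \<otimes>\<^bsub>H\<^esub> x \<otimes>\<^bsub>H\<^esub> hW (rev v))) \<in> ring_hom H (Hecke_Hopf m)" by (simp add: comp_def)
qed

lemma D_ring_subring: "subring (to_H m ` Dhat m UNIV) (Hecke_Hopf m)"
  by (rule quot.img_is_subring [OF Dhat_subring])

lemma ring_D_ring: "ring (D_ring m)"
  unfolding D_ring_def by (rule quot.S.subring_is_ring [OF D_ring_subring])

lemma D_ring_inclusion: "ring_hom_ring (D_ring m) (Hecke_Hopf m) (\<lambda>x. x)"
  unfolding D_ring_def by (rule quot.S.subring_inclusion_hom [OF D_ring_subring])

lemma D_ring_carrier: "carrier (D_ring m) = to_H m ` Dhat m UNIV"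
  by (simp add: D_ring_def)

lemma refl_D_D_ring: "t \<in> reflections m \<Longrightarrow> to_H m (refl_D m t) \<in> carrier (D_ring m)"
proof -
  assume t: "t \<in> reflections m"
  then obtain u where "t = cls u" using reflections_closed carrierE by metis
  then have "t \<in> parabolic m UNIV" by (simp add: parabolic_cls)
  then show ?thesis
    using t unfolding D_ring_carrier Dhat_def by (intro imageI generate_ring.incl) simp
qed

lemma D_dihedral_cls: "D_dihedral m (cls v) i j k = to_H m (refl_D m (cj v (dref i j k)))"
  by (simp add: D_dihedral_def cj_def dref_def)

lemma D_dihedral_closed: "k \<ge> 1 \<Longrightarrow> D_dihedral m (cls v) i j k \<in> carrier (D_ring m)"
  unfolding D_dihedral_cls by (intro refl_D_D_ring cj_reflections dref_reflection)

text \<open>By \<open>par_parabolic\<close> the conditions at the two generators extend to every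
  reflection of the dihedral subgroup, so \<open>refl_D_conj\<close> applies to each of
  them.\<close>

lemma D_dihedral_conj:
  assumes "\<not> par (rev v) (gen i)" "\<not> par (rev v) (gen j)" "k \<ge> 1"
  shows "D_dihedral m (cls v) i j k = to_H m (hW v \<otimes>\<^bsub>H\<^esub> dihedral_D i j k \<otimes>\<^bsub>H\<^esub> hW (rev v))"
proof -
  have "\<not> par (rev v) (dref i j k)"
    unfolding dref_def using assms by (intro par_parabolic [of "{i, j}"] set_alternating) auto
  then show ?thesis
    using assms(3) by (simp add: D_dihedral_cls dihedral_D_def refl_D_conj dref_reflection)
qed

lemma relators_D_ring:
  assumes ij: "i \<noteq> j" "m i j \<ge> 2" "n dvd m i j" and r: "1 \<le> r" "r \<le> n"
    and v: "\<not> par (rev v) (gen i)" "\<not> par (rev v) (gen j)"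
  defines "q \<equiv> m i j div n"
  defines "d \<equiv> \<lambda>a. D_dihedral m (cls v) i j (r + a * n)"
  shows "t \<le> q \<Longrightarrow> yb_left (D_ring m) d q t = yb_right (D_ring m) d q t"
    and "1 \<le> p \<Longrightarrow> 2 * p < q \<Longrightarrow> quad_left (D_ring m) d q p = quad_right (D_ring m) d q p"
    and "1 \<le> p \<Longrightarrow> 2 * p < q \<Longrightarrow>
      quad_left (D_ring m) (flip_chain q d) q p = quad_right (D_ring m) (flip_chain q d) q p"
proof -
  define h where "h = (\<lambda>x. to_H m (hW v \<otimes>\<^bsub>H\<^esub> x \<otimes>\<^bsub>H\<^esub> hW (rev v)))"
  interpret h: ring_hom_ring H "Hecke_Hopf m" h unfolding h_def by (rule conj_to_H_hom)
  \<comment> \<open>Sums in \<open>D_ring m\<close> refer to its smaller carrier; the inclusion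
    identifies them with sums in \<open>Hecke_Hopf m\<close>, where the relations are
    obtained.\<close>
  interpret incl: ring_hom_ring "D_ring m" "Hecke_Hopf m" "\<lambda>x. x" by (rule D_ring_inclusion)
  define e where "e = chain i j n r"
  have he: "h (e a) = d a" for a
    unfolding h_def e_def d_def chain_def using v r by (subst D_dihedral_conj) simp_all
  have hf: "h (flip_chain q e a) = flip_chain q d a" for a by (simp add: flip_chain_def he)
  have ec: "e a \<in> carrier H" "flip_chain q e a \<in> carrier H" for a
    using r by (simp_all add: e_def chain_closed flip_chain_def)
  have dc: "d a \<in> carrier (D_ring m)" "flip_chain q d a \<in> carrier (D_ring m)" for a
    using r by (simp_all add: d_def D_dihedral_closed flip_chain_def)
  \<comment> \<open>The ideal is two-sided, so it contains the conjugate by \<open>v\<close> of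
    every relator.\<close>
  have zero: "h x = h y" if "x \<ominus>\<^bsub>H\<^esub> y \<in> dihedral_relators i j n" "x \<in> carrier H" "y \<in> carrier H" for x y
  proof -
    have "x \<ominus>\<^bsub>H\<^esub> y \<in> J_ideal m"
      using that(1) dihedral_relators_K2 [OF ij] K2_J_ideal [OF ij(1)] by blast
    then have "hW v \<otimes>\<^bsub>H\<^esub> (x \<ominus>\<^bsub>H\<^esub> y) \<otimes>\<^bsub>H\<^esub> hW (rev v) \<in> J_ideal m"
      by (intro ideal.I_r_closed [OF J_ideal_ideal] ideal.I_l_closed [OF J_ideal_ideal]) simp_all
    then have "h (x \<ominus>\<^bsub>H\<^esub> y) = \<zero>\<^bsub>Hecke_Hopf m\<^esub>" by (simp add: h_def to_H_ideal)
    then show "h x = h y" using that by (simp add: h.hom_minus quot.S.r_right_minus_eq)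
  qed
  have mem: "H.relators e q \<subseteq> dihedral_relators i j n" "H.relators (flip_chain q e) q \<subseteq> dihedral_relators i j n"
    using r unfolding dihedral_relators_def q_def e_def by auto
  show "yb_left (D_ring m) d q t = yb_right (D_ring m) d q t" if t: "t \<le> q"
  proof -
    have "h (yb_left H e q t) = h (yb_right H e q t)"
      using mem(1) H.relatorsI(1) [OF t, of e] H.yb_closed [of q e t] ec t by (intro zero) auto
    then show ?thesis
      using h.hom_yb [of q e t] incl.hom_yb [of q d t] ec dc t by (simp add: he)
  qed
  assume p: "1 \<le> p" "2 * p < q"
  show "quad_left (D_ring m) d q p = quad_right (D_ring m) d q p"
  proof -
    have "h (quad_left H e q p) = h (quad_right H e q p)"
      using mem(1) H.relatorsI(3) [OF p, of e] H.quad_closed [of q e p] ec by (intro zero) auto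
    then show ?thesis
      using h.hom_quad [of q e p] incl.hom_quad [of q d p] ec dc by (simp add: he)
  qed
  show "quad_left (D_ring m) (flip_chain q d) q p = quad_right (D_ring m) (flip_chain q d) q p"
  proof -
    have "h (quad_left H (flip_chain q e) q p) = h (quad_right H (flip_chain q e) q p)"
      using mem(2) H.relatorsI(3) [OF p, of "flip_chain q e"] H.quad_closed [of q "flip_chain q e" p] ec
      by (intro zero) auto
    then show ?thesis
      using h.hom_quad [of q "flip_chain q e" p] incl.hom_quad [of q "flip_chain q d" p] ec dc by (simp add: hf)
  qed
qed

end

theorem theorem1p34:
  fixes m :: "'i \<Rightarrow> 'i \<Rightarrow> nat" and i j :: 'i and w :: "'i list set" and n r :: nat
  assumes "coxeter_matrix m"
    and "i \<noteq> j" and "m i j \<ge> 2"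
    and "w \<in> carrier (coxeter_group m)"
    and "cox_length m (w \<otimes>\<^bsub>coxeter_group m\<^esub> cox_gen m i) = cox_length m w + 1"
    and "cox_length m (w \<otimes>\<^bsub>coxeter_group m\<^esub> cox_gen m j) = cox_length m w + 1"
    and "n dvd m i j" and "1 \<le> r" and "r \<le> n"
  shows "let R = D_ring m; q = m i j div n; d = (\<lambda>a. D_dihedral m w i j (r + a * n)) in
    (\<forall>p. 1 \<le> p \<and> real p < real (m i j) / (2 * real n) \<longrightarrow>
        finsum R (\<lambda>(a, b). d a \<otimes>\<^bsub>R\<^esub> d b) {(a, b). a < b \<and> b < q \<and> b - a = q - p}
        = finsum R (\<lambda>(a, b). d b \<otimes>\<^bsub>R\<^esub> d a) {(a, b). a < b \<and> b < q \<and> b - a = p}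
          \<ominus>\<^bsub>R\<^esub> (\<Oplus>\<^bsub>R\<^esub>c\<in>{p..<q - p}. d c)
      \<and> finsum R (\<lambda>(a, b). d b \<otimes>\<^bsub>R\<^esub> d a) {(a, b). a < b \<and> b < q \<and> b - a = q - p}
        = finsum R (\<lambda>(a, b). d a \<otimes>\<^bsub>R\<^esub> d b) {(a, b). a < b \<and> b < q \<and> b - a = p}
          \<ominus>\<^bsub>R\<^esub> (\<Oplus>\<^bsub>R\<^esub>c\<in>{p..<q - p}. d c))
    \<and> (\<forall>t\<le>q.
        ordered_prod R (\<lambda>a. \<one>\<^bsub>R\<^esub> \<ominus>\<^bsub>R\<^esub> d a) [t..<q] \<otimes>\<^bsub>R\<^esub> ordered_prod R d [0..<t]
        = ordered_prod R d (rev [0..<t]) \<otimes>\<^bsub>R\<^esub>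
          ordered_prod R (\<lambda>a. \<one>\<^bsub>R\<^esub> \<ominus>\<^bsub>R\<^esub> d a) (rev [t..<q]))"
proof -
  interpret coxeter m by (rule coxeter.intro [OF assms(1)])
  interpret D: ring "D_ring m" by (rule ring_D_ring)
  obtain v where w: "w = cls v" using assms(4) by (rule carrierE)
  define q where "q = m i j div n"
  define d where "d = (\<lambda>a. D_dihedral m w i j (r + a * n))"
  have v: "\<not> par (rev v) (gen i)" "\<not> par (rev v) (gen j)"
    using assms(5,6) [unfolded w] par_right_descent by blast+
  note rels = relators_D_ring [OF assms(2,3,7-9) v, folded w, folded q_def d_def]
  have dc: "d a \<in> carrier (D_ring m)" for a
    unfolding d_def w using assms(8) by (simp add: D_dihedral_closed)
  have n: "n \<ge> 1" "m i j = q * n" using assms(7-9) by (simp_all add: q_def)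
  have quad:
    "finsum (D_ring m) (\<lambda>(a, b). d a \<otimes>\<^bsub>D_ring m\<^esub> d b) {(a, b). a < b \<and> b < q \<and> b - a = q - p}
        = finsum (D_ring m) (\<lambda>(a, b). d b \<otimes>\<^bsub>D_ring m\<^esub> d a) {(a, b). a < b \<and> b < q \<and> b - a = p}
          \<ominus>\<^bsub>D_ring m\<^esub> (\<Oplus>\<^bsub>D_ring m\<^esub>c\<in>{p..<q - p}. d c)
      \<and> finsum (D_ring m) (\<lambda>(a, b). d b \<otimes>\<^bsub>D_ring m\<^esub> d a) {(a, b). a < b \<and> b < q \<and> b - a = q - p}
        = finsum (D_ring m) (\<lambda>(a, b). d a \<otimes>\<^bsub>D_ring m\<^esub> d b) {(a, b). a < b \<and> b < q \<and> b - a = p}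
          \<ominus>\<^bsub>D_ring m\<^esub> (\<Oplus>\<^bsub>D_ring m\<^esub>c\<in>{p..<q - p}. d c)"
    if p: "1 \<le> p" "real p < real (m i j) / (2 * real n)" for p
  proof -
    \<comment> \<open>The bound on \<open>p\<close> is a real quotient in the statement; with
      \<open>m i j = q * n\<close> it becomes a condition on naturals.\<close>
    have "real (2 * p) < real q" using p(2) n by (simp add: field_simps)
    then have p2: "2 * p < q" by linarith
    then have k: "q - p \<ge> 1" by simp
    have pairs: "finsum (D_ring m) (\<lambda>(a, b). d a \<otimes>\<^bsub>D_ring m\<^esub> d b) {(a, b). a < b \<and> b < q \<and> b - a = k}
        = pair_sum (D_ring m) (\<lambda>a b. d a \<otimes>\<^bsub>D_ring m\<^esub> d b) q k"
      "finsum (D_ring m) (\<lambda>(a, b). d b \<otimes>\<^bsub>D_ring m\<^esub> d a) {(a, b). a < b \<and> b < q \<and> b - a = k}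
        = pair_sum (D_ring m) (\<lambda>a b. d b \<otimes>\<^bsub>D_ring m\<^esub> d a) q k" if "k \<ge> 1" for k
      by (rule D.finsum_pairs; use dc that in simp)+
    \<comment> \<open>The second quadratic relation is \<open>rels(3)\<close>, the first relation of
      the reversed chain, rewritten by \<open>quad_flip\<close>; only the sides for \<open>d\<close>
      itself are unfolded.\<close>
    show ?thesis
      unfolding pairs [OF k] pairs [OF p(1)]
      using rels(2,3) [OF p(1) p2] D.quad_flip [of d q p] dc
      unfolding quad_left_def [of _ d] quad_right_def [of _ d] by simp
  qed
  show ?thesis
    unfolding Let_def q_def [symmetric] d_def [symmetric]
    using quad rels(1) unfolding yb_left_def yb_right_def by blast
qed

end
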